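(* Fix $p\in[1,\infty)$ and let $g\in H^p(\mathbb{B}^d)$ be such that $\|g\|_p\le1$ and $1/g\in H^\infty(\mathbb{B}^d)$. Let $w=|g|^p$ (on $\mathbb{B}^d$, and $\sigma$-a.e. on $\partial\mathbb{B}^d$ through boundary values). Let $\mu_{\mathrm{s}}$ be a discrete measure on $\partial\mathbb{B}^d$ such that $d\mu(\zeta):=w(\zeta)\,d\sigma(\zeta)+d\mu_{\mathrm{s}}(\zeta)$ is a probability measure, and let $(\gamma_{\alpha,\beta})_{\alpha,\beta\in\mathbb{N}_0^d}$ be the Verblunsky coefficients of $\mu$. Then $$\prod_{\alpha\in\mathbb{N}_0^d}(1-|\gamma_{0,\alpha}|^2)=\exp\left(\int_{\partial\mathbb{B}^d}\log(w(\zeta))\,d\sigma(\zeta)\right).$$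
   Context: $\mathbb{B}^d$ is the open unit ball of $\mathbb{C}^d$, $\partial\mathbb{B}^d$ the unit sphere, $\sigma$ the rotation-invariant Lebesgue probability measure on $\partial\mathbb{B}^d$. $H^p(\mathbb{B}^d)$ is the space of holomorphic $g$ on $\mathbb{B}^d$ with $\|g\|_p^p=\sup_{0<r<1}\int_{\partial\mathbb{B}^d}|g(r\zeta)|^pd\sigma(\zeta)<\infty$, and $H^\infty(\mathbb{B}^d)$ the space of bounded holomorphic functions. For $\sigma$-a.e. $\zeta$, $g(\zeta)$ denotes the $K$-limit of $g$ at $\zeta$ (limit as $z\to\zeta$ within each Kor\'anyi region $\{z\in\mathbb{B}^d:|1-\langle z,\zeta\rangle|<\frac c2(1-\|z\|^2)\}$, $c>1$), which exists $\sigma$-a.e. and coincides with the radial limit. A measure is discrete if it is a countable sum $\sum_k\rho_k\delta_{\zeta_k}$, $\rho_k>0$, of point masses (possibly zero). Shortlex order $\prec$ on $\mathbb{N}_0^d$: $\alpha\prec\beta$ if $|\alpha|<|\beta|$ (where $|\alpha|=\sum\alpha_i$), or if $|\alpha|=|\beta|$ and $\alpha_i>\beta_i$ at the first index where they differ. Infinite products over $\mathbb{N}_0^d$ are limits of partial products in this order. Verblunsky coefficients of $\mu$: let $K(\alpha,\beta)=\int_{\partial\mathbb{B}^d}\zeta^\alpha\overline{\zeta}^\beta d\mu$ (its finite sections are positive definite here). For $\alpha\prec\beta$ let $S=\{\delta:\alpha\prec\delta\prec\beta\}$, $M=[K(\delta,\delta')]_{\delta,\delta'\in S}$, $u=[K(\alpha,\delta)]_{\delta\in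 S}$ (row), $v=[K(\delta,\beta)]_{\delta\in S}$ (column), and $$\gamma_{\alpha,\beta}=\frac{K(\alpha,\beta)-uM^{-1}v}{\sqrt{K(\alpha,\alpha)-uM^{-1}u^*}\,\sqrt{K(\beta,\beta)-v^*M^{-1}v}},$$ where terms involving $M$ are omitted if $S=\emptyset$; $\gamma_{\alpha,\alpha}=0$, $\gamma_{\beta,\alpha}=\overline{\gamma_{\alpha,\beta}}$. *)

theory Defs
  imports "HOL-Probability.Probability"
begin

section \<open>Function theory on the unit ball of \<open>\<complex>\<^sup>d\<close>\<close>

text \<open>\<open>\<complex>\<^sup>d\<close> is \<^typ>\<open>complex ^ 'n\<close> with \<open>d = CARD('n)\<close>; its library norm is the Hermitian norm, so
  \<open>ball 0 1\<close> is the unit ball and \<open>sphere 0 1\<close> the unit sphere.\<close>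

definition cinner :: "complex ^ 'n \<Rightarrow> complex ^ 'n \<Rightarrow> complex" where
  "cinner z \<zeta> = (\<Sum>i\<in>UNIV. z $ i * cnj (\<zeta> $ i))"

text \<open>Holomorphy in several variables: complex (Frechet) differentiability at every point, i.e. the
  real derivative exists and is complex linear. Only used for open \<open>S\<close>.\<close>

definition mv_holomorphic_on :: "(complex ^ 'n \<Rightarrow> complex) \<Rightarrow> (complex ^ 'n) set \<Rightarrow> bool" where
  "mv_holomorphic_on f S \<longleftrightarrow>
     (\<forall>z\<in>S. \<exists>D. (f has_derivative D) (at z) \<and> (\<forall>c v. D (c *s v) = c * D v))"

text \<open>The rotation-invariant probability measure on the unit sphere: the image of normalised Lebesgue
  measure on the unit ball under \<open>x \<mapsto> x / \<parallel>x\<parallel>\<close>. It is a Borel measure on the whole space carried by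
  the sphere; see \<open>prob_space_sphere_measure\<close>, \<open>AE_sphere_measure\<close> and
  \<open>sphere_measure_rotation_invariant\<close> below.\<close>

definition sphere_measure :: "'a::euclidean_space measure" where
  "sphere_measure = distr (uniform_measure lborel (ball 0 1)) borel (\<lambda>x. x /\<^sub>R norm x)"

definition hardy_mean :: "real \<Rightarrow> (complex ^ 'n \<Rightarrow> complex) \<Rightarrow> ennreal" where
  "hardy_mean p g =
     (SUP r\<in>{0<..<1}. \<integral>\<^sup>+ \<zeta>\<in>sphere 0 1. ennreal (norm (g (r *\<^sub>R \<zeta>)) powr p) \<partial>sphere_measure)"

definition hardy_space :: "real \<Rightarrow> (complex ^ 'n \<Rightarrow> complex) set" where
  "hardy_space p = {g. mv_holomorphic_on g (ball 0 1) \<and> hardy_mean p g < \<infinity>}"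

definition hardy_norm :: "real \<Rightarrow> (complex ^ 'n \<Rightarrow> complex) \<Rightarrow> real" where
  "hardy_norm p g = enn2real (hardy_mean p g) powr (1 / p)"

definition hardy_inf :: "(complex ^ 'n \<Rightarrow> complex) set" where
  "hardy_inf = {g. mv_holomorphic_on g (ball 0 1) \<and> bounded (g ` ball 0 1)}"

definition koranyi_region :: "real \<Rightarrow> complex ^ 'n \<Rightarrow> (complex ^ 'n) set" where
  "koranyi_region c \<zeta> = {z \<in> ball 0 1. norm (1 - cinner z \<zeta>) < c / 2 * (1 - (norm z)\<^sup>2)}"

definition has_K_limit :: "(complex ^ 'n \<Rightarrow> complex) \<Rightarrow> complex ^ 'n \<Rightarrow> complex \<Rightarrow> bool" where
  "has_K_limit g \<zeta> l \<longleftrightarrow> (\<forall>c>1. (g \<longlongrightarrow> l) (at \<zeta> within koranyi_region c \<zeta>))"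

text \<open>For \<open>g\<close> in a Hardy space the K-limit exists almost everywhere on the sphere; the value 0 on the
  exceptional null set is a convention without effect.\<close>

definition boundary_value :: "(complex ^ 'n \<Rightarrow> complex) \<Rightarrow> complex ^ 'n \<Rightarrow> complex" where
  "boundary_value g \<zeta> =
     (if \<exists>l. has_K_limit g \<zeta> l then (THE l. has_K_limit g \<zeta> l) else 0)"

text \<open>\<open>\<Sum>\<^sub>k \<rho>\<^sub>k \<delta>\<^bsub>\<zeta>\<^sub>k\<^esub>\<close> with \<open>k\<close> ranging over a countable (possibly empty or finite) index set.\<close>

definition discrete_on_sphere :: "'a::euclidean_space measure \<Rightarrow> bool" where
  "discrete_on_sphere \<nu> \<longleftrightarrow> sets \<nu> = sets borel \<and>
     (\<exists>(I :: nat set) (\<rho> :: nat \<Rightarrow> real) (\<zeta> :: nat \<Rightarrow> 'a).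
        (\<forall>k\<in>I. \<rho> k > 0 \<and> \<zeta> k \<in> sphere 0 1) \<and>
        (\<forall>A\<in>sets borel. emeasure \<nu> A =
           (\<Sum>k. if k \<in> I then ennreal (\<rho> k) * indicator A (\<zeta> k) else 0)))"


section \<open>Multi-indices and Verblunsky coefficients\<close>

text \<open>The coordinates are ordered by the linear order of the index type \<open>'n\<close>, which is isomorphic
  to \<open>{1..d}\<close>.\<close>

definition mdeg :: "nat ^ 'n \<Rightarrow> nat" where
  "mdeg \<alpha> = (\<Sum>i\<in>UNIV. \<alpha> $ i)"

text \<open>Equal to \<^typ>\<open>nat ^ 'n\<close> and \<^typ>\<open>complex ^ 'n\<close>; the binary type syntax admits no index
  sorts besides \<^class>\<open>finite\<close>.\<close>

type_synonym 'n mindex = "(nat, 'n) vec"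
type_synonym 'n cspace = "(complex, 'n) vec"

definition shortlex :: "('n::{finite,linorder}) mindex \<Rightarrow> 'n mindex \<Rightarrow> bool"  (infix \<open>\<prec>\<^sub>s\<close> 50) where
  "\<alpha> \<prec>\<^sub>s \<beta> \<longleftrightarrow> mdeg \<alpha> < mdeg \<beta> \<or>
     mdeg \<alpha> = mdeg \<beta> \<and> (\<exists>i. \<alpha> $ i > \<beta> $ i \<and> (\<forall>j<i. \<alpha> $ j = \<beta> $ j))"

text \<open>The \<open>n\<close>-th multi-index (counting from 0) in shortlex order: the one with exactly \<open>n\<close>
  predecessors. See \<open>bij_shortlex_enum\<close> and \<open>shortlex_enum_mono\<close> below.\<close>

definition shortlex_enum :: "nat \<Rightarrow> ('n::{finite,linorder}) mindex" where
  "shortlex_enum n = (THE \<alpha>. card {\<delta>. \<delta> \<prec>\<^sub>s \<alpha>} = n)"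

definition mmonom :: "nat ^ 'n \<Rightarrow> complex ^ 'n \<Rightarrow> complex" where
  "mmonom \<alpha> \<zeta> = (\<Prod>i\<in>UNIV. \<zeta> $ i ^ \<alpha> $ i)"

definition moment :: "(complex ^ 'n) measure \<Rightarrow> nat ^ 'n \<Rightarrow> nat ^ 'n \<Rightarrow> complex" where
  "moment \<mu> \<alpha> \<beta> = (LINT \<zeta>|\<mu>. mmonom \<alpha> \<zeta> * cnj (mmonom \<beta> \<zeta>))"

text \<open>The inverse of a matrix whose rows and columns are indexed by an arbitrary finite set \<open>S\<close>,
  extended by 0 outside \<open>S \<times> S\<close> to make it unique as a function.\<close>

definition matrix_inverse_on ::
    "'i set \<Rightarrow> ('i \<Rightarrow> 'i \<Rightarrow> complex) \<Rightarrow> 'i \<Rightarrow> 'i \<Rightarrow> complex" where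
  "matrix_inverse_on S M = (THE N.
     (\<forall>i j. i \<notin> S \<or> j \<notin> S \<longrightarrow> N i j = 0) \<and>
     (\<forall>i\<in>S. \<forall>j\<in>S. (\<Sum>k\<in>S. M i k * N k j) = (if i = j then 1 else 0)) \<and>
     (\<forall>i\<in>S. \<forall>j\<in>S. (\<Sum>k\<in>S. N i k * M k j) = (if i = j then 1 else 0)))"

text \<open>\<open>x M\<^sup>-\<^sup>1 y\<close> for a row \<open>x\<close> and a column \<open>y\<close> indexed by \<open>S\<close>; it is 0 if \<open>S\<close> is empty.\<close>

definition inv_form ::
    "'i set \<Rightarrow> ('i \<Rightarrow> 'i \<Rightarrow> complex) \<Rightarrow> ('i \<Rightarrow> complex) \<Rightarrow> ('i \<Rightarrow> complex) \<Rightarrow> complex" where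
  "inv_form S M x y = (\<Sum>i\<in>S. \<Sum>j\<in>S. x i * matrix_inverse_on S M i j * y j)"

text \<open>The two quantities under the square roots are positive reals when the finite sections of \<open>K\<close>
  are positive definite, so taking \<open>Re\<close> only adjusts the type.\<close>

definition verblunsky_pre ::
    "(('n::{finite,linorder}) mindex \<Rightarrow> 'n mindex \<Rightarrow> complex) \<Rightarrow> 'n mindex \<Rightarrow> 'n mindex \<Rightarrow> complex" where
  "verblunsky_pre K \<alpha> \<beta> =
     (let S = {\<delta>. \<alpha> \<prec>\<^sub>s \<delta> \<and> \<delta> \<prec>\<^sub>s \<beta>};
          u = (\<lambda>\<delta>. K \<alpha> \<delta>);
          v = (\<lambda>\<delta>. K \<delta> \<beta>)
      in (K \<alpha> \<beta> - inv_form S K u v) /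
           complex_of_real (sqrt (Re (K \<alpha> \<alpha> - inv_form S K u (\<lambda>\<delta>. cnj (u \<delta>)))) *
                            sqrt (Re (K \<beta> \<beta> - inv_form S K (\<lambda>\<delta>. cnj (v \<delta>)) v))))"

definition verblunsky ::
    "(('n::{finite,linorder}) cspace) measure \<Rightarrow> 'n mindex \<Rightarrow> 'n mindex \<Rightarrow> complex" where
  "verblunsky \<mu> \<alpha> \<beta> =
     (if \<alpha> \<prec>\<^sub>s \<beta> then verblunsky_pre (moment \<mu>) \<alpha> \<beta>
      else if \<beta> \<prec>\<^sub>s \<alpha> then cnj (verblunsky_pre (moment \<mu>) \<beta> \<alpha>)
      else 0)"


section \<open>The sphere measure is the rotation-invariant probability measure\<close>

lemma prob_space_sphere_measure: "prob_space (sphere_measure :: 'a::euclidean_space measure)"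
proof -
  have "prob_space (uniform_measure lborel (ball (0::'a) 1))"
  proof (rule prob_space_uniform_measure)
    have "\<not> negligible (ball (0::'a) 1)"
      by (rule open_not_negligible) auto
    then have "ball (0::'a) 1 \<notin> null_sets lborel"
      by (auto simp: negligible_iff_null_sets intro: null_sets_completionI)
    then show "emeasure lborel (ball (0::'a) 1) \<noteq> 0"
      by (auto simp: null_sets_def)
    show "emeasure lborel (ball (0::'a) 1) \<noteq> \<infinity>"
      using emeasure_bounded_finite[of "ball (0::'a) 1"] by auto
  qed
  then show ?thesis
    unfolding sphere_measure_def
    by (rule prob_space.prob_space_distr) simp
qed

lemma AE_sphere_measure: "AE \<zeta> in (sphere_measure :: 'a::euclidean_space measure). \<zeta> \<in> sphere 0 1"
proof -
  have "AE x in lborel. x \<noteq> (0::'a)"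
    by (rule AE_I[of _ _ "{0}"]) auto
  then have "AE x in uniform_measure lborel (ball (0::'a) 1). x \<noteq> 0"
    by (intro AE_uniform_measureI) auto
  then show ?thesis
    unfolding sphere_measure_def
    by (subst AE_distr_iff) (auto simp: dist_norm)
qed

lemma lborel_orthogonal_invariant:
  fixes T :: "'a::euclidean_space \<Rightarrow> 'a"
  assumes T: "orthogonal_transformation T"
  shows "distr lborel borel T = lborel"
proof (rule measure_eqI)
  fix A assume "A \<in> sets (distr lborel borel T)"
  then have A [measurable]: "A \<in> sets borel"
    by simp
  have lin: "linear T"
    using T by (rule orthogonal_transformation_linear)
  then have [measurable]: "T \<in> borel_measurable borel"
    by (simp add: borel_measurable_continuous_onI linear_continuous_on linear_conv_bounded_linear)
  have nT: "norm (T x) = norm x" for x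
    using T by (rule orthogonal_transformation_norm)
  define B where "B = ball (0::'a) 1"
  have [measurable]: "B \<in> sets borel"
    by (simp add: B_def)
  have trans: "(\<integral>\<^sup>+x. f (c + x) \<partial>lborel) = (\<integral>\<^sup>+x. f x \<partial>lborel)"
    if [measurable]: "f \<in> borel_measurable borel" for f :: "'a \<Rightarrow> ennreal" and c
    by (subst (2) lborel_distr_plus[of c, symmetric], subst nn_integral_distr) auto
  have refl: "(\<integral>\<^sup>+x. f (c - x) \<partial>lborel) = (\<integral>\<^sup>+x. f x \<partial>lborel)"
    if [measurable]: "f \<in> borel_measurable borel" for f :: "'a \<Rightarrow> ennreal" and c
    by (subst (2) lborel_affine[of "-1" c])
       (auto simp: nn_integral_density nn_integral_distr one_ennreal_def[symmetric])
  have "emeasure (distr lborel borel T) A * emeasure lborel B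
      = (\<integral>\<^sup>+x. indicator A (T x) * emeasure lborel B \<partial>lborel)"
  proof -
    have "T -` A \<in> sets borel"
      using measurable_sets[of T borel borel A] by simp
    then have "emeasure (distr lborel borel T) A = (\<integral>\<^sup>+x. indicator (T -` A) x \<partial>lborel)"
      by (simp add: emeasure_distr)
    also have "\<dots> = (\<integral>\<^sup>+x. indicator A (T x) \<partial>lborel)"
      by (simp add: indicator_def)
    finally show ?thesis
      by (simp add: nn_integral_multc)
  qed
  also have "\<dots> = (\<integral>\<^sup>+x. \<integral>\<^sup>+y. indicator A (T x) * indicator B (T x + y) \<partial>lborel \<partial>lborel)"
    by (subst nn_integral_cmult, measurable)
       (simp add: trans)
  also have "\<dots> = (\<integral>\<^sup>+y. \<integral>\<^sup>+x. indicator A (T x) * indicator B (T x + y) \<partial>lborel \<partial>lborel)"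
    by (rule lborel_pair.Fubini') measurable
  also have "\<dots> = (\<integral>\<^sup>+y. \<integral>\<^sup>+x. indicator A (T x - y) * indicator B (T x) \<partial>lborel \<partial>lborel)"
  proof (rule nn_integral_cong)
    fix y :: 'a
    obtain y' where y: "y = T y'"
      using orthogonal_transformation_surj[OF T] by (metis surjD)
    show "(\<integral>\<^sup>+x. indicator A (T x) * indicator B (T x + y) \<partial>lborel)
        = (\<integral>\<^sup>+x. indicator A (T x - y) * indicator B (T x) \<partial>lborel)"
      using trans[of "\<lambda>x. indicator A (T x - y) * indicator B (T x)" y']
      by (simp add: y linear_add[OF lin] add.commute)
  qed
  also have "\<dots> = (\<integral>\<^sup>+x. \<integral>\<^sup>+y. indicator A (T x - y) * indicator B (T x) \<partial>lborel \<partial>lborel)"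
    by (rule lborel_pair.Fubini') measurable
  also have "\<dots> = (\<integral>\<^sup>+x. emeasure lborel A * indicator B x \<partial>lborel)"
  proof (rule nn_integral_cong)
    fix x :: 'a
    have "indicator B (T x) = (indicator B x :: ennreal)"
      by (simp add: B_def indicator_def nT)
    then show "(\<integral>\<^sup>+y. indicator A (T x - y) * indicator B (T x) \<partial>lborel)
        = emeasure lborel A * indicator B x"
      using refl[of "indicator A" "T x"] by (simp add: nn_integral_multc)
  qed
  also have "\<dots> = emeasure lborel A * emeasure lborel B"
    by (simp add: nn_integral_cmult)
  finally have "emeasure (distr lborel borel T) A * emeasure lborel B
      = emeasure lborel A * emeasure lborel B" .
  moreover have "unit_ball_vol (real DIM('a)) \<noteq> 0"
    using unit_ball_vol_pos[of "real DIM('a)"] by linarith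
  then have "emeasure lborel B \<noteq> 0" "emeasure lborel B \<noteq> \<top>"
    using emeasure_ball[of 1 "0::'a"] by (auto simp: B_def)
  ultimately show "emeasure (distr lborel borel T) A = emeasure lborel A"
    by (metis ennreal_mult_cancel_left mult.commute)
qed simp

lemma sphere_measure_rotation_invariant:
  fixes T :: "'a::euclidean_space \<Rightarrow> 'a"
  assumes T: "orthogonal_transformation T"
  shows "distr sphere_measure borel T = sphere_measure"
proof (rule measure_eqI)
  fix A assume "A \<in> sets (distr (sphere_measure :: 'a measure) borel T)"
  then have A [measurable]: "A \<in> sets borel"
    by simp
  have lin: "linear T"
    using T by (rule orthogonal_transformation_linear)
  then have T' [measurable]: "T \<in> borel_measurable borel"
    by (simp add: borel_measurable_continuous_onI linear_continuous_on linear_conv_bounded_linear)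
  have nT: "norm (T x) = norm x" for x
    using T by (rule orthogonal_transformation_norm)
  let ?P = "\<lambda>x::'a. x /\<^sub>R norm x"
  have P [measurable]: "?P \<in> borel_measurable borel"
    by measurable
  have *: "emeasure (sphere_measure :: 'a measure) C
      = emeasure lborel (ball 0 1 \<inter> ?P -` C) / emeasure lborel (ball (0::'a) 1)"
    if [measurable]: "C \<in> sets borel" for C
  proof -
    have "?P -` C \<in> sets borel"
      using measurable_sets[OF P that] by simp
    then show ?thesis
      by (simp add: sphere_measure_def emeasure_distr emeasure_uniform_measure)
  qed
  have TA: "T -` A \<in> sets borel"
    using measurable_sets[OF T' A] by simp
  have PA: "?P -` A \<in> sets borel"
    using measurable_sets[OF P A] by simp
  have "ball 0 1 \<inter> ?P -` (T -` A) = T -` (ball 0 1 \<inter> ?P -` A)"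
    by (auto simp: nT linear_scale[OF lin])
  moreover have "emeasure lborel (T -` (ball 0 1 \<inter> ?P -` A)) = emeasure lborel (ball 0 1 \<inter> ?P -` A)"
    using PA by (subst (2) lborel_orthogonal_invariant[OF T, symmetric]) (simp add: emeasure_distr)
  ultimately have "emeasure sphere_measure (T -` A) = emeasure sphere_measure A"
    using * TA A by simp
  then show "emeasure (distr sphere_measure borel T) A = emeasure sphere_measure A"
    by (simp add: emeasure_distr sphere_measure_def)
qed (simp add: sphere_measure_def)


section \<open>The shortlex enumeration\<close>

lemma shortlex_irrefl: "\<not> \<alpha> \<prec>\<^sub>s \<alpha>"
  by (auto simp: shortlex_def)

lemma shortlex_trans:
  assumes "\<alpha> \<prec>\<^sub>s \<beta>" "\<beta> \<prec>\<^sub>s \<gamma>" shows "\<alpha> \<prec>\<^sub>s \<gamma>"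
proof -
  have *: "\<exists>i. \<alpha> $ i > \<gamma> $ i \<and> (\<forall>j<i. \<alpha> $ j = \<gamma> $ j)"
    if "\<alpha> $ i > \<beta> $ i" "\<forall>j<i. \<alpha> $ j = \<beta> $ j" "\<beta> $ k > \<gamma> $ k" "\<forall>j<k. \<beta> $ j = \<gamma> $ j" for i k
    using that by (intro exI[of _ "min i k"]) (cases i k rule: linorder_cases; force simp: min_def)
  show ?thesis
    using assms unfolding shortlex_def by (elim disjE conjE exE) (simp_all add: *)
qed

lemma shortlex_total: "\<alpha> \<prec>\<^sub>s \<beta> \<or> \<alpha> = \<beta> \<or> \<beta> \<prec>\<^sub>s \<alpha>"
proof (cases "\<alpha> = \<beta>")
  case False
  define D where "D = {i. \<alpha> $ i \<noteq> \<beta> $ i}"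
  have D: "finite D" "D \<noteq> {}"
    using False by (auto simp: D_def vec_eq_iff)
  have "\<alpha> $ Min D \<noteq> \<beta> $ Min D"
    using Min_in[OF D] by (simp add: D_def)
  moreover have "\<forall>j<Min D. \<alpha> $ j = \<beta> $ j"
    using Min_le[OF D(1)] by (metis (mono_tags, lifting) D_def leD mem_Collect_eq)
  ultimately show ?thesis
    unfolding shortlex_def by (metis linorder_neqE_nat)
qed simp

lemma finite_shortlex_below: "finite {\<delta>. \<delta> \<prec>\<^sub>s \<alpha>}"
proof (rule finite_subset)
  show "{\<delta>. \<delta> \<prec>\<^sub>s \<alpha>} \<subseteq> vec_lambda ` (UNIV \<rightarrow>\<^sub>E {..mdeg \<alpha>})"
  proof
    fix \<delta> assume "\<delta> \<in> {\<delta>. \<delta> \<prec>\<^sub>s \<alpha>}"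
    then have "mdeg \<delta> \<le> mdeg \<alpha>" by (auto simp: shortlex_def)
    moreover have "\<delta> $ i \<le> mdeg \<delta>" for i
      unfolding mdeg_def by (rule member_le_sum) auto
    ultimately show "\<delta> \<in> vec_lambda ` (UNIV \<rightarrow>\<^sub>E {..mdeg \<alpha>})"
      by (intro image_eqI[of _ _ "vec_nth \<delta>"]) (auto intro: order_trans)
  qed
qed (intro finite_imageI finite_PiE; simp)

lemma card_shortlex_below_mono:
  assumes "\<alpha> \<prec>\<^sub>s \<beta>" shows "card {\<delta>. \<delta> \<prec>\<^sub>s \<alpha>} < card {\<delta>. \<delta> \<prec>\<^sub>s \<beta>}"
  using assms shortlex_trans shortlex_irrefl
  by (intro psubset_card_mono finite_shortlex_below) blast

lemma inj_card_shortlex_below: "inj (\<lambda>\<alpha>. card {\<delta>. \<delta> \<prec>\<^sub>s \<alpha>})"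
  by (rule injI) (metis card_shortlex_below_mono less_irrefl shortlex_total)

lemma surj_card_shortlex_below:
  "surj (\<lambda>\<alpha> :: ('n::{finite,linorder}) mindex. card {\<delta>. \<delta> \<prec>\<^sub>s \<alpha>})"
proof -
  let ?c = "\<lambda>\<alpha> :: 'n mindex. card {\<delta>. \<delta> \<prec>\<^sub>s \<alpha>}"
  have down: "{..?c \<alpha>} \<subseteq> range ?c" for \<alpha>
  proof -
    have "?c ` {\<delta>. \<delta> \<prec>\<^sub>s \<alpha>} \<subseteq> {..<?c \<alpha>}"
      using card_shortlex_below_mono by auto
    moreover have "card (?c ` {\<delta>. \<delta> \<prec>\<^sub>s \<alpha>}) = card {..<?c \<alpha>}"
      by (simp add: card_image inj_on_subset[OF inj_card_shortlex_below])
    ultimately have "?c ` {\<delta>. \<delta> \<prec>\<^sub>s \<alpha>} = {..<?c \<alpha>}"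
      by (intro card_subset_eq) auto
    then show ?thesis
      by (metis (no_types, lifting) image_mono insert_subset lessThan_Suc lessThan_Suc_atMost
          rangeI subset_UNIV)
  qed
  have inf: "infinite (range ?c)"
  proof -
    have "inj (\<lambda>k::nat. (\<chi> i. k) :: 'n mindex)"
      by (auto intro!: injI simp: vec_eq_iff)
    then have "infinite (range (\<lambda>k::nat. (\<chi> i. k) :: 'n mindex))"
      by (rule range_inj_infinite)
    then have "infinite (UNIV :: 'n mindex set)"
      by (rule infinite_super[OF subset_UNIV])
    then show ?thesis
      using finite_imageD[OF _ inj_card_shortlex_below] by auto
  qed
  show ?thesis
  proof (intro equalityI subsetI)
    fix n :: nat
    obtain m where "m \<in> range ?c" "n < m"
      using inf unfolding infinite_nat_iff_unbounded by blast
    then obtain \<alpha> where "n < ?c \<alpha>"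
      by auto
    then have "n \<in> {..?c \<alpha>}"
      by simp
    then show "n \<in> range ?c"
      using down by blast
  qed simp
qed

lemma card_below_shortlex_enum:
  "card {\<delta>. \<delta> \<prec>\<^sub>s (shortlex_enum n :: ('n::{finite,linorder}) mindex)} = n"
proof -
  obtain \<alpha> :: "'n mindex" where \<alpha>: "n = card {\<delta>. \<delta> \<prec>\<^sub>s \<alpha>}"
    using surjE[OF surj_card_shortlex_below] .
  show ?thesis
    unfolding shortlex_enum_def
  proof (rule theI)
    show "card {\<delta>. \<delta> \<prec>\<^sub>s \<alpha>} = n"
      using \<alpha> by simp
    show "\<beta> = \<alpha>" if "card {\<delta>. \<delta> \<prec>\<^sub>s \<beta>} = n" for \<beta>
      by (rule injD[OF inj_card_shortlex_below]) (simp add: that \<alpha>[symmetric])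
  qed
qed

lemma bij_shortlex_enum: "bij (shortlex_enum :: nat \<Rightarrow> ('n::{finite,linorder}) mindex)"
proof (rule bijI)
  show "inj (shortlex_enum :: nat \<Rightarrow> 'n mindex)"
    by (rule inj_on_inverseI[where g = "\<lambda>\<alpha>. card {\<delta>. \<delta> \<prec>\<^sub>s \<alpha>}"])
       (rule card_below_shortlex_enum)
  show "surj (shortlex_enum :: nat \<Rightarrow> 'n mindex)"
  proof (rule surjI)
    show "shortlex_enum (card {\<delta>. \<delta> \<prec>\<^sub>s \<alpha>}) = \<alpha>" for \<alpha> :: "'n mindex"
      by (rule injD[OF inj_card_shortlex_below]) (rule card_below_shortlex_enum)
  qed
qed

lemma shortlex_enum_mono:
  fixes m n :: nat
  assumes "m < n"
  shows "(shortlex_enum m :: ('n::{finite,linorder}) mindex) \<prec>\<^sub>s shortlex_enum n"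
proof -
  let ?e = "shortlex_enum :: nat \<Rightarrow> 'n mindex"
  have "?e m \<noteq> ?e n"
    using assms bij_is_inj[OF bij_shortlex_enum] by (auto dest: injD)
  moreover have "\<not> ?e n \<prec>\<^sub>s ?e m"
    using card_shortlex_below_mono[of "?e n" "?e m"] assms
    unfolding card_below_shortlex_enum by (meson less_asym)
  ultimately show ?thesis
    using shortlex_total by blast
qed

end

theory Submission
  imports Defs "HOL-Complex_Analysis.Complex_Analysis"
begin

text \<open>
  By Schur complements the \<open>n\<close>-th partial product is the squared distance in \<open>L\<^sup>2(\<mu>)\<close> from 1 to the span
  of the nonconstant monomials of index less than \<open>n\<close>. Put \<open>F = g\<^sup>-\<^sup>p\<^sup>/\<^sup>2\<close>, a bounded zero-free holomorphic
  function, so that \<open>w = \<bar>F\<bar>\<^sup>-\<^sup>2\<close> on the sphere; the functions \<open>1/F\<close> and \<open>log \<bar>F\<bar>\<close> obey the mean value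
  property up to the boundary because their dilations are bounded in \<open>L\<^sup>2\<close>, whence
  \<open>exp (\<integral> log w d\<sigma>) = \<bar>F(0)\<bar>\<^sup>-\<^sup>2\<close>. For a polynomial \<open>q\<close> with \<open>q(0) = 1\<close> the Cauchy--Schwarz inequality gives
  \<open>\<integral> \<bar>q\<bar>\<^sup>2 d\<mu> \<ge> \<bar>\<integral> q/F d\<sigma>\<bar>\<^sup>2 = \<bar>F(0)\<bar>\<^sup>-\<^sup>2\<close>. Conversely \<open>F/F(0)\<close>, multiplied by factors
  \<open>(1 - \<langle>z,\<zeta>\<^sub>k\<rangle>) / (1 + \<delta> - \<langle>z,\<zeta>\<^sub>k\<rangle>)\<close> that vanish at finitely many atoms, is a limit of polynomials and
  nearly attains this value. The boundary values exist by Koranyi's theorem, obtained here from a \<open>TT\<^sup>*\<close>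
  form of the weak-type maximal inequality.
\<close>

section \<open>Monomials on the sphere\<close>

text \<open>At the start only the rotation invariance of the sphere measure is available, so phases
  and rotations of coordinate planes have to supply every integral: monomials are orthogonal and
  their norms obey a one-step recursion, which is what makes the Szego kernel reproduce polynomials.
  Passing to \<open>F\<close> moves the work to bounded functions. Polynomial approximants of
  \<open>F\<close> are uniformly bounded, so dominated convergence against \<open>w\<close> applies,
  while the mean of |1/F|^2 over a smaller sphere is the mean of |g|^p and is controlled by the
  Hardy condition. Koranyi's theorem is then needed only for \<open>F\<close> and 1/g; the limit of
  \<open>g\<close> is the reciprocal of the latter. The atoms are the obstacle in the upper
  estimate: \<open>F\<close> has boundary values only almost everywhere, possibly none at an atom. A
  factor that tends to 0 along the radius towards the atom, times a bounded function, still tends to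
  0 there. The number m of factors is fixed by the mass of the remaining atoms before \<delta> is
  chosen, so the value (1+\<delta>)^(-m) at the origin is normalised to 1 at a cost that vanishes
  with \<delta>.\<close>

lemma sets_sphere_measure [simp, measurable_cong]: "sets sphere_measure = sets borel"
  by (simp add: sphere_measure_def)

lemma space_sphere_measure [simp]: "space sphere_measure = UNIV"
  by (simp add: sphere_measure_def)

interpretation sphere: prob_space "sphere_measure :: 'a::euclidean_space measure"
  by (rule prob_space_sphere_measure)

lemma measurable_sphere_measure [simp]: "measurable sphere_measure M = measurable borel M"
  by (rule measurable_cong_sets) auto

lemma integrable_sphere_bounded:
  fixes f :: "'a::euclidean_space \<Rightarrow> 'b::{banach, second_countable_topology}"
  assumes "f \<in> borel_measurable borel" "\<And>z. norm z = 1 \<Longrightarrow> norm (f z) \<le> B"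
  shows "integrable sphere_measure f"
proof (rule sphere.integrable_const_bound[where B = B])
  show "AE x in sphere_measure. norm (f x) \<le> B"
    using AE_sphere_measure by eventually_elim (simp add: assms)
qed (use assms in simp)

lemma continuous_bounded_on_sphere:
  fixes f :: "'a::euclidean_space \<Rightarrow> 'b::real_normed_vector"
  assumes "continuous_on UNIV f"
  obtains B where "\<And>z. norm z = 1 \<Longrightarrow> norm (f z) \<le> B"
proof -
  have "bounded (f ` sphere 0 1)"
    by (intro compact_imp_bounded compact_continuous_image continuous_on_subset[OF assms]) auto
  then obtain B where B: "\<And>z. z \<in> sphere 0 1 \<Longrightarrow> norm (f z) \<le> B"
    unfolding bounded_iff by blast
  show ?thesis
    by (rule that[of B]) (simp add: B)
qed

lemma integrable_sphere_continuous:
  fixes f :: "'a::euclidean_space \<Rightarrow> 'b::{banach, second_countable_topology}"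
  assumes "continuous_on UNIV f"
  shows "integrable sphere_measure f"
proof -
  obtain B where "\<And>z. norm z = 1 \<Longrightarrow> norm (f z) \<le> B"
    using continuous_bounded_on_sphere[OF assms] by blast
  with borel_measurable_continuous_onI[OF assms] show ?thesis
    by (rule integrable_sphere_bounded)
qed

lemma integral_sphere_rotation:
  fixes f :: "'a::euclidean_space \<Rightarrow> 'b::{banach, second_countable_topology}" and T :: "'a \<Rightarrow> 'a"
  assumes T: "orthogonal_transformation T" and f: "f \<in> borel_measurable borel"
  shows "(LINT z|sphere_measure. f (T z)) = (LINT z|sphere_measure. f z)"
proof -
  have [measurable]: "T \<in> borel_measurable borel"
    using orthogonal_transformation_linear[OF T]
    by (simp add: borel_measurable_continuous_onI linear_continuous_on linear_conv_bounded_linear)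
  show ?thesis
    by (subst (2) sphere_measure_rotation_invariant[OF T, symmetric])
      (subst integral_distr, use f in auto)
qed

lemma orthogonal_transformation_phase:
  fixes a :: "'n::finite \<Rightarrow> complex"
  assumes "\<And>j. norm (a j) = 1"
  shows "orthogonal_transformation (\<lambda>z :: complex ^ 'n. \<chi> j. a j * z $ j)"
  unfolding orthogonal_transformation
proof
  show "linear (\<lambda>z :: complex ^ 'n. \<chi> j. a j * z $ j)"
    by (rule linearI) (auto simp: vec_eq_iff algebra_simps)
  show "\<forall>v. norm (\<chi> j. a j * v $ j) = norm v"
    by (simp add: norm_vec_def norm_mult assms)
qed

text \<open>Phases only separate different monomials. Mixing two coordinates is what relates the
  norms of distinct monomials of the same degree.\<close>

lemma orthogonal_transformation_plane_rotation:
  fixes i j :: "'n::finite" and c s :: real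
  assumes ij: "i \<noteq> j" and cs: "c\<^sup>2 + s\<^sup>2 = 1"
  shows "orthogonal_transformation (\<lambda>z :: complex ^ 'n. \<chi> k.
    if k = i then c * z $ i + s * z $ j else if k = j then c * z $ j - s * z $ i else z $ k)"
    (is "orthogonal_transformation ?R")
  unfolding orthogonal_transformation
proof
  show "linear ?R"
    by (rule linearI) (auto simp: vec_eq_iff algebra_simps scaleR_conv_of_real[where 'a = complex])
  have "(norm (?R v))\<^sup>2 = (norm v)\<^sup>2" for v
  proof -
    have split: "(\<Sum>k\<in>UNIV. h k) = h i + h j + (\<Sum>k\<in>UNIV - {i, j}. h k)" for h :: "'n \<Rightarrow> real"
    proof -
      have "(\<Sum>k\<in>UNIV. h k) = (\<Sum>k\<in>{i, j}. h k) + (\<Sum>k\<in>UNIV - {i, j}. h k)"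
        by (metis (no_types) add.commute finite subset_UNIV sum.subset_diff)
      then show ?thesis using ij by simp
    qed
    have "(norm (c * v $ i + s * v $ j))\<^sup>2 + (norm (c * v $ j - s * v $ i))\<^sup>2
        = (c\<^sup>2 + s\<^sup>2) * ((norm (v $ i))\<^sup>2 + (norm (v $ j))\<^sup>2)"
      unfolding cmod_power2 by (simp add: power2_eq_square algebra_simps)
    moreover have "(\<Sum>k\<in>UNIV - {i, j}. (norm (?R v $ k))\<^sup>2) = (\<Sum>k\<in>UNIV - {i, j}. (norm (v $ k))\<^sup>2)"
      by (rule sum.cong) auto
    ultimately show ?thesis
      using ij cs by (simp add: norm_vec_def L2_set_def sum_nonneg split)
  qed
  then show "\<forall>v. norm (?R v) = norm v"
    by simp
qed

lemma mmonom_0 [simp]: "mmonom 0 z = 1"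
  by (simp add: mmonom_def)

lemma mmonom_add: "mmonom (\<alpha> + \<beta>) z = mmonom \<alpha> z * mmonom \<beta> z"
  by (simp add: mmonom_def power_add prod.distrib)

lemma mmonom_axis [simp]: "mmonom (axis i k) z = z $ i ^ k"
proof -
  have "mmonom (axis i k) z = (\<Prod>j\<in>UNIV. if j = i then z $ j ^ k else 1)"
    unfolding mmonom_def by (rule prod.cong) (auto simp: axis_def)
  then show ?thesis by simp
qed

lemma continuous_on_mmonom [continuous_intros]: "continuous_on A (mmonom \<alpha>)"
  unfolding mmonom_def by (intro continuous_intros)

lemma mmonom_phase: "mmonom \<alpha> (\<chi> j. a j * z $ j) = (\<Prod>j\<in>UNIV. a j ^ \<alpha> $ j) * mmonom \<alpha> z"
  by (simp add: mmonom_def power_mult_distrib prod.distrib)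

text \<open>The angle 1/(j+k+1) keeps the phase difference strictly between -1 and 1, hence away
  from nonzero multiples of 2 pi. One explicit angle thus serves for every pair of exponents or
  degrees.\<close>

lemma cis_diff_quotient_neq_1:
  assumes "j \<noteq> k"
  shows "cis ((real j - real k) * (1 / real (j + k + 1))) \<noteq> 1"
proof -
  define x where "x = (real j - real k) * (1 / real (j + k + 1))"
  have "\<bar>x\<bar> < 1" "x \<noteq> 0"
    using assms by (auto simp: x_def abs_mult)
  then have "-pi < x" "x < pi" "x \<noteq> 0"
    using pi_gt3 by linarith+
  then have "sin x \<noteq> 0"
    using sin_eq_0_pi by blast
  then show ?thesis
    unfolding x_def[symmetric] by (auto simp: complex_eq_iff)
qed

text \<open>Rotating one coordinate in which the exponents differ multiplies the moment by a phase
  other than 1, while invariance leaves it unchanged.\<close>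

lemma moment_sphere_orthogonal:
  assumes "\<alpha> \<noteq> \<beta>"
  shows "moment sphere_measure \<alpha> \<beta> = 0"
proof -
  obtain i where i: "\<alpha> $ i \<noteq> \<beta> $ i"
    using assms by (auto simp: vec_eq_iff)
  define t where "t = 1 / real (\<alpha> $ i + \<beta> $ i + 1)"
  define u where "u = (\<lambda>j. if j = i then cis t else 1)"
  have nu: "norm (u j) = 1" for j
    by (simp add: u_def)
  have pr: "(\<Prod>j\<in>UNIV. u j ^ \<gamma> $ j) = cis (real (\<gamma> $ i) * t)" for \<gamma> :: "nat ^ 'a"
  proof -
    have "(\<Prod>j\<in>UNIV. u j ^ \<gamma> $ j) = (\<Prod>j\<in>UNIV. if j = i then cis (real (\<gamma> $ j) * t) else 1)"
      by (rule prod.cong) (use Complex.DeMoivre[of t] in \<open>auto simp: u_def\<close>)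
    then show ?thesis by simp
  qed
  have eq: "moment sphere_measure \<alpha> \<beta>
      = (LINT z|sphere_measure. mmonom \<alpha> (\<chi> j. u j * z $ j) * cnj (mmonom \<beta> (\<chi> j. u j * z $ j)))"
    unfolding moment_def
    by (rule integral_sphere_rotation[OF orthogonal_transformation_phase[OF nu], symmetric])
      (intro borel_measurable_continuous_onI continuous_intros)
  also have "\<dots> = (LINT z|sphere_measure. cis ((real (\<alpha> $ i) - real (\<beta> $ i)) * t) * (mmonom \<alpha> z * cnj (mmonom \<beta> z)))"
  proof -
    have "cis (real (\<alpha> $ i) * t) * cnj (cis (real (\<beta> $ i) * t)) = cis ((real (\<alpha> $ i) - real (\<beta> $ i)) * t)"
      by (simp add: cis_cnj cis_mult left_diff_distrib)
    from this[symmetric] show ?thesis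
      by (intro Bochner_Integration.integral_cong refl) (simp only: mmonom_phase pr complex_cnj_mult mult_ac)
  qed
  also have "\<dots> = cis ((real (\<alpha> $ i) - real (\<beta> $ i)) * t) * moment sphere_measure \<alpha> \<beta>"
    by (simp add: moment_def)
  finally have "moment sphere_measure \<alpha> \<beta> = cis ((real (\<alpha> $ i) - real (\<beta> $ i)) * t) * moment sphere_measure \<alpha> \<beta>" .
  moreover have "cis ((real (\<alpha> $ i) - real (\<beta> $ i)) * t) \<noteq> 1"
    unfolding t_def by (rule cis_diff_quotient_neq_1[OF i])
  ultimately show ?thesis
    unfolding mult_cancel_right1 by blast
qed

section \<open>Norms of monomials, determined by rotation invariance alone\<close>

definition monom_sqnorm :: "nat ^ 'n::finite \<Rightarrow> real" where
  "monom_sqnorm \<alpha> = (LINT z|sphere_measure. (norm (mmonom \<alpha> z))\<^sup>2)"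

lemma moment_sphere: "moment sphere_measure \<alpha> \<beta> = (if \<alpha> = \<beta> then of_real (monom_sqnorm \<alpha>) else 0)"
  using moment_sphere_orthogonal[of \<alpha> \<beta>]
  by (simp add: moment_def monom_sqnorm_def complex_norm_square[symmetric] flip: of_real_power)

lemma integrable_moment [simp, intro]:
  "integrable sphere_measure (\<lambda>z. mmonom \<alpha> z * cnj (mmonom \<beta> z))"
  by (intro integrable_sphere_continuous continuous_intros)

text \<open>Replacing z_i by c z_i + s z_j preserves the norm of z_i^n times the remaining monomial.
  Expanding by the binomial theorem and using orthogonality gives an identity between polynomials in
  c^2 and s^2 on the unit circle; homogenising the constant side with (c^2+s^2)^n and comparing
  coefficients yields the claim.\<close>

lemma monom_sqnorm_binomial:
  fixes \<gamma> :: "nat ^ 'n::finite"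
  assumes ij: "i \<noteq> j" and "\<gamma> $ i = 0" "\<gamma> $ j = 0" and "a \<le> n"
  shows "real (n choose a) * monom_sqnorm (\<gamma> + axis i (n - a) + axis j a) = monom_sqnorm (\<gamma> + axis i n)"
proof -
  define \<alpha> where "\<alpha> = (\<lambda>a. \<gamma> + axis i (n - a) + axis j a)"
  have \<alpha>0: "\<alpha> 0 = \<gamma> + axis i n"
    by (simp add: \<alpha>_def vec_eq_iff axis_def)
  have inj: "\<alpha> a = \<alpha> b \<longleftrightarrow> a = b" for a b
  proof
    assume "\<alpha> a = \<alpha> b"
    then have "\<alpha> a $ j = \<alpha> b $ j" by simp
    then show "a = b" using ij by (simp add: \<alpha>_def axis_def)
  qed simp
  have rot: "(\<Sum>a\<le>n. (real (n choose a) * c ^ (n - a) * s ^ a)\<^sup>2 * monom_sqnorm (\<alpha> a)) = monom_sqnorm (\<alpha> 0)"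
    if cs: "c\<^sup>2 + s\<^sup>2 = 1" for c s :: real
  proof -
    let ?R = "\<lambda>z :: complex ^ 'n. \<chi> k. if k = i then c * z $ i + s * z $ j
       else if k = j then c * z $ j - s * z $ i else z $ k"
    let ?b = "\<lambda>a. of_real (real (n choose a) * c ^ (n - a) * s ^ a) :: complex"
    have mR: "mmonom (\<alpha> 0) (?R z) = (\<Sum>a\<le>n. ?b a * mmonom (\<alpha> a) z)" for z
    proof -
      have "mmonom \<gamma> (?R z) = mmonom \<gamma> z"
        unfolding mmonom_def by (rule prod.cong) (use assms in auto)
      moreover have "(s * z $ j + c * z $ i) ^ n
          = (\<Sum>a\<le>n. ?b a * (z $ i ^ (n - a) * z $ j ^ a))"
        unfolding binomial_ring by (rule sum.cong) (auto simp: power_mult_distrib mult_ac)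
      ultimately show ?thesis
        using ij by (simp add: \<alpha>0 mmonom_add) (simp add: \<alpha>_def mmonom_add sum_distrib_left mult_ac add.commute)
    qed
    have "moment sphere_measure (\<alpha> 0) (\<alpha> 0)
      = (LINT z|sphere_measure. mmonom (\<alpha> 0) (?R z) * cnj (mmonom (\<alpha> 0) (?R z)))"
      unfolding moment_def
      by (rule integral_sphere_rotation[OF orthogonal_transformation_plane_rotation[OF ij cs], symmetric])
        (intro borel_measurable_continuous_onI continuous_intros)
    also have "\<dots> = (LINT z|sphere_measure. (\<Sum>a\<le>n. \<Sum>b\<le>n. ?b a * ?b b * (mmonom (\<alpha> a) z * cnj (mmonom (\<alpha> b) z))))"
      unfolding mR by (simp add: sum_product mult_ac)
    also have "\<dots> = (\<Sum>a\<le>n. \<Sum>b\<le>n. ?b a * ?b b * moment sphere_measure (\<alpha> a) (\<alpha> b))"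
      unfolding moment_def by (subst Bochner_Integration.integral_sum) (auto simp: Bochner_Integration.integral_sum)
    also have "\<dots> = (\<Sum>a\<le>n. ?b a * ?b a * of_real (monom_sqnorm (\<alpha> a)))"
      by (rule sum.cong) (simp_all add: moment_sphere inj if_distrib cong: if_cong)
    finally have "of_real (monom_sqnorm (\<alpha> 0)) = (of_real
        (\<Sum>a\<le>n. (real (n choose a) * c ^ (n - a) * s ^ a)\<^sup>2 * monom_sqnorm (\<alpha> a)) :: complex)"
      by (simp add: moment_sphere power2_eq_square mult_ac)
    then show ?thesis
      unfolding of_real_eq_iff ..
  qed
  \<comment> \<open>The difference of the two sides after division by c^(2n), as a polynomial in t^2
    = (s/c)^2. It vanishes on all nonnegative reals and is therefore zero.\<close>
  define p where "p = (\<Sum>a\<le>n. monom ((real (n choose a))\<^sup>2 * monom_sqnorm (\<alpha> a) - real (n choose a) * monom_sqnorm (\<alpha> 0)) a)"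
  have pz: "poly p (t\<^sup>2) = 0" for t :: real
  proof -
    \<comment> \<open>Normalised so that (c, c t) lies on the unit circle.\<close>
    define c where "c = 1 / sqrt (1 + t\<^sup>2)"
    have pos: "1 + t\<^sup>2 > 0" by (simp add: add_pos_nonneg)
    then have c2: "c\<^sup>2 * (1 + t\<^sup>2) = 1" "c > 0"
      by (auto simp: c_def power_divide)
    then have "c\<^sup>2 + (c * t)\<^sup>2 = 1"
      by (simp add: power_mult_distrib algebra_simps)
    from rot[OF this]
    have "(1 + t\<^sup>2) ^ n * (\<Sum>a\<le>n. (real (n choose a) * c ^ (n - a) * (c * t) ^ a)\<^sup>2 * monom_sqnorm (\<alpha> a))
        = (1 + t\<^sup>2) ^ n * monom_sqnorm (\<alpha> 0)" by simp
    moreover have "(1 + t\<^sup>2) ^ n * (real (n choose a) * c ^ (n - a) * (c * t) ^ a)\<^sup>2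
        = (real (n choose a))\<^sup>2 * (t\<^sup>2) ^ a" if "a \<le> n" for a
    proof -
      have "c ^ (n - a) * c ^ a = c ^ n"
        using that by (simp flip: power_add)
      then have e: "real (n choose a) * c ^ (n - a) * (c * t) ^ a = real (n choose a) * (c ^ n * t ^ a)"
        by (metis mult.assoc power_mult_distrib)
      have "(1 + t\<^sup>2) ^ n * (real (n choose a) * c ^ (n - a) * (c * t) ^ a)\<^sup>2
         = (real (n choose a))\<^sup>2 * (t\<^sup>2) ^ a * ((1 + t\<^sup>2) ^ n * (c\<^sup>2) ^ n)"
        unfolding e by (simp add: power_mult_distrib mult_ac flip: power_mult)
      also have "(1 + t\<^sup>2) ^ n * (c\<^sup>2) ^ n = 1"
        using c2 by (simp add: mult_ac flip: power_mult_distrib)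
      finally show ?thesis by simp
    qed
    ultimately have "(\<Sum>a\<le>n. (real (n choose a))\<^sup>2 * (t\<^sup>2) ^ a * monom_sqnorm (\<alpha> a))
        = (1 + t\<^sup>2) ^ n * monom_sqnorm (\<alpha> 0)"
      by (simp add: sum_distrib_left mult.assoc[symmetric])
    also have "(1 + t\<^sup>2) ^ n = (\<Sum>a\<le>n. real (n choose a) * (t\<^sup>2) ^ a)"
      using binomial_ring[of "t\<^sup>2" 1 n] by (simp add: add.commute)
    finally show ?thesis
      by (simp add: p_def poly_sum poly_monom sum_subtractf sum_distrib_left sum_distrib_right algebra_simps)
  qed
  have "{0..} \<subseteq> {x. poly p x = 0}"
  proof
    fix x :: real assume "x \<in> {0..}"
    then show "x \<in> {x. poly p x = 0}" using pz[of "sqrt x"] by simp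
  qed
  then have "infinite {x. poly p x = 0}"
    using infinite_Ici infinite_super by blast
  then have "p = 0"
    using poly_roots_finite by blast
  then have "coeff p a = 0" by simp
  then have "(real (n choose a))\<^sup>2 * monom_sqnorm (\<alpha> a) = real (n choose a) * monom_sqnorm (\<alpha> 0)"
    using \<open>a \<le> n\<close> by (simp add: p_def coeff_sum)
  moreover have "n choose a \<noteq> 0"
    using \<open>a \<le> n\<close> by simp
  ultimately show ?thesis
    unfolding \<alpha>0 by (simp add: power2_eq_square \<alpha>_def)
qed

text \<open>Both monomials belong to the same family of \<open>monom_sqnorm_binomial\<close>, at the
  consecutive positions \<open>\<gamma> $ j\<close> and \<open>\<gamma> $ j + 1\<close>, so the
  relation is the quotient of two neighbouring binomial coefficients.\<close>

lemma monom_sqnorm_exchange: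
  fixes \<gamma> :: "nat ^ 'n::finite"
  shows "real (\<gamma> $ j + 1) * monom_sqnorm (\<gamma> + axis i 1) = real (\<gamma> $ i + 1) * monom_sqnorm (\<gamma> + axis j 1)"
proof (cases "i = j")
  case False
  define \<gamma>0 where "\<gamma>0 = (\<chi> k. if k = i \<or> k = j then 0 else \<gamma> $ k)"
  define n where "n = \<gamma> $ i + \<gamma> $ j + 1"
  have 0: "\<gamma>0 $ i = 0" "\<gamma>0 $ j = 0" by (auto simp: \<gamma>0_def)
  have 1: "\<gamma> + axis i 1 = \<gamma>0 + axis i (n - \<gamma> $ j) + axis j (\<gamma> $ j)"
    "\<gamma> + axis j 1 = \<gamma>0 + axis i (n - (\<gamma> $ j + 1)) + axis j (\<gamma> $ j + 1)"
    using False by (auto simp: vec_eq_iff \<gamma>0_def n_def axis_def)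
  have b: "(n choose \<gamma> $ j) * (\<gamma> $ i + 1) = (n choose (\<gamma> $ j + 1)) * (\<gamma> $ j + 1)"
  proof -
    have "n - \<gamma> $ j = \<gamma> $ i + 1" by (simp add: n_def)
    then show ?thesis
      using binomial_absorb_comp[of n "\<gamma> $ j"] binomial_absorption[of "\<gamma> $ j" "n"]
      by (simp only: Suc_eq_plus1 mult.commute)
  qed
  have e: "real (n choose \<gamma> $ j) * monom_sqnorm (\<gamma> + axis i 1)
      = real (n choose (\<gamma> $ j + 1)) * monom_sqnorm (\<gamma> + axis j 1)"
    unfolding 1 by (subst (1 2) monom_sqnorm_binomial[OF False 0]) (auto simp: n_def)
  have "real (n choose \<gamma> $ j) * (real (\<gamma> $ i + 1) * (real (\<gamma> $ j + 1) * monom_sqnorm (\<gamma> + axis i 1)))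
      = real (\<gamma> $ i + 1) * (real (\<gamma> $ j + 1) * (real (n choose \<gamma> $ j) * monom_sqnorm (\<gamma> + axis i 1)))"
    by (simp only: mult_ac)
  also have "\<dots> = real (\<gamma> $ i + 1) * (real ((n choose (\<gamma> $ j + 1)) * (\<gamma> $ j + 1)) * monom_sqnorm (\<gamma> + axis j 1))"
    unfolding e by (simp only: of_nat_mult mult_ac)
  also have "\<dots> = real (n choose \<gamma> $ j) * (real (\<gamma> $ i + 1) * (real (\<gamma> $ i + 1) * monom_sqnorm (\<gamma> + axis j 1)))"
    unfolding b[symmetric] by (simp only: of_nat_mult mult_ac)
  finally show ?thesis
    using n_def by simp
qed simp

text \<open>Insert 1 = sum of |z_j|^2, valid on the sphere, and express every resulting norm through
  the i-th one by the exchange relation. This is the recursion of the closed form \<alpha>! (d-1)! /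
  (|\<alpha>|+d-1)!, obtained without evaluating an integral.\<close>

lemma monom_sqnorm_Suc:
  fixes \<gamma> :: "nat ^ 'n::finite"
  shows "real (mdeg \<gamma> + CARD('n)) * monom_sqnorm (\<gamma> + axis i 1) = real (\<gamma> $ i + 1) * monom_sqnorm \<gamma>"
proof -
  have "monom_sqnorm \<gamma> = (LINT z|sphere_measure. (\<Sum>j\<in>UNIV. (norm (mmonom (\<gamma> + axis j 1) z))\<^sup>2))"
    unfolding monom_sqnorm_def
  proof (rule integral_cong_AE)
    show "AE z in sphere_measure. (norm (mmonom \<gamma> z))\<^sup>2 = (\<Sum>j\<in>UNIV. (norm (mmonom (\<gamma> + axis j 1) z))\<^sup>2)"
      using AE_sphere_measure
    proof eventually_elim
      fix z :: "complex ^ 'n" assume "z \<in> sphere 0 1"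
      then have "(\<Sum>j\<in>UNIV. (norm (z $ j))\<^sup>2) = 1"
        by (simp add: norm_vec_def L2_set_def)
      then show "(norm (mmonom \<gamma> z))\<^sup>2 = (\<Sum>j\<in>UNIV. (norm (mmonom (\<gamma> + axis j 1) z))\<^sup>2)"
        by (simp add: mmonom_add norm_mult power_mult_distrib flip: sum_distrib_left)
    qed
  qed (simp_all, (intro borel_measurable_continuous_onI continuous_intros)+)
  also have "\<dots> = (\<Sum>j\<in>UNIV. monom_sqnorm (\<gamma> + axis j 1))"
    unfolding monom_sqnorm_def
    by (intro Bochner_Integration.integral_sum integrable_sphere_continuous continuous_intros)
  finally have "real (\<gamma> $ i + 1) * monom_sqnorm \<gamma> = (\<Sum>j\<in>UNIV. real (\<gamma> $ i + 1) * monom_sqnorm (\<gamma> + axis j 1))"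
    by (simp only: sum_distrib_left)
  also have "\<dots> = (\<Sum>j\<in>UNIV. real (\<gamma> $ j + 1) * monom_sqnorm (\<gamma> + axis i 1))"
    by (rule sum.cong[OF refl], rule monom_sqnorm_exchange[symmetric])
  also have "\<dots> = real (mdeg \<gamma> + CARD('n)) * monom_sqnorm (\<gamma> + axis i 1)"
    by (simp add: mdeg_def sum.distrib flip: sum_distrib_right)
  finally show ?thesis ..
qed

lemma mdeg_0 [simp]: "mdeg 0 = 0"
  by (simp add: mdeg_def)

lemma mdeg_add: "mdeg (\<alpha> + \<beta>) = mdeg \<alpha> + mdeg \<beta>"
  by (simp add: mdeg_def sum.distrib)

lemma mdeg_axis [simp]: "mdeg (axis i k) = k"
  by (simp add: mdeg_def axis_def)

lemma mdeg_eq_0_iff: "mdeg \<alpha> = 0 \<longleftrightarrow> \<alpha> = 0"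
  by (simp add: mdeg_def vec_eq_iff)

lemma mindex_cases [case_names zero add]:
  fixes \<alpha> :: "nat ^ 'n::finite"
  obtains "\<alpha> = 0" | \<gamma> i where "\<alpha> = \<gamma> + axis i 1"
proof (cases "\<alpha> = 0")
  case False
  then obtain i where i: "\<alpha> $ i \<noteq> 0" by (auto simp: vec_eq_iff)
  have "\<alpha> = (\<chi> k. if k = i then \<alpha> $ k - 1 else \<alpha> $ k) + axis i 1"
    using i by (auto simp: vec_eq_iff axis_def)
  then show ?thesis using that by blast
qed (use that in blast)

lemma monom_sqnorm_pos: "monom_sqnorm (\<alpha> :: nat ^ 'n::finite) > 0"
proof (induction "mdeg \<alpha>" arbitrary: \<alpha>)
  case 0
  then have "\<alpha> = 0"
    by (simp add: mdeg_eq_0_iff)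
  then show ?case
    by (simp add: monom_sqnorm_def sphere.prob_space[simplified])
next
  case (Suc n)
  show ?case
  proof (cases \<alpha> rule: mindex_cases)
    case zero
    then show ?thesis using Suc by simp
  next
    case (add \<gamma> i)
    then have "monom_sqnorm \<gamma> > 0"
      using Suc by (simp add: mdeg_add)
    then have "0 < real (mdeg \<gamma> + CARD('n)) * monom_sqnorm (\<gamma> + axis i 1)"
      unfolding monom_sqnorm_Suc by simp
    then show ?thesis
      unfolding add by (simp add: zero_less_mult_iff)
  qed
qed

section \<open>Polynomials and the Poisson--Szego formula\<close>

lemma cinner_commute: "cinner \<eta> z = cnj (cinner z \<eta>)"
  by (simp add: cinner_def mult.commute)

lemma cinner_self: "cinner z z = of_real ((norm z)\<^sup>2)"
  by (simp add: cinner_def norm_vec_def L2_set_def sum_nonneg flip: complex_norm_square of_real_power)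

lemma continuous_on_cinner [continuous_intros]:
  assumes "continuous_on A f" "continuous_on A g"
  shows "continuous_on A (\<lambda>x. cinner (f x) (g x))"
  unfolding cinner_def by (intro continuous_intros assms)

lemma cinner_diff_left: "cinner (x - y) z = cinner x z - cinner y z"
  by (simp add: cinner_def sum_subtractf left_diff_distrib)

lemma cinner_diff_right: "cinner z (x - y) = cinner z x - cinner z y"
  by (simp add: cinner_def sum_subtractf right_diff_distrib)

lemma cinner_scale_left: "cinner (c *s x) z = c * cinner x z"
  by (simp add: cinner_def sum_distrib_left mult_ac)

lemma cinner_scale_right: "cinner z (c *s x) = cnj c * cinner z x"
  by (simp add: cinner_def sum_distrib_left mult_ac)

lemma norm_cinner_le: "norm (cinner x y) \<le> norm x * norm y"
proof -
  have "norm (cinner x y) \<le> (\<Sum>i\<in>UNIV. \<bar>norm (x $ i)\<bar> * \<bar>norm (y $ i)\<bar>)"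
    unfolding cinner_def by (rule sum_norm_le) (simp add: norm_mult)
  also have "\<dots> \<le> norm x * norm y"
    unfolding norm_vec_def by (rule L2_set_mult_ineq)
  finally show ?thesis .
qed

text \<open>An inductive closure instead of explicit coefficient families: identities that are
  linear in the polynomial reduce to monomials by induction. Coefficients are recovered by
  \<open>polyfun_representation\<close> where they are needed.\<close>

inductive polyfun :: "(complex ^ 'n::finite \<Rightarrow> complex) \<Rightarrow> bool" where
  monom: "polyfun (mmonom \<alpha>)"
| add: "polyfun f \<Longrightarrow> polyfun g \<Longrightarrow> polyfun (\<lambda>z. f z + g z)"
| cmult: "polyfun f \<Longrightarrow> polyfun (\<lambda>z. c * f z)"

lemma polyfun_const [intro]: "polyfun (\<lambda>z. c)"
proof -
  have "(\<lambda>z. c * mmonom 0 z) = (\<lambda>z. c)" by simp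
  then show ?thesis
    using polyfun.cmult[OF polyfun.monom, of c 0] by simp
qed

lemma polyfun_coord [intro]: "polyfun (\<lambda>z. z $ i)"
  using polyfun.monom[of "axis i 1"] by (simp add: mmonom_axis[abs_def])

lemma polyfun_sum [intro]: "(\<And>i. i \<in> A \<Longrightarrow> polyfun (f i)) \<Longrightarrow> polyfun (\<lambda>z. \<Sum>i\<in>A. f i z)"
  by (induction A rule: infinite_finite_induct) (auto intro: polyfun.add)

lemma polyfun_mult:
  assumes "polyfun f" "polyfun g"
  shows "polyfun (\<lambda>z. f z * g z)"
  using assms
proof (induction f)
  case (monom \<alpha>)
  from monom show ?case
  proof (induction g)
    case (monom \<beta>)
    show ?case using polyfun.monom[of "\<alpha> + \<beta>"] by (simp add: mmonom_add[abs_def])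
  next
    case (add f g)
    then show ?case by (simp add: distrib_left polyfun.add)
  next
    case (cmult f c)
    then show ?case using polyfun.cmult[of "\<lambda>z. mmonom \<alpha> z * f z" c] by (simp add: mult_ac)
  qed
next
  case (add f g)
  then show ?case by (simp add: distrib_right polyfun.add)
next
  case (cmult f c)
  then show ?case by (simp add: mult.assoc polyfun.cmult)
qed

lemma polyfun_diff:
  assumes "polyfun f" "polyfun g"
  shows "polyfun (\<lambda>z. f z - g z)"
  using polyfun.add[OF assms(1) polyfun.cmult[OF assms(2), of "-1"]] by simp

lemma polyfun_power: "polyfun f \<Longrightarrow> polyfun (\<lambda>z. f z ^ k)"
  by (induction k) (auto intro: polyfun_mult)

lemma polyfun_prod: "(\<And>i. i \<in> A \<Longrightarrow> polyfun (f i)) \<Longrightarrow> polyfun (\<lambda>z. \<Prod>i\<in>A. f i z)"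
  by (induction A rule: infinite_finite_induct) (auto intro: polyfun_mult)

lemma polyfun_cinner_left: "polyfun (\<lambda>\<eta>. cinner \<eta> z)"
  unfolding cinner_def
  by (intro polyfun_sum polyfun_mult polyfun_coord polyfun_const)

lemma continuous_on_polyfun: "polyfun f \<Longrightarrow> continuous_on A f"
  by (induction f rule: polyfun.induct) (auto intro!: continuous_intros)

lemma borel_measurable_polyfun: "polyfun f \<Longrightarrow> f \<in> borel_measurable borel"
  by (intro borel_measurable_continuous_onI continuous_on_polyfun)

lemma polyfun_representation:
  assumes "polyfun f"
  shows "\<exists>A c. finite A \<and> f = (\<lambda>z. \<Sum>\<alpha>\<in>A. c \<alpha> * mmonom \<alpha> z)"
  using assms
proof induction
  case (monom \<alpha>)
  show ?case by (rule exI[of _ "{\<alpha>}"], rule exI[of _ "\<lambda>_. 1"]) simp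
next
  case (add f g)
  then obtain A c B e where AB: "finite A" "finite B" and f: "f = (\<lambda>z. \<Sum>\<alpha>\<in>A. c \<alpha> * mmonom \<alpha> z)"
    and g: "g = (\<lambda>z. \<Sum>\<alpha>\<in>B. e \<alpha> * mmonom \<alpha> z)" by blast
  have "f z = (\<Sum>\<alpha>\<in>A \<union> B. (if \<alpha> \<in> A then c \<alpha> else 0) * mmonom \<alpha> z)" for z
    unfolding f using AB by (intro sum.mono_neutral_cong_left) auto
  moreover have "g z = (\<Sum>\<alpha>\<in>A \<union> B. (if \<alpha> \<in> B then e \<alpha> else 0) * mmonom \<alpha> z)" for z
    unfolding g using AB by (intro sum.mono_neutral_cong_left) auto
  ultimately have "f z + g z = (\<Sum>\<alpha>\<in>A \<union> B. ((if \<alpha> \<in> A then c \<alpha> else 0)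
      + (if \<alpha> \<in> B then e \<alpha> else 0)) * mmonom \<alpha> z)" for z
    by (simp only: distrib_right sum.distrib)
  then show ?case
    using AB by (intro exI[of _ "A \<union> B"] exI conjI) auto
next
  case (cmult f k)
  then obtain A c where "finite A" and f: "f = (\<lambda>z. \<Sum>\<alpha>\<in>A. c \<alpha> * mmonom \<alpha> z)" by blast
  then show ?case
    by (intro exI[of _ A] exI[of _ "\<lambda>\<alpha>. k * c \<alpha>"]) (simp add: sum_distrib_left mult_ac)
qed

section \<open>The Szego and Poisson kernels as reproducing kernels\<close>

lemma integrable_polyfun:
  assumes "polyfun f" shows "integrable sphere_measure f"
  by (intro integrable_sphere_continuous continuous_on_polyfun assms)

lemma integrable_monom_cnj_polyfun:
  assumes "polyfun f" "polyfun g"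
  shows "integrable sphere_measure (\<lambda>\<eta>. f \<eta> * cnj (g \<eta>))"
  by (intro integrable_sphere_continuous continuous_intros continuous_on_polyfun assms)

text \<open>On homogeneous polynomials of degree k+1 the adjoint of multiplication by z_i is the
  partial derivative in z_i divided by k+d. On monomials this is the norm recursion together with
  orthogonality.\<close>

lemma integral_monom_cnj_coord:
  fixes \<alpha> :: "nat ^ 'n::finite"
  assumes Q: "polyfun Q" and \<alpha>: "mdeg \<alpha> = Suc k"
  shows "(LINT \<eta>|sphere_measure. mmonom \<alpha> \<eta> * cnj (\<eta> $ i * Q \<eta>))
    = of_real (real (\<alpha> $ i) / real (k + CARD('n))) * (LINT \<eta>|sphere_measure. mmonom (\<alpha> - axis i 1) \<eta> * cnj (Q \<eta>))"
  using Q
proof induction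
  case (monom \<beta>)
  have 1: "(LINT \<eta>|sphere_measure. mmonom \<alpha> \<eta> * cnj (\<eta> $ i * mmonom \<beta> \<eta>)) = moment sphere_measure \<alpha> (\<beta> + axis i 1)"
    by (simp add: moment_def mmonom_add mult_ac)
  have 2: "(LINT \<eta>|sphere_measure. mmonom (\<alpha> - axis i 1) \<eta> * cnj (mmonom \<beta> \<eta>)) = moment sphere_measure (\<alpha> - axis i 1) \<beta>"
    by (simp add: moment_def)
  show ?case
  proof (cases "\<alpha> $ i = 0")
    \<comment> \<open>Here the subtraction \<open>\<alpha> - axis i 1\<close> truncates, but the
      factor \<open>\<alpha> $ i\<close> is 0 as well.\<close>
    case True
    then have "\<alpha> \<noteq> \<beta> + axis i 1"
      by (auto simp: axis_def)
    then show ?thesis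
      unfolding 1 2 moment_sphere using True by simp
  next
    case False
    define \<gamma> where "\<gamma> = \<alpha> - axis i 1"
    have \<gamma>: "\<alpha> = \<gamma> + axis i 1"
      using False by (auto simp: \<gamma>_def vec_eq_iff axis_def)
    have "mdeg \<gamma> = k"
      using \<alpha> unfolding \<gamma> mdeg_add by simp
    then have "monom_sqnorm \<alpha> = real (\<alpha> $ i) / real (k + CARD('n)) * monom_sqnorm \<gamma>"
    proof -
      have "\<alpha> $ i = \<gamma> $ i + 1"
        unfolding \<gamma> by (simp add: axis_def)
      moreover have "real (k + CARD('n)) * monom_sqnorm \<alpha> = real (\<gamma> $ i + 1) * monom_sqnorm \<gamma>"
        using monom_sqnorm_Suc[of \<gamma> i] \<open>mdeg \<gamma> = k\<close> by (simp only: \<gamma>[symmetric])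
      moreover have "real (k + CARD('n)) > 0" by (simp only: of_nat_0_less_iff) simp
      ultimately show ?thesis
        by (metis nonzero_mult_div_cancel_left order_less_irrefl times_divide_eq_left)
    qed
    then show ?thesis
      unfolding 1 2 moment_sphere unfolding \<gamma>_def[symmetric] by (auto simp: \<gamma>)
  qed
next
  case (add f g)
  have "integrable sphere_measure (\<lambda>\<eta>. mmonom \<alpha> \<eta> * cnj (\<eta> $ i * h \<eta>))"
     "integrable sphere_measure (\<lambda>\<eta>. mmonom (\<alpha> - axis i 1) \<eta> * cnj (h \<eta>))" if "polyfun h" for h
    using that by (intro integrable_monom_cnj_polyfun polyfun_mult polyfun.monom polyfun_coord; simp)+
  then show ?case
    using add by (simp add: distrib_left)
next
  case (cmult f c)
  have e: "(LINT \<eta>|sphere_measure. a \<eta> * cnj (b \<eta> * (c * f \<eta>)))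
      = cnj c * (LINT \<eta>|sphere_measure. a \<eta> * cnj (b \<eta> * f \<eta>))" for a b
    by (subst integral_mult_right_zero[symmetric]) (simp add: mult_ac)
  show ?case
    using e[of "mmonom \<alpha>" "\<lambda>\<eta>. \<eta> $ i"] e[of "mmonom (\<alpha> - axis i 1)" "\<lambda>\<eta>. 1"] cmult
    by simp
qed

text \<open>The binomial coefficient of d+k-1 over k, that is, the k-th Taylor coefficient of
  (1-x)^(-d).\<close>

definition szego_coeff :: "nat \<Rightarrow> nat \<Rightarrow> real" where
  "szego_coeff d k = pochhammer (real d) k / fact k"

lemma szego_coeff_pos: "d > 0 \<Longrightarrow> szego_coeff d k > 0"
  by (simp add: szego_coeff_def pochhammer_pos)

lemma szego_coeff_Suc: "szego_coeff d (Suc k) = szego_coeff d k * real (k + d) / real (Suc k)"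
  by (simp add: szego_coeff_def pochhammer_Suc field_simps)

text \<open>The degree-k term of the Szego kernel projects onto the homogeneous polynomials of
  degree k. One factor of the power is expanded in coordinates and moved to the other side by the
  adjoint formula, which lowers all degrees by one; the sum of the \<open>\<alpha> $ i\<close>,
  equal to k+1, cancels against the quotient of consecutive coefficients.\<close>

lemma integral_monom_cinner_power:
  fixes \<alpha> :: "nat ^ 'n::finite"
  shows "of_real (szego_coeff CARD('n) k) * (LINT \<eta>|sphere_measure. mmonom \<alpha> \<eta> * cinner z \<eta> ^ k)
    = (if mdeg \<alpha> = k then mmonom \<alpha> z else 0)"
proof (induction k arbitrary: \<alpha>)
  case 0
  have "(LINT \<eta>|sphere_measure. mmonom \<alpha> \<eta> * cinner z \<eta> ^ 0) = moment sphere_measure \<alpha> 0"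
    by (simp add: moment_def)
  moreover have "monom_sqnorm (0 :: nat ^ 'n) = 1"
    by (simp add: monom_sqnorm_def sphere.prob_space[simplified])
  ultimately show ?case
    by (auto simp: moment_sphere szego_coeff_def mdeg_eq_0_iff)
next
  case (Suc k)
  let ?d = "CARD('n)"
  note IH = Suc.IH
    have pQ: "polyfun (\<lambda>\<eta>. cinner \<eta> z ^ k)"
      by (intro polyfun_power polyfun_cinner_left)
    have "(LINT \<eta>|sphere_measure. mmonom \<alpha> \<eta> * cinner z \<eta> ^ Suc k)
       = (LINT \<eta>|sphere_measure. (\<Sum>i\<in>UNIV. z $ i * (mmonom \<alpha> \<eta> * cnj (\<eta> $ i * cinner \<eta> z ^ k))))"
    proof (intro Bochner_Integration.integral_cong refl)
      fix \<eta> :: "complex ^ 'n"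
      have "mmonom \<alpha> \<eta> * cinner z \<eta> ^ Suc k = mmonom \<alpha> \<eta> * (cinner z \<eta> ^ k * cinner z \<eta>)"
        by simp
      also have "\<dots> = mmonom \<alpha> \<eta> * (cinner z \<eta> ^ k * (\<Sum>i\<in>UNIV. z $ i * cnj (\<eta> $ i)))"
        by (simp only: cinner_def)
      finally show "mmonom \<alpha> \<eta> * cinner z \<eta> ^ Suc k
          = (\<Sum>i\<in>UNIV. z $ i * (mmonom \<alpha> \<eta> * cnj (\<eta> $ i * cinner \<eta> z ^ k)))"
        by (simp add: cinner_commute[of \<eta> z] sum_distrib_left mult_ac)
    qed
    also have "\<dots> = (\<Sum>i\<in>UNIV. z $ i * (LINT \<eta>|sphere_measure. mmonom \<alpha> \<eta> * cnj (\<eta> $ i * cinner \<eta> z ^ k)))"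
      by (subst Bochner_Integration.integral_sum)
        (auto intro!: integrable_mult_right integrable_monom_cnj_polyfun polyfun_mult polyfun.monom pQ simp del: complex_cnj_mult)
    finally have I: "(LINT \<eta>|sphere_measure. mmonom \<alpha> \<eta> * cinner z \<eta> ^ Suc k) = \<dots>" .
    show ?case
    proof (cases "mdeg \<alpha> = Suc k")
      case True
      have S: "of_real (szego_coeff ?d k) * (z $ i * (LINT \<eta>|sphere_measure. mmonom \<alpha> \<eta> * cnj (\<eta> $ i * cinner \<eta> z ^ k)))
        = of_real (real (\<alpha> $ i) / real (k + ?d)) * mmonom \<alpha> z" for i
      proof (cases "\<alpha> $ i = 0")
        case False
        define \<gamma> where "\<gamma> = \<alpha> - axis i 1"
        have \<gamma>: "\<alpha> = \<gamma> + axis i 1"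
          using False by (auto simp: \<gamma>_def vec_eq_iff axis_def)
        have "mdeg \<gamma> = k"
          using True unfolding \<gamma> mdeg_add by simp
        then have "of_real (szego_coeff ?d k) * (LINT \<eta>|sphere_measure. mmonom \<gamma> \<eta> * cnj (cinner \<eta> z ^ k)) = mmonom \<gamma> z"
          using Suc[of \<gamma>] by (simp add: cinner_commute[of _ z])
        then show ?thesis
          unfolding integral_monom_cnj_coord[OF pQ True] \<gamma>_def[symmetric]
          by (simp add: \<gamma> mmonom_add mult_ac)
      next
        case True
        then show ?thesis
          unfolding integral_monom_cnj_coord[OF pQ \<open>mdeg \<alpha> = Suc k\<close>] by simp
      qed
      have "of_real (szego_coeff ?d k) * (LINT \<eta>|sphere_measure. mmonom \<alpha> \<eta> * cinner z \<eta> ^ Suc k)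
         = (\<Sum>i\<in>UNIV. of_real (real (\<alpha> $ i) / real (k + ?d)) * mmonom \<alpha> z)"
        unfolding I sum_distrib_left S ..
      also have "\<dots> = of_real ((\<Sum>i\<in>UNIV. real (\<alpha> $ i)) / real (k + ?d)) * mmonom \<alpha> z"
        by (simp only: sum_distrib_right sum_divide_distrib of_real_sum)
      also have "(\<Sum>i\<in>UNIV. real (\<alpha> $ i)) = real (Suc k)"
        using True by (simp add: mdeg_def flip: of_nat_sum)
      finally have F: "of_real (szego_coeff ?d k) * (LINT \<eta>|sphere_measure. mmonom \<alpha> \<eta> * cinner z \<eta> ^ Suc k)
        = of_real (real (Suc k) / real (k + ?d)) * mmonom \<alpha> z" .
      have G: "szego_coeff ?d (Suc k) = (real (k + ?d) / real (Suc k)) * szego_coeff ?d k"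
        by (simp add: szego_coeff_Suc)
      have H: "(real (k + ?d) / real (Suc k)) * (real (Suc k) / real (k + ?d)) = 1"
        using not_less_eq by (simp del: of_nat_add of_nat_Suc)
      have "of_real (szego_coeff ?d (Suc k)) * (LINT \<eta>|sphere_measure. mmonom \<alpha> \<eta> * cinner z \<eta> ^ Suc k)
        = of_real ((real (k + ?d) / real (Suc k)) * (real (Suc k) / real (k + ?d))) * mmonom \<alpha> z"
        unfolding G of_real_mult mult.assoc F ..
      then show ?thesis
        unfolding H using True by simp
    next
      case False
      have "(LINT \<eta>|sphere_measure. mmonom \<alpha> \<eta> * cnj (\<eta> $ i * cinner \<eta> z ^ k)) = 0" for i
      \<comment> \<open>A constant monomial cannot be lowered, so it is treated by orthogonality to
        every polynomial divisible by a coordinate.\<close>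
      proof (cases "mdeg \<alpha>")
        case 0
        have "(LINT \<eta>|sphere_measure. mmonom \<alpha> \<eta> * cnj (\<eta> $ i * Q \<eta>)) = 0" if "polyfun Q" for Q
          using that
        proof induction
          case (monom \<beta>)
          have "\<alpha> \<noteq> \<beta> + axis i 1"
            using 0 by (auto simp: mdeg_add)
          then have "moment sphere_measure \<alpha> (\<beta> + axis i 1) = 0"
            by (rule moment_sphere_orthogonal)
          then show ?case
            by (simp add: moment_def mmonom_add mult_ac)
        next
          case (add f g)
          have "integrable sphere_measure (\<lambda>\<eta>. mmonom \<alpha> \<eta> * cnj (\<eta> $ i * h \<eta>))" if "polyfun h" for h
            using that by (intro integrable_monom_cnj_polyfun polyfun_mult polyfun.monom polyfun_coord)
          then show ?case
            using add by (simp add: distrib_left)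
        next
          case (cmult f c)
          have "(LINT \<eta>|sphere_measure. mmonom \<alpha> \<eta> * cnj (\<eta> $ i * (c * f \<eta>)))
             = cnj c * (LINT \<eta>|sphere_measure. mmonom \<alpha> \<eta> * cnj (\<eta> $ i * f \<eta>))"
            by (subst integral_mult_right_zero[symmetric]) (simp add: mult_ac)
          then show ?case using cmult by simp
        qed
        then show ?thesis using pQ by blast
      next
        case (Suc l)
        show ?thesis
        proof (cases "\<alpha> $ i = 0")
          case True
          then show ?thesis
            using integral_monom_cnj_coord[OF pQ Suc, of i] by simp
        next
          case a: False
          define \<gamma> where "\<gamma> = \<alpha> - axis i 1"
          have \<gamma>: "\<alpha> = \<gamma> + axis i 1"
            using a by (auto simp: \<gamma>_def vec_eq_iff axis_def)
          have "mdeg \<gamma> \<noteq> k"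
            using False unfolding \<gamma> mdeg_add by simp
          then have "(LINT \<eta>|sphere_measure. mmonom \<gamma> \<eta> * cnj (cinner \<eta> z ^ k)) = 0"
            using IH[of \<gamma>] szego_coeff_pos[of ?d k] by (simp add: cinner_commute[of _ z])
          then show ?thesis
            unfolding integral_monom_cnj_coord[OF pQ Suc] \<gamma>_def[symmetric] by simp
        qed
      qed
      then show ?thesis
        unfolding I using False by simp
    qed
qed

text \<open>The invariant Poisson--Szego kernel of the ball, not the Euclidean Poisson kernel: its
  singularity is measured by |1 - <z,\<eta>>|, the quantity that also defines the Koranyi
  regions.\<close>

definition poisson_kernel :: "complex ^ 'n::finite \<Rightarrow> complex ^ 'n \<Rightarrow> real" where
  "poisson_kernel z \<eta> = ((1 - (norm z)\<^sup>2) / (norm (1 - cinner z \<eta>))\<^sup>2) ^ CARD('n)"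

lemma szego_sums:
  assumes "norm x < 1"
  shows "(\<lambda>k. of_real (szego_coeff d k) * x ^ k) sums (1 / (1 - x :: complex) ^ d)"
proof -
  have "((\<lambda>k. (- of_nat d gchoose k) * (- x) ^ k) sums (1 + (- x)) powr (- of_nat d))"
    by (rule gen_binomial_complex) (use assms in simp)
  moreover have "(- of_nat d gchoose k) * (- x) ^ k = of_real (szego_coeff d k) * x ^ k" for k
  proof -
    have p: "of_real (pochhammer (real d) k) = (pochhammer (of_nat d) k :: complex)"
      by (simp add: pochhammer_of_real[symmetric])
    have "(- 1) ^ k * (- x) ^ k = x ^ k"
      by (simp flip: power_mult_distrib)
    then show ?thesis
      by (simp add: gbinomial_pochhammer szego_coeff_def p)
  qed
  moreover have "(1 + (- x)) powr (- of_nat d) = 1 / (1 - x) ^ d"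
  proof -
    have "1 - x \<noteq> 0" using assms by auto
    then show ?thesis by (simp add: powr_minus powr_nat' divide_inverse)
  qed
  ultimately show ?thesis by simp
qed

definition szego_partial :: "nat \<Rightarrow> complex ^ 'n::finite \<Rightarrow> complex ^ 'n \<Rightarrow> complex" where
  "szego_partial N z \<eta> = (\<Sum>k<N. of_real (szego_coeff CARD('n) k) * cinner z \<eta> ^ k)"

lemma szego_partial_limit:
  assumes "norm (cinner z \<eta>) < 1"
  shows "(\<lambda>N. szego_partial N z (\<eta> :: complex ^ 'n::finite)) \<longlonglongrightarrow> 1 / (1 - cinner z \<eta>) ^ CARD('n)"
  unfolding szego_partial_def using szego_sums[OF assms] by (simp add: sums_def)

text \<open>The coefficients are positive, so the series at the real point \<open>r\<close>
  majorises all partial sums. Uniformity in \<open>N\<close> is what dominated convergence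
  needs.\<close>

lemma norm_szego_partial_le:
  fixes \<eta> :: "complex ^ 'n::finite"
  assumes "norm (cinner z \<eta>) \<le> r" "r < 1"
  shows "norm (szego_partial N z \<eta>) \<le> 1 / (1 - r) ^ CARD('n)"
proof -
  have "0 \<le> r" using assms(1) norm_ge_zero order_trans by blast
  then have r: "norm (of_real r :: complex) < 1" using assms by simp
  have pos: "szego_coeff CARD('n) k \<ge> 0" for k
    using szego_coeff_pos[of "CARD('n)" k] by (simp add: less_imp_le)
  have "(\<lambda>k. complex_of_real (szego_coeff CARD('n) k * r ^ k)) sums complex_of_real (1 / (1 - r) ^ CARD('n))"
    using szego_sums[OF r, of "CARD('n)"] by simp
  then have s: "(\<lambda>k. szego_coeff CARD('n) k * r ^ k) sums (1 / (1 - r) ^ CARD('n))"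
    unfolding sums_of_real_iff .
  have "norm (szego_partial N z \<eta>) \<le> (\<Sum>k<N. szego_coeff CARD('n) k * r ^ k)"
    unfolding szego_partial_def
    by (rule sum_norm_le) (auto simp: norm_mult norm_power pos abs_of_nonneg intro!: mult_left_mono power_mono assms)
  also have "\<dots> \<le> 1 / (1 - r) ^ CARD('n)"
    using sum_le_suminf[OF sums_summable[OF s], of "{..<N}"] sums_unique[OF s] pos \<open>0 \<le> r\<close> by simp
  finally show ?thesis .
qed

lemma continuous_on_szego_partial: "continuous_on A (szego_partial N z)"
  unfolding szego_partial_def by (intro continuous_intros)

text \<open>Conjugation swaps the arguments of the Hermitian form, so the conjugate kernel is
  holomorphic in the integration variable and may be multiplied to the polynomial that is being
  reproduced.\<close>

lemma polyfun_cnj_szego_partial: "polyfun (\<lambda>\<eta>. cnj (szego_partial N z \<eta>))"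
proof -
  have "cnj (szego_partial N z \<eta>) = (\<Sum>k<N. of_real (szego_coeff CARD('a) k) * cinner \<eta> z ^ k)" for \<eta>
    by (simp add: szego_partial_def cinner_commute[of \<eta> z])
  then show ?thesis
    by (simp only:) (intro polyfun_sum polyfun.cmult polyfun_power polyfun_cinner_left)
qed

text \<open>The integral is eventually constant, with the degree as threshold. An existential
  threshold replaces the degree, which \<open>polyfun\<close> does not record, and combines by
  maximum under addition.\<close>

lemma szego_partial_reproducing:
  fixes z :: "complex ^ 'n::finite"
  assumes "polyfun f"
  shows "\<exists>M. \<forall>N\<ge>M. (LINT \<eta>|sphere_measure. f \<eta> * szego_partial N z \<eta>) = f z"
  using assms
proof induction
  case (monom \<alpha>)
  have "(LINT \<eta>|sphere_measure. mmonom \<alpha> \<eta> * szego_partial N z \<eta>) = mmonom \<alpha> z" if "N \<ge> Suc (mdeg \<alpha>)" for N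
  proof -
    have "(LINT \<eta>|sphere_measure. mmonom \<alpha> \<eta> * szego_partial N z \<eta>)
       = (LINT \<eta>|sphere_measure. (\<Sum>k<N. of_real (szego_coeff CARD('n) k) * (mmonom \<alpha> \<eta> * cinner z \<eta> ^ k)))"
      by (simp add: szego_partial_def sum_distrib_left mult_ac)
    also have "\<dots> = (\<Sum>k<N. of_real (szego_coeff CARD('n) k) * (LINT \<eta>|sphere_measure. mmonom \<alpha> \<eta> * cinner z \<eta> ^ k))"
      by (subst Bochner_Integration.integral_sum)
        (auto intro!: integrable_mult_right integrable_sphere_continuous continuous_intros)
    also have "\<dots> = mmonom \<alpha> z"
      using that by (simp add: integral_monom_cinner_power)
    finally show ?thesis .
  qed
  then show ?case by blast
next
  case (add f g)
  then obtain M1 M2 where M: "\<forall>N\<ge>M1. (LINT \<eta>|sphere_measure. f \<eta> * szego_partial N z \<eta>) = f z"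
    "\<forall>N\<ge>M2. (LINT \<eta>|sphere_measure. g \<eta> * szego_partial N z \<eta>) = g z" by blast
  have "integrable sphere_measure (\<lambda>\<eta>. h \<eta> * szego_partial N z \<eta>)" if "polyfun h" for h N
    by (intro integrable_sphere_continuous continuous_intros continuous_on_polyfun continuous_on_szego_partial that)
  then show ?case
    using M add by (intro exI[of _ "max M1 M2"]) (simp add: distrib_right)
next
  case (cmult f c)
  have "(LINT \<eta>|sphere_measure. c * f \<eta> * szego_partial N z \<eta>) = c * (LINT \<eta>|sphere_measure. f \<eta> * szego_partial N z \<eta>)" for N
    by (subst integral_mult_right_zero[symmetric]) (simp add: mult_ac)
  then show ?case using cmult by auto
qed

text \<open>Reproducing the polynomial \<open>f \<cdot> cnj (szego_partial M z)\<close> at \<open>z\<close> yields the Poisson--Szego formula, since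
  the Poisson kernel is the squared modulus of the Szego kernel divided by its diagonal value.\<close>

lemma measurable_cnj [measurable]: "cnj \<in> borel_measurable borel"
  by (intro borel_measurable_continuous_onI continuous_intros)

lemma poisson_formula:
  fixes z :: "complex ^ 'n::finite"
  assumes f: "polyfun f" and z: "norm z < 1"
  shows "(LINT \<eta>|sphere_measure. f \<eta> * of_real (poisson_kernel z \<eta>)) = f z"
proof -
  define S where "S = (\<lambda>\<eta>. 1 / (1 - cinner z \<eta>) ^ CARD('n))"
  define B where "B = 1 / (1 - norm z) ^ CARD('n)"
  have ci: "norm (cinner z \<eta>) \<le> norm z" if "norm \<eta> = 1" for \<eta>
    using norm_cinner_le[of z \<eta>] that by simp
  have lim: "(\<lambda>N. szego_partial N z \<eta>) \<longlonglongrightarrow> S \<eta>" if "norm \<eta> = 1" for \<eta>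
    unfolding S_def using ci[OF that] z by (intro szego_partial_limit) simp
  have bd: "norm (szego_partial N z \<eta>) \<le> B" if "norm \<eta> = 1" for \<eta> N
    unfolding B_def by (intro norm_szego_partial_le ci that z)
  have bd': "norm (S \<eta>) \<le> B" if "norm \<eta> = 1" for \<eta>
    by (rule Lim_bounded[OF tendsto_norm[OF lim[OF that]]]) (use bd that in blast)
  have [measurable]: "S \<in> borel_measurable borel"
    unfolding S_def by (intro borel_measurable_divide borel_measurable_power borel_measurable_diff borel_measurable_const
        borel_measurable_continuous_onI continuous_intros)
  have [measurable]: "szego_partial N z \<in> borel_measurable borel" for N
    by (intro borel_measurable_continuous_onI continuous_on_szego_partial)
  have [measurable]: "f \<in> borel_measurable borel"
    by (rule borel_measurable_polyfun[OF f])
  obtain C where C: "\<And>\<eta>. norm \<eta> = 1 \<Longrightarrow> norm (f \<eta>) \<le> C"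
    using continuous_bounded_on_sphere[OF continuous_on_polyfun[OF f]] by blast
  obtain e :: "complex ^ 'n" where "norm e = 1"
    using vector_choose_size[of 1] by auto
  then have C0: "0 \<le> C" using order_trans[OF norm_ge_zero C] by blast
  have B0: "0 \<le> B" using z by (simp add: B_def)
  \<comment> \<open>The two kernel factors are completed one after the other: with \<open>M\<close>
    fixed the conjugated factor is still a polynomial, so \<open>N\<close> may tend to infinity;
    only then does \<open>M\<close>.\<close>
  have step: "(LINT \<eta>|sphere_measure. f \<eta> * cnj (szego_partial M z \<eta>) * S \<eta>) = f z * cnj (szego_partial M z z)" for M
  proof (rule LIMSEQ_unique)
    show "(\<lambda>N. LINT \<eta>|sphere_measure. f \<eta> * cnj (szego_partial M z \<eta>) * szego_partial N z \<eta>)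
       \<longlonglongrightarrow> (LINT \<eta>|sphere_measure. f \<eta> * cnj (szego_partial M z \<eta>) * S \<eta>)"
    proof (rule integral_dominated_convergence[where w = "\<lambda>_. C * B * B"])
      show "AE \<eta> in sphere_measure. (\<lambda>N. f \<eta> * cnj (szego_partial M z \<eta>) * szego_partial N z \<eta>)
          \<longlonglongrightarrow> f \<eta> * cnj (szego_partial M z \<eta>) * S \<eta>"
        using AE_sphere_measure by eventually_elim (auto intro!: tendsto_intros lim)
      show "AE \<eta> in sphere_measure. norm (f \<eta> * cnj (szego_partial M z \<eta>) * szego_partial N z \<eta>) \<le> C * B * B" for N
        using AE_sphere_measure
        by eventually_elim (auto simp: norm_mult intro!: mult_mono bd C B0 C0 mult_nonneg_nonneg)
    qed (simp_all)
    have "polyfun (\<lambda>\<eta>. f \<eta> * cnj (szego_partial M z \<eta>))"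
      by (intro polyfun_mult f polyfun_cnj_szego_partial)
    from szego_partial_reproducing[OF this, of z]
    show "(\<lambda>N. LINT \<eta>|sphere_measure. f \<eta> * cnj (szego_partial M z \<eta>) * szego_partial N z \<eta>)
       \<longlonglongrightarrow> f z * cnj (szego_partial M z z)"
      by (intro tendsto_eventually) (simp add: eventually_sequentially)
  qed
  have "(LINT \<eta>|sphere_measure. f \<eta> * cnj (S \<eta>) * S \<eta>) = f z * cnj (S z)"
  proof (rule LIMSEQ_unique)
    show "(\<lambda>M. LINT \<eta>|sphere_measure. f \<eta> * cnj (szego_partial M z \<eta>) * S \<eta>)
       \<longlonglongrightarrow> (LINT \<eta>|sphere_measure. f \<eta> * cnj (S \<eta>) * S \<eta>)"
    proof (rule integral_dominated_convergence[where w = "\<lambda>_. C * B * B"])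
      show "AE \<eta> in sphere_measure. (\<lambda>M. f \<eta> * cnj (szego_partial M z \<eta>) * S \<eta>)
          \<longlonglongrightarrow> f \<eta> * cnj (S \<eta>) * S \<eta>"
        using AE_sphere_measure by eventually_elim (auto intro!: tendsto_intros lim)
      show "AE \<eta> in sphere_measure. norm (f \<eta> * cnj (szego_partial M z \<eta>) * S \<eta>) \<le> C * B * B" for M
        using AE_sphere_measure
        by eventually_elim (auto simp: norm_mult intro!: mult_mono bd bd' C B0 C0 mult_nonneg_nonneg)
    qed (simp_all)
    have "norm (cinner z z) < 1"
      using z by (simp add: cinner_self norm_power power_less_one_iff)
    then have "(\<lambda>M. szego_partial M z z) \<longlonglongrightarrow> S z"
      unfolding S_def by (rule szego_partial_limit)
    then show "(\<lambda>M. LINT \<eta>|sphere_measure. f \<eta> * cnj (szego_partial M z \<eta>) * S \<eta>) \<longlonglongrightarrow> f z * cnj (S z)"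
      unfolding step by (intro tendsto_intros)
  qed
  moreover have "S z = of_real (1 / (1 - (norm z)\<^sup>2) ^ CARD('n))"
    by (simp add: S_def cinner_self)
  moreover have "(complex_of_real (norm z))\<^sup>2 \<noteq> 1"
  proof -
    have "(norm z)\<^sup>2 < 1" using z by (simp add: power_less_one_iff)
    then show ?thesis by (metis of_real_eq_1_iff of_real_power less_irrefl)
  qed
  ultimately have "(LINT \<eta>|sphere_measure. of_real ((1 - (norm z)\<^sup>2) ^ CARD('n)) * (f \<eta> * cnj (S \<eta>) * S \<eta>)) = f z"
    by simp
  moreover have "of_real ((1 - (norm z)\<^sup>2) ^ CARD('n)) * (f \<eta> * cnj (S \<eta>) * S \<eta>) = f \<eta> * of_real (poisson_kernel z \<eta>)" for \<eta>
  proof -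
    have "cnj (S \<eta>) * S \<eta> = of_real ((norm (S \<eta>))\<^sup>2)"
      by (metis complex_norm_square mult.commute)
    moreover have "(1 - (norm z)\<^sup>2) ^ CARD('n) * (norm (S \<eta>))\<^sup>2 = poisson_kernel z \<eta>"
      by (simp add: S_def poisson_kernel_def norm_divide norm_power power_divide mult.commute flip: power_mult)
    ultimately show ?thesis
      by (metis (no_types, lifting) mult.assoc mult.left_commute of_real_mult)
  qed
  ultimately show ?thesis by (simp only:)
qed

section \<open>The Koranyi maximal inequality\<close>

text \<open>Quasi-triangle inequality of Koranyi's distance on the closed ball. \<open>a\<close> and
  \<open>c\<close> are split into multiples of \<open>b\<close> and remainders; a remainder has
  squared norm at most 2 |1 - <a,b>|, respectively 2 |1 - <c,b>|. For |b| = 1 this is the orthogonal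
  decomposition, and for smaller \<open>b\<close> there are corrections with the factor 1 - |b|^2.
  The bounds add up to 4x + 2y.\<close>

lemma norm_one_minus_cinner_quasi_triangle:
  fixes a b c :: "complex ^ 'n::finite"
  assumes a: "norm a \<le> 1" and b: "norm b \<le> 1" and c: "norm c \<le> 1"
  shows "norm (1 - cinner a c) \<le> 4 * (norm (1 - cinner a b) + norm (1 - cinner b c))"
proof -
  have proj: "(norm (a - cinner a b *s b))\<^sup>2 \<le> 2 * norm (1 - cinner a b)"
    if a: "norm a \<le> 1" for a
  proof -
    define t where "t = norm (cinner a b)"
    have t: "0 \<le> t" "t \<le> norm b" "t \<le> 1"
      using norm_cinner_le[of a b] mult_right_mono[OF a norm_ge_zero[of b]] b by (simp_all add: t_def)
    have "cinner (a - cinner a b *s b) (a - cinner a b *s b)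
      = cinner a a - (2 - cinner b b) * (cinner a b * cnj (cinner a b))"
      by (simp add: cinner_diff_left cinner_diff_right cinner_scale_left cinner_scale_right
          cinner_commute[of b a] algebra_simps)
    then have "complex_of_real ((norm (a - cinner a b *s b))\<^sup>2) = of_real ((norm a)\<^sup>2 - (2 - (norm b)\<^sup>2) * t\<^sup>2)"
      by (simp add: cinner_self t_def complex_norm_square[symmetric])
    then have "(norm (a - cinner a b *s b))\<^sup>2 = (norm a)\<^sup>2 - (2 - (norm b)\<^sup>2) * t\<^sup>2"
      unfolding of_real_eq_iff .
    also have "\<dots> \<le> 1 - 1 * t\<^sup>2"
      using a b by (intro diff_mono mult_right_mono) (auto simp: power_le_one)
    also have "1 - 1 * t\<^sup>2 = (1 - t) * (1 + t)"
      by (simp add: algebra_simps power2_eq_square)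
    also have "\<dots> \<le> (1 - t) * 2"
      using t by (intro mult_left_mono) auto
    also have "1 - t \<le> norm (1 - cinner a b)"
      using norm_triangle_ineq2[of 1 "cinner a b"] by (simp add: t_def)
    finally show ?thesis by simp
  qed
  define x y where "x = norm (1 - cinner a b)" and "y = norm (1 - cinner b c)"
  have cb: "norm (1 - cinner c b) = y"
    unfolding y_def by (metis cinner_commute complex_cnj_diff complex_cnj_one complex_mod_cnj)
  have "cinner (a - cinner a b *s b) (c - cinner c b *s b)
      = cinner a c - (2 - cinner b b) * (cinner a b * cinner b c)"
    by (simp add: cinner_diff_left cinner_diff_right cinner_scale_left cinner_scale_right
        cinner_commute[of c b] algebra_simps)
  \<comment> \<open>The last two terms collect what is missing from the product rule along
    \<open>b\<close>: the defect of |b| from 1 and the pairing of the two remainders.\<close>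
  then have *: "1 - cinner a c = (1 - cinner a b) + cinner a b * (1 - cinner b c)
      - cinner a b * cinner b c * (1 - cinner b b)
      - cinner (a - cinner a b *s b) (c - cinner c b *s b)"
    by (simp add: algebra_simps)
  have "norm (1 - cinner a c) \<le> norm (1 - cinner a b) + norm (cinner a b * (1 - cinner b c))
      + norm (cinner a b * cinner b c * (1 - cinner b b))
      + norm (cinner (a - cinner a b *s b) (c - cinner c b *s b))"
  proof -
    have "norm (p + q - u - v) \<le> norm p + norm q + norm u + norm v" for p q u v :: complex
      using norm_triangle_ineq4[of "p + q - u" v] norm_triangle_ineq4[of "p + q" u] norm_triangle_ineq[of p q]
      by linarith
    then show ?thesis using * by metis
  qed
  moreover have ab: "norm (cinner a b) \<le> norm b" "norm (cinner a b) \<le> 1" "norm (cinner b c) \<le> 1"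
    using norm_cinner_le[of a b] norm_cinner_le[of b c] mult_mono[OF a b] mult_mono[OF b c] mult_right_mono[OF a, of "norm b"]
    by auto
  have "norm (cinner a b * (1 - cinner b c)) \<le> y"
    unfolding y_def norm_mult using ab by (simp add: mult_left_le_one_le)
  moreover have "norm (cinner a b * cinner b c * (1 - cinner b b)) \<le> 2 * x"
  proof -
    have "norm (1 - cinner b b) = 1 - (norm b)\<^sup>2"
    proof -
      have "1 - cinner b b = of_real (1 - (norm b)\<^sup>2)"
        by (simp add: cinner_self)
      then show ?thesis
        using b by (simp only: norm_of_real) (simp add: power_le_one)
    qed
    also have "\<dots> = (1 - norm b) * (1 + norm b)"
      by (simp add: algebra_simps power2_eq_square)
    also have "\<dots> \<le> (1 - norm b) * 2"
      using b by (intro mult_left_mono) auto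
    also have "1 - norm b \<le> x"
      using norm_triangle_ineq2[of 1 "cinner a b"] ab by (simp add: x_def)
    finally have "norm (1 - cinner b b) \<le> 2 * x" by simp
    moreover have "norm (cinner a b * cinner b c) \<le> 1"
      unfolding norm_mult using ab by (intro mult_le_one) auto
    ultimately show ?thesis
      unfolding norm_mult[of _ "1 - cinner b b"]
      using mult_mono[of _ 1 "norm (1 - cinner b b)" "2 * x"] by simp
  qed
  moreover have "norm (cinner (a - cinner a b *s b) (c - cinner c b *s b)) \<le> x + y"
  proof -
    have "norm (cinner (a - cinner a b *s b) (c - cinner c b *s b))
       \<le> norm (a - cinner a b *s b) * norm (c - cinner c b *s b)"
      by (rule norm_cinner_le)
    also have "2 * \<dots> \<le> (norm (a - cinner a b *s b))\<^sup>2 + (norm (c - cinner c b *s b))\<^sup>2"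
      using sum_squares_bound by (simp add: mult.assoc[symmetric])
    also have "\<dots> \<le> 2 * x + 2 * y"
      using proj[OF a] proj[OF c] unfolding cb x_def by simp
    finally show ?thesis by simp
  qed
  moreover have "x \<ge> 0" "y \<ge> 0" by (auto simp: x_def y_def)
  ultimately show ?thesis
    unfolding x_def[symmetric] y_def[symmetric] by simp
qed

section \<open>Pointwise and integrated bounds for the Poisson kernel\<close>

lemma one_minus_norm_le_cinner:
  assumes "norm \<xi> \<le> 1"
  shows "1 - norm z \<le> norm (1 - cinner z \<xi>)"
proof -
  have "norm (cinner z \<xi>) \<le> norm z"
    using norm_cinner_le[of z \<xi>] assms mult_left_le order_trans norm_ge_zero by blast
  then show ?thesis
    using norm_triangle_ineq2[of 1 "cinner z \<xi>"] by simp
qed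

lemma norm_one_minus_cinner_commute: "norm (1 - cinner x y) = norm (1 - cinner y x)"
  by (metis cinner_commute complex_cnj_diff complex_cnj_one complex_mod_cnj)

lemma poisson_kernel_nonneg: "norm z \<le> 1 \<Longrightarrow> 0 \<le> poisson_kernel z \<eta>"
  by (simp add: poisson_kernel_def power_le_one)

lemma poisson_kernel_le:
  assumes "norm z < 1" "norm \<eta> = 1"
  shows "poisson_kernel z (\<eta> :: complex ^ 'n::finite) \<le> (1 / (1 - norm z)\<^sup>2) ^ CARD('n)"
  unfolding poisson_kernel_def
  using assms one_minus_norm_le_cinner[of \<eta> z]
  by (intro power_mono frac_le power_mono) (auto simp: power_le_one)

lemma measurable_poisson_kernel [measurable]: "poisson_kernel z \<in> borel_measurable borel"
proof -
  have [measurable]: "cinner z \<in> borel_measurable borel"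
    by (intro borel_measurable_continuous_onI continuous_intros)
  show ?thesis unfolding poisson_kernel_def[abs_def] by measurable
qed

lemma integrable_poisson_kernel:
  assumes "norm (z :: complex ^ 'n::finite) < 1"
  shows "integrable sphere_measure (poisson_kernel z)"
proof (rule integrable_sphere_bounded[OF measurable_poisson_kernel])
  show "norm (poisson_kernel z \<eta>) \<le> (1 / (1 - norm z)\<^sup>2) ^ CARD('n)" if "norm \<eta> = 1" for \<eta>
    using poisson_kernel_le[OF assms that] poisson_kernel_nonneg[of z \<eta>] assms by simp
qed

lemma integral_poisson_kernel:
  assumes "norm z < 1" shows "(LINT \<eta>|sphere_measure. poisson_kernel z \<eta>) = 1"
proof -
  have "complex_of_real (LINT \<eta>|sphere_measure. poisson_kernel z \<eta>) = 1"
    using poisson_formula[OF polyfun_const[of 1] assms] by simp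
  then show ?thesis by (simp only: of_real_eq_1_iff)
qed

text \<open>The comparison constant 32 (1+c) of the distances enters the Poisson kernel squared and
  then to the power d.\<close>

definition koranyi_const :: "real \<Rightarrow> nat \<Rightarrow> real" where
  "koranyi_const c d = ((32 * (1 + c))\<^sup>2) ^ d"

text \<open>Since \<open>z'\<close> approaches \<zeta> inside its region, the quasi-triangle
  inequality bounds the distance from \<open>z\<close> to \<zeta> by the distances of
  \<open>z\<close> and \<open>z'\<close> to \<xi>. One of these two dominates, and the corresponding
  kernel at \<xi> is at most a constant times the kernel of \<open>z\<close> at \<zeta>; for
  \<open>z'\<close> the numerators compare because |z| \<le> |z'|. The other kernel is kept as a
  factor.\<close>

lemma poisson_kernel_product_bound:
  fixes z z' \<zeta> \<xi> :: "complex ^ 'n::finite"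
  assumes c: "c > 1" and z: "norm z < 1" and z': "z' \<in> koranyi_region c \<zeta>"
    and \<zeta>: "norm \<zeta> = 1" and \<xi>: "norm \<xi> = 1" and le: "norm z \<le> norm z'"
  shows "poisson_kernel z \<xi> * poisson_kernel z' \<xi>
    \<le> koranyi_const c CARD('n) * poisson_kernel z \<zeta> * (poisson_kernel z \<xi> + poisson_kernel z' \<xi>)"
proof -
  define D where "D = (\<lambda>x y :: complex ^ 'n. norm (1 - cinner x y))"
  define k where "k = 32 * (1 + c)"
  have nz': "norm z' < 1" and kz': "D z' \<zeta> < c / 2 * (1 - (norm z')\<^sup>2)"
    using z' by (auto simp: koranyi_region_def D_def)
  have k: "k > 0" using c by (simp add: k_def)
  have pos: "D x y > 0" if "norm x < 1" "norm y = 1" for x y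
    using one_minus_norm_le_cinner[of y x] that unfolding D_def by linarith
  have P: "poisson_kernel x y = ((1 - (norm x)\<^sup>2) / (D x y)\<^sup>2) ^ CARD('n)" for x y
    by (simp add: poisson_kernel_def D_def)
  have "D z' \<zeta> \<le> c / 2 * ((1 - norm z') * (1 + norm z'))"
    using kz' by (simp add: algebra_simps power2_eq_square)
  also have "\<dots> \<le> c / 2 * (D z' \<xi> * 2)"
    using c nz' one_minus_norm_le_cinner[of \<xi> z'] \<xi>
    by (intro mult_left_mono mult_mono) (auto simp: D_def)
  finally have 1: "D z' \<zeta> \<le> c * D z' \<xi>" by simp
  have 2: "D z \<zeta> \<le> 4 * (D z \<xi> + D \<xi> \<zeta>)" "D \<xi> \<zeta> \<le> 4 * (D \<xi> z' + D z' \<zeta>)"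
    unfolding D_def using z nz' \<zeta> \<xi> by (intro norm_one_minus_cinner_quasi_triangle; simp)+
  have 3: "D \<xi> z' = D z' \<xi>"
    unfolding D_def by (rule norm_one_minus_cinner_commute)
  have 4: "D z \<zeta> \<le> 4 * D z \<xi> + 16 * (1 + c) * D z' \<xi>"
    using 1 2 3 by (simp add: algebra_simps)
  \<comment> \<open>\<open>k\<close> is twice the larger coefficient in the preceding estimate: if
    both alternatives failed, each summand would be below half of
    \<open>D z \<zeta>\<close>.\<close>
  have "D z \<zeta> \<le> k * D z \<xi> \<or> D z \<zeta> \<le> k * D z' \<xi>"
  proof (rule ccontr)
    assume "\<not> ?thesis"
    then have "k * D z \<xi> < D z \<zeta>" "k * D z' \<xi> < D z \<zeta>" by auto
    moreover have "8 * D z \<xi> \<le> k * D z \<xi>"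
      using c by (intro mult_right_mono) (auto simp: k_def D_def)
    moreover have "32 * (1 + c) * D z' \<xi> = k * D z' \<xi>" by (simp add: k_def)
    ultimately show False using 4 by (simp add: algebra_simps)
  qed
  moreover have le: "poisson_kernel x \<xi> \<le> koranyi_const c CARD('n) * poisson_kernel z \<zeta>"
    if "D z \<zeta> \<le> k * D x \<xi>" "norm x < 1" "norm z \<le> norm x" for x
  proof -
    have "(D z \<zeta>)\<^sup>2 \<le> (k * D x \<xi>)\<^sup>2"
      using that by (intro power_mono) (auto simp: D_def)
    moreover have "(norm z)\<^sup>2 \<le> (norm x)\<^sup>2" "(norm x)\<^sup>2 \<le> 1" "(norm z)\<^sup>2 \<le> 1"
      using that z by (auto intro!: power_mono power_le_one)
    moreover have "(D x \<xi>)\<^sup>2 > 0" "(D z \<zeta>)\<^sup>2 > 0"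
      using pos[of x \<xi>] pos[of z \<zeta>] that z \<zeta> \<xi> by simp_all
    ultimately have "1 / (D x \<xi>)\<^sup>2 \<le> k\<^sup>2 / (D z \<zeta>)\<^sup>2" "1 - (norm x)\<^sup>2 \<le> 1 - (norm z)\<^sup>2"
        "0 \<le> 1 - (norm x)\<^sup>2" "0 \<le> 1 - (norm z)\<^sup>2"
      by (simp_all add: field_simps)
    then have "(1 - (norm x)\<^sup>2) * (1 / (D x \<xi>)\<^sup>2) \<le> (1 - (norm z)\<^sup>2) * (k\<^sup>2 / (D z \<zeta>)\<^sup>2)"
      by (intro mult_mono) simp_all
    then have "(1 - (norm x)\<^sup>2) / (D x \<xi>)\<^sup>2 \<le> (1 - (norm z)\<^sup>2) * k\<^sup>2 / (D z \<zeta>)\<^sup>2"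
      by simp
    then have "poisson_kernel x \<xi> \<le> ((1 - (norm z)\<^sup>2) * k\<^sup>2 / (D z \<zeta>)\<^sup>2) ^ CARD('n)"
      unfolding P using that by (intro power_mono) (auto simp: power_le_one)
    also have "\<dots> = koranyi_const c CARD('n) * poisson_kernel z \<zeta>"
      unfolding P koranyi_const_def k_def[symmetric] by (simp add: power_mult_distrib power_divide)
    finally show ?thesis .
  qed
  ultimately consider "poisson_kernel z \<xi> \<le> koranyi_const c CARD('n) * poisson_kernel z \<zeta>"
    | "poisson_kernel z' \<xi> \<le> koranyi_const c CARD('n) * poisson_kernel z \<zeta>"
    using le[of z] le[of z'] z nz' assms(6) by auto
  moreover have nn: "poisson_kernel z \<xi> \<ge> 0" "poisson_kernel z' \<xi> \<ge> 0" "poisson_kernel z \<zeta> \<ge> 0"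
    "koranyi_const c CARD('n) \<ge> 0"
    using z nz' by (auto intro: poisson_kernel_nonneg simp: koranyi_const_def)
  ultimately show ?thesis
  proof cases
    case 1
    have "poisson_kernel z \<xi> * poisson_kernel z' \<xi> \<le> koranyi_const c CARD('n) * poisson_kernel z \<zeta> * poisson_kernel z' \<xi>"
      by (rule mult_right_mono[OF 1 nn(2)])
    then show ?thesis using nn by (simp add: distrib_left add_increasing)
  next
    case 2
    have "poisson_kernel z' \<xi> * poisson_kernel z \<xi> \<le> koranyi_const c CARD('n) * poisson_kernel z \<zeta> * poisson_kernel z \<xi>"
      by (rule mult_right_mono[OF 2 nn(1)])
    then show ?thesis using nn by (simp add: distrib_left add_increasing2 mult.commute[of "poisson_kernel z \<xi>"])
  qed
qed

text \<open>Openness in the boundary point, for a fixed interior point. It makes the set of boundary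
  points whose region contains \<open>z\<close> Borel.\<close>

lemma open_koranyi_trace: "open {\<zeta> :: complex ^ 'n::finite. z \<in> koranyi_region c \<zeta>}"
proof (cases "z \<in> ball 0 1")
  case True
  have "open {\<zeta>. norm (1 - cinner z \<zeta>) < c / 2 * (1 - (norm z)\<^sup>2)}"
    by (intro open_Collect_less continuous_intros)
  then show ?thesis using True by (simp add: koranyi_region_def)
qed (simp add: koranyi_region_def)

text \<open>Both kernels on the right of the pointwise bound have mass 1, which gives the factor 2
  and leaves only the value at \<zeta>.\<close>

lemma integral_poisson_product_bound:
  fixes z z' \<zeta> :: "complex ^ 'n::finite"
  assumes c: "c > 1" and z: "norm z < 1" and z': "z' \<in> koranyi_region c \<zeta>"
    and \<zeta>: "norm \<zeta> = 1" and le: "norm z \<le> norm z'"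
  shows "(LINT \<xi>|sphere_measure. poisson_kernel z \<xi> * poisson_kernel z' \<xi>) \<le> 2 * koranyi_const c CARD('n) * poisson_kernel z \<zeta>"
proof -
  have nz': "norm z' < 1" using z' by (simp add: koranyi_region_def)
  have i: "integrable sphere_measure (\<lambda>\<xi>. poisson_kernel z \<xi> * poisson_kernel z' \<xi>)"
    by (rule integrable_sphere_bounded[where B = "(1 / (1 - norm z)\<^sup>2) ^ CARD('n) * (1 / (1 - norm z')\<^sup>2) ^ CARD('n)"])
      (auto simp: norm_mult poisson_kernel_nonneg z nz' less_imp_le intro!: mult_mono poisson_kernel_le)
  have "(LINT \<xi>|sphere_measure. poisson_kernel z \<xi> * poisson_kernel z' \<xi>)
     \<le> (LINT \<xi>|sphere_measure. koranyi_const c CARD('n) * poisson_kernel z \<zeta> * (poisson_kernel z \<xi> + poisson_kernel z' \<xi>))"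
  proof (rule integral_mono_AE[OF i])
    show "AE \<xi> in sphere_measure. poisson_kernel z \<xi> * poisson_kernel z' \<xi>
      \<le> koranyi_const c CARD('n) * poisson_kernel z \<zeta> * (poisson_kernel z \<xi> + poisson_kernel z' \<xi>)"
      using AE_sphere_measure
      by eventually_elim (use poisson_kernel_product_bound[OF c z z' \<zeta> _ le] in simp)
  qed (intro integrable_mult_right Bochner_Integration.integrable_add integrable_poisson_kernel z nz')
  also have "\<dots> = koranyi_const c CARD('n) * poisson_kernel z \<zeta> * 2"
    using z nz' by (simp add: integrable_poisson_kernel integral_poisson_kernel)
  finally show ?thesis by simp
qed

text \<open>A \<open>TT\<^sup>*\<close> argument: for the average \<open>G\<close> of the Poisson kernels attached to disjoint pieces \<open>B j\<close>
  of the exceptional set \<open>O\<close>, the kernel bound gives \<open>\<parallel>G\<parallel>\<^sup>2 \<le> C \<integral>\<^sub>O G\<close> without any covering lemma.\<close>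

lemma koranyi_weak_type_finite:
  fixes x :: "nat \<Rightarrow> complex ^ 'n::finite"
  assumes c: "c > 1" and E: "polyfun E" and \<epsilon>: "\<epsilon> > 0"
    and x: "\<And>j. j < n \<Longrightarrow> norm (x j) < 1" "\<And>j. j < n \<Longrightarrow> \<epsilon> \<le> norm (E (x j))"
  shows "\<epsilon>\<^sup>2 * measure sphere_measure (\<Union>j<n. {\<zeta> \<in> sphere 0 1. x j \<in> koranyi_region c \<zeta>})
    \<le> 16 * (koranyi_const c CARD('n))\<^sup>2 * (LINT \<eta>|sphere_measure. (norm (E \<eta>))\<^sup>2)"
proof -
  define A where "A = (\<lambda>j. {\<zeta> \<in> sphere 0 1. x j \<in> koranyi_region c \<zeta>})"
  define B where "B = disjointed A"
  define b where "b = (\<lambda>j. measure sphere_measure (B j))"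
  define C where "C = koranyi_const c CARD('n)"
  define P where "P = (\<lambda>j. poisson_kernel (x j))"
  define S where "S = (\<Union>j<n. A j)"
  define G where "G = (\<lambda>\<eta>. \<Sum>j<n. b j * P j \<eta>)"
  have C: "C > 0" using c by (simp add: C_def koranyi_const_def)
  have A: "A j \<in> sets borel" for j
  proof -
    have "A j = sphere 0 1 \<inter> {\<zeta>. x j \<in> koranyi_region c \<zeta>}" by (auto simp: A_def)
    then show ?thesis using open_koranyi_trace[of "x j" c] by auto
  qed
  then have "range B \<subseteq> sets borel"
    unfolding B_def by (intro sets.range_disjointed_sets) auto
  then have B [measurable]: "B j \<in> sets borel" for j by auto
  have BA: "B j \<subseteq> A j" for j unfolding B_def by (rule disjointed_subset)
  have S: "S = (\<Union>j<n. B j)"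
    using finite_UN_disjointed_eq[of A n] by (simp add: S_def B_def atLeast0LessThan)
  have disj: "disjoint_family B" unfolding B_def by (rule disjoint_family_disjointed)
  have S_meas [measurable]: "S \<in> sets borel" unfolding S by auto
  have mS: "measure sphere_measure S = (\<Sum>j<n. b j)"
    unfolding S b_def by (intro sphere.finite_measure_finite_Union) (use disj in \<open>auto simp: disjoint_family_on_def\<close>)
  have b0: "b j \<ge> 0" for j by (simp add: b_def)
  have P0: "P j \<eta> \<ge> 0" if "j < n" for j \<eta> unfolding P_def using x[OF that] by (intro poisson_kernel_nonneg) simp
  have [measurable]: "P j \<in> borel_measurable borel" for j unfolding P_def by measurable
  have [measurable]: "E \<in> borel_measurable borel" by (rule borel_measurable_polyfun[OF E])
  have Pi: "integrable sphere_measure (P j)" if "j < n" for j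
    unfolding P_def by (intro integrable_poisson_kernel x that)
  have PPi: "integrable sphere_measure (\<lambda>\<eta>. P i \<eta> * P j \<eta>)" if "i < n" "j < n" for i j
    by (rule integrable_sphere_bounded[where B = "(1 / (1 - norm (x i))\<^sup>2) ^ CARD('n) * (1 / (1 - norm (x j))\<^sup>2) ^ CARD('n)"])
      (use that P0 in \<open>auto simp: norm_mult P_def x intro!: mult_mono poisson_kernel_le\<close>)
  have PBi: "integrable sphere_measure (\<lambda>\<eta>. P i \<eta> * indicator T \<eta>)" if "i < n" "T \<in> sets borel" for i T
    using integrable_mult_indicator[OF _ Pi[OF that(1)], of T] that by (simp add: mult.commute)
  \<comment> \<open>For every \<zeta> in \<open>B j\<close> the point \<open>x j\<close> lies in the
    region of \<zeta>, so the product bound holds with that \<zeta>; integrating over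
    \<open>B j\<close> turns the kernel value at \<zeta> into an integral over the piece.\<close>
  have key1: "b j * (LINT \<eta>|sphere_measure. P i \<eta> * P j \<eta>)
      \<le> 2 * C * (LINT \<eta>|sphere_measure. P i \<eta> * indicator (B j) \<eta>)"
    if ij: "i < n" "j < n" "norm (x i) \<le> norm (x j)" for i j
  proof -
    have "b j * (LINT \<eta>|sphere_measure. P i \<eta> * P j \<eta>)
       = (LINT \<zeta>|sphere_measure. (LINT \<eta>|sphere_measure. P i \<eta> * P j \<eta>) * indicator (B j) \<zeta>)"
      by (simp add: b_def mult.commute)
    also have "\<dots> \<le> (LINT \<zeta>|sphere_measure. 2 * C * (P i \<zeta> * indicator (B j) \<zeta>))"
    proof (rule integral_mono)
      fix \<zeta> :: "complex ^ 'n"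
      show "(LINT \<eta>|sphere_measure. P i \<eta> * P j \<eta>) * indicator (B j) \<zeta> \<le> 2 * C * (P i \<zeta> * indicator (B j) \<zeta>)"
      proof (cases "\<zeta> \<in> B j")
        case True
        then have "norm \<zeta> = 1" "x j \<in> koranyi_region c \<zeta>"
          using BA[of j] by (auto simp: A_def)
        then have "(LINT \<eta>|sphere_measure. P i \<eta> * P j \<eta>) \<le> 2 * C * P i \<zeta>"
          unfolding P_def C_def using integral_poisson_product_bound[OF c x(1)[OF ij(1)] _ _ ij(3)] by simp
        then show ?thesis using True by simp
      qed simp
    qed (auto intro!: PBi ij integrable_mult_right integrable_real_indicator simp: sphere.emeasure_finite less_top[symmetric])
    finally show ?thesis by simp
  qed
  \<comment> \<open>The product bound needs the point closer to the origin first. Whichever order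
    holds, one of the two nonnegative summands suffices, and the symmetric form can be summed over
    all pairs.\<close>
  have key2: "b i * b j * (LINT \<eta>|sphere_measure. P i \<eta> * P j \<eta>)
      \<le> 2 * C * (b i * (LINT \<eta>|sphere_measure. P i \<eta> * indicator (B j) \<eta>)
               + b j * (LINT \<eta>|sphere_measure. P j \<eta> * indicator (B i) \<eta>))"
    if ij: "i < n" "j < n" for i j
  proof -
    have nn: "(LINT \<eta>|sphere_measure. P i \<eta> * indicator (B j) \<eta>) \<ge> 0" if "i < n" for i j
      using P0[OF that] by (intro Bochner_Integration.integral_nonneg) auto
    show ?thesis
    proof (cases "norm (x i) \<le> norm (x j)")
      case True
      have "b i * (b j * (LINT \<eta>|sphere_measure. P i \<eta> * P j \<eta>))
        \<le> b i * (2 * C * (LINT \<eta>|sphere_measure. P i \<eta> * indicator (B j) \<eta>))"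
        by (rule mult_left_mono[OF key1[OF ij True] b0])
      moreover have "0 \<le> C * (b j * (LINT \<eta>|sphere_measure. P j \<eta> * indicator (B i) \<eta>))"
        using nn[OF ij(2)] C b0 by simp
      ultimately show ?thesis by (simp add: algebra_simps)
    next
      case False
      then have "norm (x j) \<le> norm (x i)" by simp
      then have "b j * (b i * (LINT \<eta>|sphere_measure. P j \<eta> * P i \<eta>))
        \<le> b j * (2 * C * (LINT \<eta>|sphere_measure. P j \<eta> * indicator (B i) \<eta>))"
        by (intro mult_left_mono[OF key1[OF ij(2,1)] b0])
      moreover have "0 \<le> C * (b i * (LINT \<eta>|sphere_measure. P i \<eta> * indicator (B j) \<eta>))"
        using nn[OF ij(1)] C b0 by simp
      ultimately show ?thesis by (simp add: algebra_simps)
    qed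
  qed
  have ind: "(\<Sum>j<n. indicator (B j) \<eta>) = (indicator S \<eta> :: real)" for \<eta>
    unfolding S by (subst indicator_UN_disjoint) (use disj in \<open>auto simp: disjoint_family_on_def\<close>)
  have GS: "(LINT \<eta>|sphere_measure. G \<eta> * indicator S \<eta>)
     = (\<Sum>i<n. \<Sum>j<n. b i * (LINT \<eta>|sphere_measure. P i \<eta> * indicator (B j) \<eta>))"
  proof -
    have "(LINT \<eta>|sphere_measure. G \<eta> * indicator S \<eta>)
       = (LINT \<eta>|sphere_measure. (\<Sum>i<n. \<Sum>j<n. b i * (P i \<eta> * indicator (B j) \<eta>)))"
      unfolding G_def ind[symmetric] sum_product by (simp only: mult.assoc)
    also have "\<dots> = (\<Sum>i<n. \<Sum>j<n. b i * (LINT \<eta>|sphere_measure. P i \<eta> * indicator (B j) \<eta>))"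
      by (subst Bochner_Integration.integral_sum)
        (auto simp: Bochner_Integration.integral_sum PBi intro!: Bochner_Integration.integrable_sum integrable_mult_right PBi)
    finally show ?thesis .
  qed
  have G2i: "integrable sphere_measure (\<lambda>\<eta>. (G \<eta>)\<^sup>2)"
    unfolding G_def power2_eq_square sum_product
    by (intro Bochner_Integration.integrable_sum)
      (use PPi in \<open>simp add: mult_ac mult.left_commute[of "P _ _"]\<close>)
  have GG: "(LINT \<eta>|sphere_measure. (G \<eta>)\<^sup>2) = (\<Sum>i<n. \<Sum>j<n. b i * b j * (LINT \<eta>|sphere_measure. P i \<eta> * P j \<eta>))"
  proof -
    have "(LINT \<eta>|sphere_measure. (G \<eta>)\<^sup>2)
       = (LINT \<eta>|sphere_measure. (\<Sum>i<n. \<Sum>j<n. b i * b j * (P i \<eta> * P j \<eta>)))"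
      unfolding G_def by (simp add: sum_product power2_eq_square mult_ac)
    also have "\<dots> = (\<Sum>i<n. \<Sum>j<n. b i * b j * (LINT \<eta>|sphere_measure. P i \<eta> * P j \<eta>))"
      by (subst Bochner_Integration.integral_sum)
        (auto simp: Bochner_Integration.integral_sum PPi intro!: Bochner_Integration.integrable_sum integrable_mult_right PPi)
    finally show ?thesis .
  qed
  have Gi: "integrable sphere_measure G"
    unfolding G_def by (intro Bochner_Integration.integrable_sum integrable_mult_right Pi) auto
  have "(LINT \<eta>|sphere_measure. (G \<eta>)\<^sup>2) \<le> (\<Sum>i<n. \<Sum>j<n.
     2 * C * (b i * (LINT \<eta>|sphere_measure. P i \<eta> * indicator (B j) \<eta>)
               + b j * (LINT \<eta>|sphere_measure. P j \<eta> * indicator (B i) \<eta>)))"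
    unfolding GG by (intro sum_mono key2) auto
  also have "\<dots> = 2 * C * ((\<Sum>i<n. \<Sum>j<n. b i * (LINT \<eta>|sphere_measure. P i \<eta> * indicator (B j) \<eta>))
      + (\<Sum>i<n. \<Sum>j<n. b j * (LINT \<eta>|sphere_measure. P j \<eta> * indicator (B i) \<eta>)))"
    by (simp only: sum_distrib_left sum.distrib distrib_left)
  also have "\<dots> = 2 * C * ((LINT \<eta>|sphere_measure. G \<eta> * indicator S \<eta>) + (LINT \<eta>|sphere_measure. G \<eta> * indicator S \<eta>))"
    unfolding GS by (subst (2) sum.swap) simp
  also have "\<dots> = (LINT \<eta>|sphere_measure. 4 * C * (G \<eta> * indicator S \<eta>))"
    by simp
  \<comment> \<open>Half of the squared norm of \<open>G\<close> is split off here and absorbed into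
    the left-hand side below.\<close>
  also have "\<dots> \<le> (LINT \<eta>|sphere_measure. (G \<eta>)\<^sup>2 / 2 + 8 * C\<^sup>2 * indicator S \<eta>)"
  proof (rule integral_mono)
    show "integrable sphere_measure (\<lambda>\<eta>. 4 * C * (G \<eta> * indicator S \<eta>))"
      using integrable_mult_indicator[OF _ Gi, of S] by (simp add: mult.commute)
    show "integrable sphere_measure (\<lambda>\<eta>. (G \<eta>)\<^sup>2 / 2 + 8 * C\<^sup>2 * indicator S \<eta>)"
      using G2i by (auto simp: sphere.emeasure_finite less_top[symmetric] integrable_real_indicator)
    fix \<eta>
    have "0 \<le> (G \<eta> - 4 * C)\<^sup>2" by simp
    then have "4 * C * G \<eta> \<le> (G \<eta>)\<^sup>2 / 2 + 8 * C\<^sup>2"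
      by (simp add: power2_eq_square algebra_simps)
    then show "4 * C * (G \<eta> * indicator S \<eta>) \<le> (G \<eta>)\<^sup>2 / 2 + 8 * C\<^sup>2 * indicator S \<eta>"
      by (simp add: indicator_def)
  qed
  also have "\<dots> = (LINT \<eta>|sphere_measure. (G \<eta>)\<^sup>2) / 2 + 8 * C\<^sup>2 * measure sphere_measure S"
    using G2i by (simp add: sphere.emeasure_finite less_top[symmetric] integrable_real_indicator)
  finally have G_le: "(LINT \<eta>|sphere_measure. (G \<eta>)\<^sup>2) \<le> 16 * C\<^sup>2 * measure sphere_measure S" by simp
  have Ei: "integrable sphere_measure (\<lambda>\<eta>. (norm (E \<eta>))\<^sup>2)"
    by (intro integrable_sphere_continuous continuous_intros continuous_on_polyfun E)
  \<comment> \<open>The Poisson formula is the only place where the polynomial nature of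
    \<open>E\<close> is used to pass from interior values to the sphere.\<close>
  have Ex: "norm (E (x j)) \<le> (LINT \<eta>|sphere_measure. P j \<eta> * norm (E \<eta>))" if "j < n" for j
  proof -
    have "norm (E (x j)) = norm (LINT \<eta>|sphere_measure. E \<eta> * of_real (P j \<eta>))"
      unfolding P_def using poisson_formula[OF E x(1)[OF that]] by simp
    also have "\<dots> \<le> (LINT \<eta>|sphere_measure. norm (E \<eta> * of_real (P j \<eta>)))"
      by (rule integral_norm_bound)
    also have "\<dots> = (LINT \<eta>|sphere_measure. P j \<eta> * norm (E \<eta>))"
      using P0[OF that] by (simp add: norm_mult mult.commute)
    finally show ?thesis .
  qed
  have PEi: "integrable sphere_measure (\<lambda>\<eta>. P j \<eta> * norm (E \<eta>))" if "j < n" for j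
  proof (rule Bochner_Integration.integrable_bound)
    show "integrable sphere_measure (\<lambda>\<eta>. P j \<eta> * P j \<eta> + (norm (E \<eta>))\<^sup>2)"
      using PPi[OF that that] Ei by simp
    have "norm (P j \<eta> * norm (E \<eta>)) \<le> norm (P j \<eta> * P j \<eta> + (norm (E \<eta>))\<^sup>2)" for \<eta>
    proof -
      have "2 * (P j \<eta> * norm (E \<eta>)) \<le> P j \<eta> * P j \<eta> + (norm (E \<eta>))\<^sup>2"
        using sum_squares_bound[of "P j \<eta>" "norm (E \<eta>)"] by (simp add: power2_eq_square mult.assoc)
      moreover have "P j \<eta> * norm (E \<eta>) \<ge> 0" using P0[OF that] by simp
      ultimately show ?thesis unfolding real_norm_def by linarith
    qed
    then show "AE \<eta> in sphere_measure. norm (P j \<eta> * norm (E \<eta>)) \<le> norm (P j \<eta> * P j \<eta> + (norm (E \<eta>))\<^sup>2)"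
      by blast
  qed simp
  \<comment> \<open>Chosen so that (t/2) times the bound 16 C^2 for the squared norm of
    \<open>G\<close> is \<epsilon>/2, which lets the measure of \<open>S\<close> be absorbed on the
    left.\<close>
  define t where "t = \<epsilon> / (16 * C\<^sup>2)"
  have t: "t > 0" using \<epsilon> C by (simp add: t_def)
  have "\<epsilon> * measure sphere_measure S \<le> (\<Sum>j<n. b j * norm (E (x j)))"
    unfolding mS sum_distrib_left using x b0 by (intro sum_mono) (simp add: mult.commute[of \<epsilon>] mult_left_mono)
  also have "\<dots> \<le> (\<Sum>j<n. b j * (LINT \<eta>|sphere_measure. P j \<eta> * norm (E \<eta>)))"
    using Ex b0 by (intro sum_mono mult_left_mono) auto
  also have "\<dots> = (LINT \<eta>|sphere_measure. G \<eta> * norm (E \<eta>))"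
    unfolding G_def sum_distrib_right mult.assoc
    by (subst Bochner_Integration.integral_sum) (auto intro!: integrable_mult_right PEi)
  also have "\<dots> \<le> (LINT \<eta>|sphere_measure. t / 2 * (G \<eta>)\<^sup>2 + (norm (E \<eta>))\<^sup>2 / (2 * t))"
  proof (rule integral_mono)
    show "integrable sphere_measure (\<lambda>\<eta>. G \<eta> * norm (E \<eta>))"
      unfolding G_def sum_distrib_right mult.assoc
      by (intro Bochner_Integration.integrable_sum integrable_mult_right PEi) auto
    show "integrable sphere_measure (\<lambda>\<eta>. t / 2 * (G \<eta>)\<^sup>2 + (norm (E \<eta>))\<^sup>2 / (2 * t))"
      using G2i Ei by simp
    fix \<eta>
    have "0 \<le> (t * G \<eta> - norm (E \<eta>))\<^sup>2 / (2 * t)" using t by simp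
    then show "G \<eta> * norm (E \<eta>) \<le> t / 2 * (G \<eta>)\<^sup>2 + (norm (E \<eta>))\<^sup>2 / (2 * t)"
      using t by (simp add: power2_eq_square field_simps)
  qed
  also have "\<dots> = t / 2 * (LINT \<eta>|sphere_measure. (G \<eta>)\<^sup>2) + (LINT \<eta>|sphere_measure. (norm (E \<eta>))\<^sup>2) / (2 * t)"
    using G2i Ei by simp
  also have "\<dots> \<le> t / 2 * (16 * C\<^sup>2 * measure sphere_measure S) + (LINT \<eta>|sphere_measure. (norm (E \<eta>))\<^sup>2) / (2 * t)"
    using G_le t by (intro add_right_mono mult_left_mono) auto
  also have "\<dots> = \<epsilon> / 2 * measure sphere_measure S + 8 * C\<^sup>2 * (LINT \<eta>|sphere_measure. (norm (E \<eta>))\<^sup>2) / \<epsilon>"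
    using C \<epsilon> by (simp add: t_def)
  finally have "\<epsilon> * (\<epsilon> * measure sphere_measure S)
    \<le> \<epsilon> * (\<epsilon> / 2 * measure sphere_measure S + 8 * C\<^sup>2 * (LINT \<eta>|sphere_measure. (norm (E \<eta>))\<^sup>2) / \<epsilon>)"
    using \<epsilon> by (intro mult_left_mono) auto
  then show ?thesis
    unfolding S_def[symmetric] A_def[symmetric] C_def[symmetric] using \<epsilon> by (simp add: algebra_simps power2_eq_square)
qed

section \<open>Homogeneous expansions\<close>

lemma norm_smult_vec: "norm (c *s (z :: complex ^ 'n::finite)) = norm c * norm z"
  by (simp add: norm_vec_def norm_mult L2_set_right_distrib)

lemma scaleR_eq_smult: "r *\<^sub>R (z :: complex ^ 'n::finite) = of_real r *s z"
  by (simp add: vec_eq_iff scaleR_conv_of_real[where 'a = complex])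

lemma has_derivative_line:
  "((\<lambda>l. a + l *s (v :: complex ^ 'n::finite)) has_derivative (\<lambda>l. l *s v)) F"
proof -
  have "linear (\<lambda>l. l *s v)"
    by (rule linearI) (auto simp: vec_eq_iff algebra_simps)
  then have "bounded_linear (\<lambda>l. l *s v)"
    by (simp add: linear_conv_bounded_linear)
  from bounded_linear_imp_has_derivative[OF this] show ?thesis
    by (auto intro!: derivative_eq_intros)
qed

lemma mv_holomorphic_on_line:
  fixes v :: "complex ^ 'n::finite"
  assumes G: "mv_holomorphic_on G S"
  shows "(\<lambda>l. G (a + l *s v)) holomorphic_on {l. a + l *s v \<in> S}"
proof (rule holomorphic_onI)
  fix l assume "l \<in> {l. a + l *s v \<in> S}"
  then obtain D where D: "(G has_derivative D) (at (a + l *s v))" "\<And>c v. D (c *s v) = c * D v"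
    using G by (auto simp: mv_holomorphic_on_def)
  have "((\<lambda>l. G (a + l *s v)) has_derivative (\<lambda>h. D (h *s v))) (at l)"
    using has_derivative_compose[OF has_derivative_line D(1)] by (simp add: o_def)
  then have "((\<lambda>l. G (a + l *s v)) has_field_derivative D v) (at l)"
    by (simp add: has_field_derivative_def D(2) mult_commute_abs)
  then show "(\<lambda>l. G (a + l *s v)) field_differentiable at l within {l. a + l *s v \<in> S}"
    using field_differentiable_at_within field_differentiable_def by blast
qed

lemma mv_holomorphic_on_imp_continuous_on:
  assumes "mv_holomorphic_on G S" shows "continuous_on S G"
proof (rule continuous_at_imp_continuous_on, rule ballI)
  fix z assume "z \<in> S"
  then show "isCont G z"
    using assms has_derivative_continuous unfolding mv_holomorphic_on_def by blast
qed

text \<open>The degree-k part of the Taylor expansion at 0, read off from the one-variable slice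
  through \<open>z\<close>. This reduces convergence and Cauchy estimates to one variable;
  polynomiality in \<open>z\<close> then has to be proved.\<close>

definition homog_part :: "(complex ^ 'n::finite \<Rightarrow> complex) \<Rightarrow> nat \<Rightarrow> complex ^ 'n \<Rightarrow> complex" where
  "homog_part G k z = (deriv ^^ k) (\<lambda>l. G (l *s z)) 0 / fact k"

context
  fixes G :: "complex ^ 'n::finite \<Rightarrow> complex"
  assumes G: "mv_holomorphic_on G (ball 0 1)"
begin

lemma slice_holomorphic:
  assumes "r * norm z \<le> 1" shows "(\<lambda>l. G (l *s z)) holomorphic_on ball 0 r"
proof (rule holomorphic_on_subset)
  show "(\<lambda>l. G (l *s z)) holomorphic_on {l. 0 + l *s z \<in> ball 0 1}"
    using mv_holomorphic_on_line[OF G, of 0 z] by simp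
  show "ball 0 r \<subseteq> {l. 0 + l *s z \<in> ball 0 1}"
  proof
    fix l :: complex assume l: "l \<in> ball 0 r"
    have "norm l * norm z < 1"
    proof (cases "z = 0")
      case False
      then have "norm l * norm z < r * norm z" using l by simp
      then show ?thesis using assms by simp
    qed simp
    then show "l \<in> {l. 0 + l *s z \<in> ball 0 1}"
      by (simp add: norm_smult_vec)
  qed
qed

lemma homog_part_sums:
  assumes "norm z < 1" shows "(\<lambda>k. homog_part G k z) sums G z"
proof -
  \<comment> \<open>A radius above 1 for which the slice still stays in the ball, so that the power
    series may be evaluated at 1.\<close>
  define r where "r = 2 / (1 + norm z)"
  have r: "r * norm z \<le> 1" "r > 1"
    using assms norm_ge_zero[of z] unfolding r_def by (simp_all add: divide_simps del: norm_ge_zero)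
  have "(\<lambda>n. (deriv ^^ n) (\<lambda>l. G (l *s z)) 0 / fact n * (1 - 0) ^ n) sums G (1 *s z)"
    by (rule holomorphic_power_series[OF slice_holomorphic[OF r(1)]]) (use r in simp)
  then show ?thesis by (simp add: homog_part_def)
qed

lemma homog_part_smult: "homog_part G k (c *s z) = c ^ k * homog_part G k z"
proof -
  define r where "r = 1 / (1 + norm z)"
  define r' where "r' = r / (1 + norm c)"
  have pos: "1 + norm z > 0" "1 + norm c > 0"
    using norm_ge_zero[of z] norm_ge_zero[of c] by linarith+
  have r: "r * norm z \<le> 1" "r > 0" "r' > 0" "norm c * r' \<le> r"
    using pos by (auto simp: r_def r'_def divide_simps)
  have "(deriv ^^ k) (\<lambda>w. G ((c * w) *s z)) 0 = c ^ k * (deriv ^^ k) (\<lambda>l. G (l *s z)) (c * 0)"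
  proof (rule higher_deriv_compose_linear[OF slice_holomorphic[OF r(1)], of "ball 0 r'"])
    fix w :: complex assume "w \<in> ball 0 r'"
    then have w: "norm w < r'" by simp
    show "c * w \<in> ball 0 r"
    proof (cases "c = 0")
      case False
      then have "norm c * norm w < norm c * r'"
        using w by (intro mult_strict_left_mono) auto
      then show ?thesis using r by (simp add: norm_mult)
    qed (use r in simp)
  qed (use r in auto)
  then show ?thesis
    by (simp add: homog_part_def vector_smult_assoc mult.commute)
qed

lemma homog_part_0_eq: "homog_part G 0 z = G 0"
  by (simp add: homog_part_def)

lemma homog_part_zero: "k > 0 \<Longrightarrow> homog_part G k 0 = 0"
  using homog_part_smult[of k 0 0] by (simp add: zero_power)

text \<open>Cauchy's inequality on the circle of radius s/|z|, which the slice maps into the sphere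
  of radius \<open>s\<close>. The estimate holds for every \<open>z\<close>, also outside the ball,
  and so doubles as a growth bound.\<close>

lemma norm_homog_part_le:
  assumes s: "0 < s" "s < 1" and B: "\<And>z. norm z \<le> s \<Longrightarrow> norm (G z) \<le> B"
  shows "norm (homog_part G k z) \<le> B * (norm z / s) ^ k"
proof (cases "z = 0")
  case True
  then show ?thesis
    using B[of 0] s by (cases k) (simp_all add: homog_part_0_eq homog_part_zero)
next
  case False
  define r where "r = s / norm z"
  define R where "R = 1 / norm z"
  have r: "0 < r" "r * norm z = s" "r < R" "R * norm z \<le> 1"
    using False s by (auto simp: r_def R_def divide_strict_right_mono)
  have hol: "(\<lambda>l. G (l *s z)) holomorphic_on ball 0 R"
    by (rule slice_holomorphic[OF r(4)])
  have sub: "cball 0 r \<subseteq> ball (0 :: complex) R" "ball 0 r \<subseteq> ball (0 :: complex) R"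
    using r by auto
  have "norm ((deriv ^^ k) (\<lambda>l. G (l *s z)) 0) \<le> fact k * B / r ^ k"
  proof (rule Cauchy_inequality)
    show "norm (G (x *s z)) \<le> B" if "norm (0 - x) = r" for x
      using that r by (intro B) (simp add: norm_smult_vec)
  qed (use r holomorphic_on_imp_continuous_on[OF holomorphic_on_subset[OF hol sub(1)]]
      holomorphic_on_subset[OF hol sub(2)] in auto)
  then have "norm ((deriv ^^ k) (\<lambda>l. G (l *s z)) 0) / fact k \<le> fact k * B / r ^ k / fact k"
    by (intro divide_right_mono) auto
  then show ?thesis
    by (simp add: homog_part_def norm_divide r_def power_divide)
qed

lemma homog_part_local_bound:
  assumes s: "0 < s" "s < 1"
  obtains B where "\<And>z. norm z \<le> s \<Longrightarrow> norm (G z) \<le> B" "B \<ge> 0"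
proof -
  have "continuous_on (cball 0 s) G"
    by (rule continuous_on_subset[OF mv_holomorphic_on_imp_continuous_on[OF G]]) (use s in auto)
  then have "bounded (G ` cball 0 s)"
    by (intro compact_imp_bounded compact_continuous_image) auto
  then obtain B where "\<forall>x\<in>cball 0 s. norm (G x) \<le> B"
    unfolding bounded_iff by blast
  then have *: "norm (G z) \<le> B" if "norm z \<le> s" for z using that by simp
  have "B \<ge> 0" using *[of 0] s norm_ge_zero[of "G 0"] by (simp del: norm_ge_zero)
  with * show ?thesis by (rule that)
qed

text \<open>By Cauchy's estimate the expansion is majorised by a geometric series of ratio
  \<open>q\<close> on the ball of radius \<open>q * s\<close>. This gives uniform approximation both
  near the origin and on spheres inside the ball.\<close>

lemma homog_part_tail:
  assumes s: "0 < s" "s < 1" and B: "\<And>z. norm z \<le> s \<Longrightarrow> norm (G z) \<le> B"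
    and q: "norm z \<le> q * s" "0 \<le> q" "q < 1"
  shows "norm (G z - (\<Sum>j<k. homog_part G j z)) \<le> B * q ^ k / (1 - q)"
proof -
  have "norm z < 1"
  proof -
    have "q * s \<le> 1 * s"
      using q s by (intro mult_right_mono) auto
    then show ?thesis using q s by linarith
  qed
  from sums_split_initial_segment[OF homog_part_sums[OF this], of k]
  have S: "(\<lambda>i. homog_part G (i + k) z) sums (G z - (\<Sum>j<k. homog_part G j z))" .
  have B0: "B \<ge> 0" using B[of 0] s norm_ge_zero[of "G 0"] by (simp del: norm_ge_zero)
  have le: "norm (homog_part G (i + k) z) \<le> B * q ^ k * q ^ i" for i
  proof -
    have "norm (homog_part G (i + k) z) \<le> B * (norm z / s) ^ (i + k)"
      by (rule norm_homog_part_le[OF s B])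
    also have "\<dots> \<le> B * q ^ (i + k)"
      using s q B0 by (intro mult_left_mono power_mono) (auto simp: divide_simps)
    finally show ?thesis by (simp add: power_add mult_ac)
  qed
  have g: "(\<lambda>i. B * q ^ k * q ^ i) sums (B * q ^ k * (1 / (1 - q)))"
    using q by (intro sums_mult geometric_sums) simp
  have "norm (\<Sum>i. homog_part G (i + k) z) \<le> (\<Sum>i. B * q ^ k * q ^ i)"
    by (rule norm_suminf_le[OF le sums_summable[OF g]])
  then show ?thesis
    using sums_unique[OF S] sums_unique[OF g] by simp
qed

text \<open>As t tends to 0, the quotient of G(t z) minus its parts of degree below k by t^k tends
  to the part of degree k, locally uniformly in \<open>z\<close>. Along a line the quotients are
  holomorphic by the induction hypothesis, and so is their limit; no joint power series is
  involved.\<close>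

lemma homog_part_line_holomorphic:
  "(\<lambda>l. homog_part G k (a + l *s v)) holomorphic_on UNIV"
proof (induction k rule: less_induct)
  case (less k)
  obtain B where B: "\<And>z. norm z \<le> 1/2 \<Longrightarrow> norm (G z) \<le> B" "B \<ge> 0"
    using homog_part_local_bound[of "1/2"] by auto
  have "(\<lambda>l. homog_part G k (a + l *s v)) holomorphic_on ball 0 R" if R: "R > 0" for R
  proof (rule holomorphic_uniform_sequence)
    \<comment> \<open>On the disc of radius \<open>R\<close> the point \<open>a + l *s v\<close> has
      norm at most M/2, and t M \<le> 1/2. The tail estimate thus applies with s = 1/2 and q = t M,
      leaving an error of order t after division by t^k.\<close>
    define M where "M = 2 * (norm a + R * norm v + 1)"
    define t where "t = (\<lambda>n. 1 / (2 * M * (real n + 1)))"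
    define f where "f = (\<lambda>n l. (G (of_real (t n) *s (a + l *s v))
      - (\<Sum>j<k. of_real (t n) ^ j * homog_part G j (a + l *s v))) / of_real (t n) ^ k)"
    have M: "M \<ge> 2" using R by (simp add: M_def)
    have t: "t n > 0" "t n * M \<le> 1/2" for n
    proof -
      have "t n * M = 1 / (2 * (real n + 1))"
        using M by (simp add: t_def)
      also have "\<dots> \<le> 1 / (2 * 1)"
        by (intro divide_left_mono mult_left_mono) auto
      finally show "t n * M \<le> 1/2" by simp
      show "t n > 0" using M by (simp add: t_def)
    qed
    have nM: "norm (a + l *s v) \<le> M / 2" if "norm l \<le> R" for l
    proof -
      have "norm (a + l *s v) \<le> norm a + norm l * norm v"
        using norm_triangle_ineq[of a "l *s v"] by (simp add: norm_smult_vec)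
      also have "\<dots> \<le> norm a + R * norm v"
        using that by (intro add_left_mono mult_right_mono) auto
      finally show ?thesis by (simp add: M_def)
    qed
    have err: "norm (f n l - homog_part G k (a + l *s v)) \<le> 2 * B * M ^ (k + 1) * t n" if l: "norm l \<le> R" for n l
    proof -
      define z where "z = a + l *s v"
      have nz: "norm (of_real (t n) *s z) \<le> t n * M * (1/2)"
        unfolding norm_smult_vec using nM[OF l] t(1)[of n] by (simp add: z_def mult_left_mono)
      have *: "norm (G (of_real (t n) *s z) - (\<Sum>j<Suc k. homog_part G j (of_real (t n) *s z))) \<le> B * (t n * M) ^ Suc k / (1 - t n * M)"
        by (rule homog_part_tail[of "1/2"]) (use nz B t[of n] M in \<open>auto\<close>)
      also have "\<dots> \<le> B * (t n * M) ^ Suc k / (1 / 2)"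
        using t[of n] M B by (intro divide_left_mono) auto
      finally have "norm (G (of_real (t n) *s z) - (\<Sum>j<Suc k. of_real (t n) ^ j * homog_part G j z)) \<le> 2 * B * (t n * M) ^ Suc k"
        by (simp add: homog_part_smult)
      moreover have "f n l - homog_part G k z = (G (of_real (t n) *s z) - (\<Sum>j<Suc k. of_real (t n) ^ j * homog_part G j z)) / of_real (t n) ^ k"
        using t(1)[of n] by (simp add: f_def z_def field_simps)
      ultimately have "norm (f n l - homog_part G k z) \<le> 2 * B * (t n * M) ^ Suc k / t n ^ k"
        using t(1)[of n] by (simp add: norm_divide norm_power divide_right_mono)
      also have "\<dots> = 2 * B * M ^ (k + 1) * t n"
        using t(1)[of n] by (simp add: power_mult_distrib)
      finally show ?thesis by (simp add: z_def)
    qed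
    show "f n holomorphic_on ball 0 R" for n
    proof -
      have "(\<lambda>l. G (of_real (t n) *s a + l *s (of_real (t n) *s v))) holomorphic_on ball 0 R"
      proof (rule holomorphic_on_subset[OF mv_holomorphic_on_line[OF G]], rule subsetI)
        fix l :: complex assume "l \<in> ball 0 R"
        then have "norm (a + l *s v) \<le> M / 2" by (intro nM) simp
        then have "t n * norm (a + l *s v) \<le> t n * (M / 2)"
          using t(1)[of n] by (intro mult_left_mono) auto
        have "norm (of_real (t n) *s (a + l *s v)) < 1"
        proof -
          have "norm (of_real (t n) *s (a + l *s v)) = t n * norm (a + l *s v)"
            using t(1)[of n] by (simp only: norm_smult_vec norm_of_real abs_of_pos)
          also note \<open>t n * norm (a + l *s v) \<le> t n * (M / 2)\<close>
          also have "t n * (M / 2) < 1" using t(2)[of n] by simp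
          finally show ?thesis .
        qed
        moreover have "of_real (t n) *s (a + l *s v) = of_real (t n) *s a + l *s (of_real (t n) *s v)"
          by (simp add: vec_eq_iff algebra_simps)
        ultimately show "l \<in> {l. of_real (t n) *s a + l *s (of_real (t n) *s v) \<in> ball 0 1}"
          by (simp only: mem_Collect_eq mem_ball dist_0_norm)
      qed
      moreover have "of_real (t n) *s a + l *s (of_real (t n) *s v) = of_real (t n) *s (a + l *s v)" for l
        by (simp add: vec_eq_iff algebra_simps)
      ultimately have "(\<lambda>l. G (of_real (t n) *s (a + l *s v))) holomorphic_on ball 0 R"
        by (simp only:)
      moreover have "(\<lambda>l. homog_part G j (a + l *s v)) holomorphic_on ball 0 R" if "j < k" for j
        by (rule holomorphic_on_subset[OF less.IH[OF that]]) auto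
      ultimately show ?thesis
        unfolding f_def using t(1)[of n] by (intro holomorphic_intros) auto
    qed
    fix x :: complex assume "x \<in> ball 0 R"
    then obtain d where d: "d > 0" "cball x d \<subseteq> ball 0 R"
      using open_contains_cball open_ball by blast
    have t0: "(\<lambda>n. 2 * B * M ^ (k + 1) * t n) \<longlonglongrightarrow> 0"
    proof -
      have "(\<lambda>n. 2 * B * M ^ (k + 1) * (1 / (2 * M)) * (1 / (real n + 1))) \<longlonglongrightarrow> 2 * B * M ^ (k + 1) * (1 / (2 * M)) * 0"
        by (intro tendsto_mult tendsto_const) (use LIMSEQ_inverse_real_of_nat in \<open>simp add: inverse_eq_divide add.commute\<close>)
      moreover have "t = (\<lambda>n. 1 / (2 * M) * (1 / (real n + 1)))"
        by (simp add: t_def)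
      ultimately show ?thesis using M by (simp add: mult.assoc)
    qed
    have "uniform_limit (cball x d) f (\<lambda>l. homog_part G k (a + l *s v)) sequentially"
    proof (rule uniform_limitI)
      fix e :: real assume "e > 0"
      then have "\<forall>\<^sub>F n in sequentially. 2 * B * M ^ (k + 1) * t n < e"
        using t0 by (rule order_tendstoD(2)[rotated])
      then show "\<forall>\<^sub>F n in sequentially. \<forall>l\<in>cball x d. dist (f n l) (homog_part G k (a + l *s v)) < e"
      proof eventually_elim
        case (elim n)
        show ?case
        proof
          fix l assume "l \<in> cball x d"
          then have "norm l \<le> R" using d by auto
          then show "dist (f n l) (homog_part G k (a + l *s v)) < e"
            unfolding dist_norm using err[of l n] elim by linarith
        qed
      qed
    qed
    with d show "\<exists>d>0. cball x d \<subseteq> ball 0 R \<and> uniform_limit (cball x d) f (\<lambda>l. homog_part G k (a + l *s v)) sequentially"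
      by blast
  qed simp
  then have hR: "(\<lambda>l. homog_part G k (a + l *s v)) holomorphic_on ball 0 R" if "R > 0" for R
    using that .
  show ?case
  proof (rule holomorphic_onI)
    fix x :: complex
    have "(\<lambda>l. homog_part G k (a + l *s v)) field_differentiable at x"
      by (rule holomorphic_on_imp_differentiable_at[OF hR[of "norm x + 1"]]) (auto simp: add_nonneg_pos)
    then show "(\<lambda>l. homog_part G k (a + l *s v)) field_differentiable at x within UNIV" by simp
  qed
qed

end

section \<open>Homogeneous parts are polynomials\<close>

definition lagrange_basis :: "nat \<Rightarrow> nat \<Rightarrow> complex \<Rightarrow> complex" where
  "lagrange_basis k j x = (\<Prod>i\<in>{..k} - {j}. (x - of_nat i) * (1 / (of_nat j - of_nat i)))"

lemma lagrange_interpolation: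
  assumes f: "\<And>x. f x = (\<Sum>m\<le>k. c m * x ^ m)"
  shows "f x = (\<Sum>j\<le>k. f (of_nat j) * lagrange_basis k j x)"
proof -
  define p where "p = (\<Sum>m\<le>k. monom (c m) m)"
  define l where "l = (\<lambda>j. \<Prod>i\<in>{..k} - {j}. smult (1 / (of_nat j - of_nat i)) [:- of_nat i, 1 :: complex:])"
  define q where "q = (\<Sum>j\<le>k. smult (f (of_nat j)) (l j))"
  have pf: "poly p x = f x" for x
    by (simp add: p_def poly_sum poly_monom f)
  have pl: "poly (l j) x = lagrange_basis k j x" for j x
    by (simp add: l_def poly_prod lagrange_basis_def diff_divide_distrib)
  have pq: "poly q x = (\<Sum>j\<le>k. f (of_nat j) * lagrange_basis k j x)" for x
    by (simp add: q_def poly_sum pl)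
  have lag: "lagrange_basis k j (of_nat i) = (if i = j then 1 else 0)" if "i \<le> k" for i j
    using that by (auto simp: lagrange_basis_def intro!: prod.neutral)
  have "p = q"
  proof (rule poly_eqI_degree[where A = "of_nat ` {..k}"])
    fix x :: complex assume "x \<in> of_nat ` {..k}"
    then obtain i where "i \<le> k" "x = of_nat i" by auto
    then show "poly p x = poly q x"
      unfolding pf pq by (simp add: lag if_distrib[of "(*) _"] cong: if_cong)
  next
    have card: "card (of_nat ` {..k} :: complex set) = Suc k"
      by (simp add: card_image inj_on_of_nat)
    have "degree p \<le> k"
      unfolding p_def by (intro degree_sum_le) (auto intro: order_trans[OF degree_monom_le])
    then show "card (of_nat ` {..k} :: complex set) > degree p" unfolding card by simp
    have "degree (l j) \<le> k" if "j \<le> k" for j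
    proof -
      have "degree (l j) \<le> (\<Sum>i\<in>{..k} - {j}. degree (smult (1 / (of_nat j - of_nat i)) [:- of_nat i, 1 :: complex:]))"
        unfolding l_def by (rule degree_prod_sum_le[unfolded o_def]) simp
      also have "\<dots> \<le> (\<Sum>i\<in>{..k} - {j}. 1)"
        by (rule sum_mono) (auto intro: order_trans[OF degree_smult_le])
      also have "\<dots> = k" using that by simp
      finally show ?thesis .
    qed
    then have "degree q \<le> k"
      unfolding q_def by (intro degree_sum_le) (auto intro: order_trans[OF degree_smult_le])
    then show "card (of_nat ` {..k} :: complex set) > degree q" unfolding card by simp
  qed
  then show ?thesis using pf pq by metis
qed

text \<open>Liouville's theorem makes \<open>H\<close> a polynomial of degree at most k in each
  variable separately. Interpolation at the nodes 0, ..., k writes it as a combination of functions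
  in which that variable is frozen, with coefficients depending on that variable alone. Freeing the
  coordinates one by one gives a polynomial, without examining how Taylor coefficients depend on the
  other variables.\<close>

lemma polyfun_if_polynomial_growth:
  fixes H :: "complex ^ 'n::finite \<Rightarrow> complex"
  assumes hol: "\<And>a i. (\<lambda>l. H (a + l *s axis i 1)) holomorphic_on UNIV"
    and growth: "\<And>z. norm (H z) \<le> C * norm z ^ k"
  shows "polyfun H"
proof -
  have interp: "H (\<chi> m. if m = i then x else y m)
     = (\<Sum>j\<le>k. H (\<chi> m. if m = i then of_nat j else y m) * lagrange_basis k j x)" for i y x
  proof -
    define a where "a = (\<chi> m. if m = i then 0 else y m)"
    define h where "h = (\<lambda>l. H (a + l *s axis i 1))"
    have ax: "a + l *s axis i 1 = (\<chi> m. if m = i then l else y m)" for l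
      by (auto simp: a_def vec_eq_iff axis_def)
    have C: "C * r ^ k \<ge> 0" if "r \<ge> 0" for r
    proof -
      obtain u :: "complex ^ 'n" where "norm u = r"
        using vector_choose_size[OF \<open>r \<ge> 0\<close>] by blast
      then show ?thesis using order_trans[OF norm_ge_zero growth[of u]] by simp
    qed
    then have C0: "C \<ge> 0" using C[of 1] by simp
    have "h l = (\<Sum>m\<le>k. (deriv ^^ m) h 0 / fact m * l ^ m)" for l
    proof (rule Liouville_polynomial)
      show "h holomorphic_on UNIV" unfolding h_def by (rule hol)
      fix l :: complex assume l: "norm a \<le> norm l"
      have "norm (a + l *s axis i 1) \<le> norm a + norm l"
        using norm_triangle_ineq[of a "l *s axis i 1"] by (simp add: norm_smult_vec)
      also have "\<dots> \<le> 2 * norm l" using l by simp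
      finally have "C * norm (a + l *s axis i 1) ^ k \<le> C * (2 * norm l) ^ k"
        using C0 by (intro mult_left_mono power_mono) auto
      then show "norm (h l) \<le> (C * 2 ^ k) * norm l ^ k"
        unfolding h_def using growth[of "a + l *s axis i 1"] by (simp add: power_mult_distrib)
    qed
    from lagrange_interpolation[OF this, of x] show ?thesis
      by (simp add: h_def ax)
  qed
  have pl: "polyfun (\<lambda>z. lagrange_basis k j (z $ i))" for i j
    unfolding lagrange_basis_def
    by (intro polyfun_prod polyfun_mult polyfun_const polyfun_diff polyfun_coord)
  have "polyfun (\<lambda>z. H (\<chi> m. if m \<in> A then z $ m else y m))" for A y
    using finite[of A]
  proof (induction A arbitrary: y)
    case empty
    show ?case by (simp add: polyfun_const)
  next
    case (insert i A)
    have "H (\<chi> m. if m \<in> insert i A then z $ m else y m)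
      = (\<Sum>j\<le>k. H (\<chi> m. if m \<in> A then z $ m else (y(i := of_nat j)) m) * lagrange_basis k j (z $ i))" for z
    proof -
      have "(\<chi> m. if m \<in> insert i A then z $ m else y m) = (\<chi> m. if m = i then z $ i else if m \<in> A then z $ m else y m)"
        by (auto simp: vec_eq_iff)
      moreover have "(\<chi> m. if m = i then of_nat j else if m \<in> A then z $ m else y m)
         = (\<chi> m. if m \<in> A then z $ m else (y(i := of_nat j)) m)" for j
        using insert.hyps by (auto simp: vec_eq_iff)
      ultimately show ?thesis
        using interp[of i "z $ i" "\<lambda>m. if m \<in> A then z $ m else y m"] by simp
    qed
    then show ?case
      by (simp only:) (intro polyfun_sum polyfun_mult insert.IH pl)
  qed
  from this[of UNIV] show ?thesis by simp
qed

lemma polyfun_homog_part: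
  assumes G: "mv_holomorphic_on G (ball 0 1)"
  shows "polyfun (homog_part G k)"
proof -
  obtain B where B: "\<And>z. norm z \<le> 1/2 \<Longrightarrow> norm (G z) \<le> B" "B \<ge> 0"
    using homog_part_local_bound[OF G, of "1/2"] by auto
  show ?thesis
  proof (rule polyfun_if_polynomial_growth)
    show "(\<lambda>l. homog_part G k (a + l *s axis i 1)) holomorphic_on UNIV" for a i
      by (rule homog_part_line_holomorphic[OF G])
    show "norm (homog_part G k z) \<le> (B * 2 ^ k) * norm z ^ k" for z
      using norm_homog_part_le[OF G, of "1/2" B k z] B by (simp add: power_mult_distrib mult_ac)
  qed
qed

section \<open>Polynomial approximation of dilations and the mean value property\<close>

lemma polyfun_smult_arg:
  assumes "polyfun f" shows "polyfun (\<lambda>z. f (c *s z))"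
  using assms
proof induction
  case (monom \<alpha>)
  have "mmonom \<alpha> (c *s z) = (\<Prod>i\<in>UNIV. c ^ \<alpha> $ i) * mmonom \<alpha> z" for z
    by (simp add: mmonom_def power_mult_distrib prod.distrib)
  then show ?case by (simp add: polyfun.cmult polyfun.monom)
qed (auto intro: polyfun.intros)

lemma integral_polyfun:
  assumes "polyfun f" shows "(LINT \<zeta>|sphere_measure. f \<zeta>) = f 0"
  using assms
proof induction
  case (monom \<alpha>)
  have "(LINT \<zeta>|sphere_measure. mmonom \<alpha> \<zeta>) = moment sphere_measure \<alpha> 0"
    by (simp add: moment_def)
  moreover have "mmonom \<alpha> 0 = (if \<alpha> = 0 then 1 else 0)"
    by (auto simp: mmonom_def vec_eq_iff)
  moreover have "monom_sqnorm (0 :: nat ^ 'a) = 1"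
    by (simp add: monom_sqnorm_def sphere.prob_space[simplified])
  ultimately show ?case by (simp add: moment_sphere)
next
  case (add f g)
  then show ?case by (simp add: integrable_polyfun)
qed simp

text \<open>A truncation of the homogeneous expansion. It keeps the part of degree 0, so the value
  at the origin is preserved exactly and not merely approximated.\<close>

lemma homog_part_approx:
  fixes G :: "complex ^ 'n::finite \<Rightarrow> complex"
  assumes G: "mv_holomorphic_on G (ball 0 1)" and r: "0 < r" "r < 1" and e: "e > 0"
  obtains q where "polyfun q" "q 0 = G 0" "\<And>z. norm z \<le> 1 \<Longrightarrow> norm (G (r *\<^sub>R z) - q z) < e"
proof -
  define s where "s = (1 + r) / 2"
  have s: "0 < s" "s < 1" "r < s" using r by (auto simp: s_def)
  obtain B where B: "\<And>z. norm z \<le> s \<Longrightarrow> norm (G z) \<le> B" "B \<ge> 0"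
    using homog_part_local_bound[OF G s(1,2)] by auto
  define q0 where "q0 = r / s"
  have q0: "0 \<le> q0" "q0 < 1" "r = q0 * s" using s r by (auto simp: q0_def)
  have "(\<lambda>m. B * q0 ^ m / (1 - q0)) \<longlonglongrightarrow> B * 0 / (1 - q0)"
    using q0 by (intro tendsto_intros LIMSEQ_power_zero) auto
  then have "\<forall>\<^sub>F m in sequentially. B * q0 ^ m / (1 - q0) < e"
    using e by (intro order_tendstoD(2)) auto
  then obtain m where m: "B * q0 ^ m / (1 - q0) < e" "m > 0"
    by (metis (mono_tags, lifting) eventually_sequentially le_add2 le_eq_less_or_eq le_add1 zero_less_Suc less_le_trans)
  define q where "q = (\<lambda>z. \<Sum>j<m. homog_part G j (of_real r *s z))"
  show ?thesis
  proof (rule that)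
    show "polyfun q" unfolding q_def
      by (intro polyfun_sum polyfun_smult_arg polyfun_homog_part G)
    have "q 0 = (\<Sum>j<m. if j = 0 then G 0 else 0)"
      unfolding q_def by (rule sum.cong) (auto simp: homog_part_0_eq[OF G] homog_part_zero[OF G])
    then show "q 0 = G 0" using m by simp
    fix z :: "complex ^ 'n" assume z: "norm z \<le> 1"
    have "norm (G (of_real r *s z) - q z) \<le> B * q0 ^ m / (1 - q0)"
      unfolding q_def
    proof (rule homog_part_tail[OF G s(1,2) B(1)])
      show "norm (of_real r *s z) \<le> q0 * s"
        unfolding norm_smult_vec q0(3)[symmetric] using z r by (simp add: mult_left_le)
    qed (use q0 in auto)
    then show "norm (G (r *\<^sub>R z) - q z) < e"
      using m(1) by (simp add: scaleR_eq_smult)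
  qed
qed

text \<open>On the sphere the dilation is a uniform limit of polynomials with value
  \<open>G 0\<close> at the origin, and their mean is exactly that value. Measurability is asked on
  the whole space because \<open>sphere_measure\<close> is a Borel measure there.\<close>

lemma mean_value_sphere:
  fixes G :: "complex ^ 'n::finite \<Rightarrow> complex"
  assumes G: "mv_holomorphic_on G (ball 0 1)" and r: "0 < r" "r < 1" and meas: "G \<in> borel_measurable borel"
  shows "integrable sphere_measure (\<lambda>\<zeta>. G (r *\<^sub>R \<zeta>))" "(LINT \<zeta>|sphere_measure. G (r *\<^sub>R \<zeta>)) = G 0"
proof -
  obtain B where B: "\<And>z. norm z \<le> r \<Longrightarrow> norm (G z) \<le> B" "B \<ge> 0"
    using homog_part_local_bound[OF G r] by auto
  show i: "integrable sphere_measure (\<lambda>\<zeta>. G (r *\<^sub>R \<zeta>))"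
    by (rule integrable_sphere_bounded[where B = B]) (use meas B r in auto)
  show "(LINT \<zeta>|sphere_measure. G (r *\<^sub>R \<zeta>)) = G 0"
  proof (rule ccontr)
    define e where "e = norm ((LINT \<zeta>|sphere_measure. G (r *\<^sub>R \<zeta>)) - G 0)"
    assume "\<not> ?thesis"
    then have e: "e > 0" by (simp add: e_def)
    obtain q where q: "polyfun q" "q 0 = G 0" "\<And>z. norm z \<le> 1 \<Longrightarrow> norm (G (r *\<^sub>R z) - q z) < e / 2"
      using homog_part_approx[OF G r, of "e / 2"] e by auto
    have "norm (LINT \<zeta>|sphere_measure. G (r *\<^sub>R \<zeta>) - q \<zeta>) \<le> (LINT \<zeta>|sphere_measure. norm (G (r *\<^sub>R \<zeta>) - q \<zeta>))"
      by (rule integral_norm_bound)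
    also have "\<dots> \<le> (LINT (\<zeta> :: complex ^ 'n)|sphere_measure. e / 2)"
    proof (rule integral_mono_AE)
      show "AE \<zeta> in sphere_measure. norm (G (r *\<^sub>R \<zeta>) - q \<zeta>) \<le> e / 2"
        using AE_sphere_measure
      proof eventually_elim
        fix \<zeta> :: "complex ^ 'n" assume "\<zeta> \<in> sphere 0 1"
        then show "norm (G (r *\<^sub>R \<zeta>) - q \<zeta>) \<le> e / 2"
          using q(3)[of \<zeta>] by simp
      qed
    qed (use i integrable_polyfun[OF q(1)] in auto)
    also have "\<dots> = e / 2" by (simp add: sphere.prob_space[simplified])
    finally have "e \<le> e / 2"
      using i integrable_polyfun[OF q(1)] integral_polyfun[OF q(1)] q(2) by (simp add: e_def)
    then show False using e by simp
  qed
qed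

text \<open>A common phase u in all coordinates multiplies the pairing by u^j times the conjugate of
  u^k, which is not 1 for the chosen angle.\<close>

lemma homog_part_orthogonal:
  fixes G :: "complex ^ 'n::finite \<Rightarrow> complex"
  assumes G: "mv_holomorphic_on G (ball 0 1)" and "j \<noteq> k"
  shows "(LINT \<zeta>|sphere_measure. homog_part G j \<zeta> * cnj (homog_part G k \<zeta>)) = 0"
proof -
  define t where "t = (real j - real k) * (1 / real (j + k + 1))"
  define u where "u = cis (1 / real (j + k + 1))"
  have ct: "cis t \<noteq> 1"
    unfolding t_def by (rule cis_diff_quotient_neq_1[OF \<open>j \<noteq> k\<close>])
  have "u ^ j * cnj (u ^ k) = cis (real j / real (j + k + 1)) * cnj (cis (real k / real (j + k + 1)))"
    by (simp add: u_def Complex.DeMoivre)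
  also have "\<dots> = cis t"
    by (simp add: cis_cnj cis_mult t_def diff_divide_distrib)
  finally have uu: "u ^ j * cnj (u ^ k) = cis t" .
  have pj: "polyfun (homog_part G i)" for i by (rule polyfun_homog_part[OF G])
  have us: "(\<chi> i. u * \<zeta> $ i) = u *s \<zeta>" for \<zeta> :: "complex ^ 'n" by (simp add: vec_eq_iff)
  have "(LINT \<zeta>|sphere_measure. homog_part G j \<zeta> * cnj (homog_part G k \<zeta>))
     = (LINT \<zeta>|sphere_measure. homog_part G j (\<chi> i. u * \<zeta> $ i) * cnj (homog_part G k (\<chi> i. u * \<zeta> $ i)))"
    by (rule integral_sphere_rotation[symmetric, OF orthogonal_transformation_phase])
      (simp add: u_def, intro borel_measurable_continuous_onI continuous_on_mult continuous_on_cnj continuous_on_polyfun[OF pj])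
  also have "\<dots> = (LINT \<zeta>|sphere_measure. cis t * (homog_part G j \<zeta> * cnj (homog_part G k \<zeta>)))"
    unfolding us homog_part_smult[OF G] uu[symmetric] complex_cnj_mult by (simp only: mult_ac)
  also have "\<dots> = cis t * (LINT \<zeta>|sphere_measure. homog_part G j \<zeta> * cnj (homog_part G k \<zeta>))"
    by simp
  finally show ?thesis
    using ct unfolding mult_cancel_right1 by blast
qed

section \<open>Square norms of homogeneous expansions\<close>

definition homog_sqnorm :: "(complex ^ 'n::finite \<Rightarrow> complex) \<Rightarrow> nat \<Rightarrow> real" where
  "homog_sqnorm G k = (LINT \<zeta>|sphere_measure. (norm (homog_part G k \<zeta>))\<^sup>2)"

lemma homog_sqnorm_nonneg: "homog_sqnorm G k \<ge> 0"
  by (simp add: homog_sqnorm_def)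

text \<open>Pythagoras for the homogeneous parts. The weights allow for dilations, with a_k = r^k,
  as well as for differences of partial sums, with a_k = 1.\<close>

lemma integral_homog_sum_sqnorm:
  fixes G :: "complex ^ 'n::finite \<Rightarrow> complex"
  assumes G: "mv_holomorphic_on G (ball 0 1)" and "finite A"
  shows "(LINT \<zeta>|sphere_measure. (norm (\<Sum>k\<in>A. of_real (a k) * homog_part G k \<zeta>))\<^sup>2) = (\<Sum>k\<in>A. (a k)\<^sup>2 * homog_sqnorm G k)"
proof -
  have pj: "polyfun (homog_part G i)" for i by (rule polyfun_homog_part[OF G])
  have I: "integrable sphere_measure (\<lambda>\<zeta>. homog_part G j \<zeta> * cnj (homog_part G k \<zeta>))" for j k
    by (rule integrable_monom_cnj_polyfun[OF pj pj])
  have jk: "(LINT \<zeta>|sphere_measure. homog_part G j \<zeta> * cnj (homog_part G k \<zeta>)) = (if j = k then of_real (homog_sqnorm G k) else 0)" for j k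
    using homog_part_orthogonal[OF G, of j k]
    by (simp add: homog_sqnorm_def complex_norm_square[symmetric] flip: of_real_power)
  have "complex_of_real (LINT \<zeta>|sphere_measure. (norm (\<Sum>k\<in>A. of_real (a k) * homog_part G k \<zeta>))\<^sup>2)
     = (LINT \<zeta>|sphere_measure. (\<Sum>j\<in>A. \<Sum>k\<in>A. of_real (a j * a k) * (homog_part G j \<zeta> * cnj (homog_part G k \<zeta>))))"
  proof -
    have "complex_of_real (LINT \<zeta>|sphere_measure. (norm (\<Sum>k\<in>A. of_real (a k) * homog_part G k \<zeta>))\<^sup>2)
      = (LINT \<zeta>|sphere_measure. complex_of_real ((norm (\<Sum>k\<in>A. of_real (a k) * homog_part G k \<zeta>))\<^sup>2))"
      by (rule integral_complex_of_real[symmetric])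
    also have "\<dots> = (LINT \<zeta>|sphere_measure. (\<Sum>j\<in>A. \<Sum>k\<in>A. of_real (a j * a k) * (homog_part G j \<zeta> * cnj (homog_part G k \<zeta>))))"
      unfolding complex_norm_square cnj_sum sum_product
      by (intro Bochner_Integration.integral_cong sum.cong refl) simp
    finally show ?thesis .
  qed
  also have "\<dots> = (\<Sum>j\<in>A. \<Sum>k\<in>A. of_real (a j * a k) * (LINT \<zeta>|sphere_measure. homog_part G j \<zeta> * cnj (homog_part G k \<zeta>)))"
    by (subst Bochner_Integration.integral_sum)
      (auto simp: Bochner_Integration.integral_sum I intro!: Bochner_Integration.integrable_sum integrable_mult_right I)
  also have "\<dots> = complex_of_real (\<Sum>k\<in>A. (a k)\<^sup>2 * homog_sqnorm G k)"
    unfolding jk of_real_sum using \<open>finite A\<close>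
    by (intro sum.cong refl) (simp add: if_distrib power2_eq_square cong: if_cong)
  finally show ?thesis unfolding of_real_eq_iff .
qed

text \<open>For r < 1 a long partial sum of the dilated expansion is uniformly within
  \<open>e\<close> of a function bounded by \<open>B\<close>, so its square norm is at most (B+e)^2.
  The first \<open>m\<close> terms survive the limits of \<open>e\<close> to 0 and then r to
  1.\<close>

lemma homog_sqnorm_bessel:
  fixes G :: "complex ^ 'n::finite \<Rightarrow> complex"
  assumes G: "mv_holomorphic_on G (ball 0 1)" and B: "\<And>z. norm z < 1 \<Longrightarrow> norm (G z) \<le> B"
  shows "(\<Sum>k<m. homog_sqnorm G k) \<le> B\<^sup>2"
proof -
  have B0: "B \<ge> 0" using B[of 0] norm_ge_zero[of "G 0"] by (simp del: norm_ge_zero)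
  have r_case: "(\<Sum>k<m. (r ^ k)\<^sup>2 * homog_sqnorm G k) \<le> B\<^sup>2" if r: "0 < r" "r < 1" for r
  proof -
    define s where "s = (1 + r) / 2"
    have s: "0 < s" "s < 1" "r < s" using r by (auto simp: s_def)
    have "(\<Sum>k<m. (r ^ k)\<^sup>2 * homog_sqnorm G k) \<le> (B + e)\<^sup>2" if e: "e > 0" for e
    proof -
      define q0 where "q0 = r / s"
      have q0: "0 \<le> q0" "q0 < 1" "r = q0 * s" using s r by (auto simp: q0_def)
      have "(\<lambda>M. B * q0 ^ M / (1 - q0)) \<longlonglongrightarrow> B * 0 / (1 - q0)"
        using q0 by (intro tendsto_intros LIMSEQ_power_zero) auto
      then have "\<forall>\<^sub>F M in sequentially. B * q0 ^ M / (1 - q0) < e"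
        using e by (intro order_tendstoD(2)) auto
      then have "\<forall>\<^sub>F M in sequentially. B * q0 ^ M / (1 - q0) < e \<and> m \<le> M"
        using eventually_ge_at_top by (rule eventually_conj)
      then obtain M where M: "B * q0 ^ M / (1 - q0) < e" "m \<le> M"
        by (auto simp: eventually_sequentially)
      have "(\<Sum>k<m. (r ^ k)\<^sup>2 * homog_sqnorm G k) \<le> (\<Sum>k<M. (r ^ k)\<^sup>2 * homog_sqnorm G k)"
        using M by (intro sum_mono2) (auto simp: homog_sqnorm_nonneg)
      also have "\<dots> = (LINT \<zeta>|sphere_measure. (norm (\<Sum>k<M. of_real (r ^ k) * homog_part G k \<zeta>))\<^sup>2)"
        by (rule integral_homog_sum_sqnorm[OF G, symmetric]) simp
      also have "\<dots> \<le> (LINT (\<zeta> :: complex ^ 'n)|sphere_measure. (B + e)\<^sup>2)"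
      proof (rule integral_mono_AE)
        show "integrable sphere_measure (\<lambda>\<zeta>. (norm (\<Sum>k<M. of_real (r ^ k) * homog_part G k \<zeta>))\<^sup>2)"
          by (intro integrable_sphere_continuous continuous_intros continuous_on_polyfun polyfun_homog_part G)
        show "AE \<zeta> in sphere_measure. (norm (\<Sum>k<M. of_real (r ^ k) * homog_part G k \<zeta>))\<^sup>2 \<le> (B + e)\<^sup>2"
          using AE_sphere_measure
        proof eventually_elim
          fix \<zeta> :: "complex ^ 'n" assume \<zeta>: "\<zeta> \<in> sphere 0 1"
          have "norm (G (of_real r *s \<zeta>) - (\<Sum>k<M. homog_part G k (of_real r *s \<zeta>))) \<le> B * q0 ^ M / (1 - q0)"
          proof (rule homog_part_tail[OF G s(1,2)])
            show "norm (of_real r *s \<zeta>) \<le> q0 * s"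
              unfolding norm_smult_vec q0(3)[symmetric] using \<zeta> r by simp
          qed (use q0 s B in auto)
          then have "norm (G (of_real r *s \<zeta>) - (\<Sum>k<M. of_real (r ^ k) * homog_part G k \<zeta>)) \<le> e"
            using M by (simp add: homog_part_smult[OF G])
          moreover have "norm (G (of_real r *s \<zeta>)) \<le> B"
            using \<zeta> r by (intro B) (simp add: norm_smult_vec)
          ultimately have "norm (\<Sum>k<M. of_real (r ^ k) * homog_part G k \<zeta>) \<le> B + e"
            using norm_triangle_ineq3[of "G (of_real r *s \<zeta>)" "\<Sum>k<M. of_real (r ^ k) * homog_part G k \<zeta>"] by linarith
          then show "(norm (\<Sum>k<M. of_real (r ^ k) * homog_part G k \<zeta>))\<^sup>2 \<le> (B + e)\<^sup>2"
            by (intro power_mono) auto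
        qed
      qed simp
      also have "\<dots> = (B + e)\<^sup>2" by (simp add: sphere.prob_space[simplified])
      finally show ?thesis .
    qed
    note * = this
    have "((\<lambda>e. (B + e)\<^sup>2) \<longlongrightarrow> (B + 0)\<^sup>2) (at_right 0)"
      by (intro tendsto_intros)
    then have "(\<Sum>k<m. (r ^ k)\<^sup>2 * homog_sqnorm G k) \<le> (B + 0)\<^sup>2"
      by (rule tendsto_lowerbound) (use * in \<open>auto simp: eventually_at_right_less intro: eventually_mono[OF eventually_at_right_less]\<close>)
    then show ?thesis by simp
  qed
  have "((\<lambda>r. \<Sum>k<m. (r ^ k)\<^sup>2 * homog_sqnorm G k) \<longlongrightarrow> (\<Sum>k<m. (1 ^ k)\<^sup>2 * homog_sqnorm G k)) (at_left (1::real))"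
    by (intro tendsto_intros)
  then have "(\<Sum>k<m. (1 ^ k)\<^sup>2 * homog_sqnorm G k) \<le> B\<^sup>2"
  proof (rule tendsto_upperbound)
    have "\<forall>\<^sub>F r in at_left (1::real). r \<in> {0<..<1}"
      by (rule eventually_at_left_real) simp
    then show "\<forall>\<^sub>F r in at_left (1::real). (\<Sum>k<m. (r ^ k)\<^sup>2 * homog_sqnorm G k) \<le> B\<^sup>2"
      by eventually_elim (use r_case in auto)
  qed simp
  then show ?thesis by simp
qed

section \<open>Koranyi limits of bounded holomorphic functions\<close>

text \<open>Replaces a supremum over the uncountably many points of a region by one over a countable
  set.\<close>

lemma separable_open_subset:
  fixes U :: "'a::euclidean_space set"
  obtains D where "countable D" "D \<subseteq> U" "\<And>V. open V \<Longrightarrow> open U \<Longrightarrow> U \<inter> V \<noteq> {} \<Longrightarrow> D \<inter> V \<noteq> {}"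
proof -
  obtain D0 :: "'a set" where D0: "countable D0" "\<And>X. open X \<Longrightarrow> X \<noteq> {} \<Longrightarrow> \<exists>d\<in>D0. d \<in> X"
    using countable_dense_exists by blast
  show ?thesis
  proof (rule that[of "D0 \<inter> U"])
    show "D0 \<inter> U \<inter> V \<noteq> {}" if "open V" "open U" "U \<inter> V \<noteq> {}" for V
      using D0(2)[of "U \<inter> V"] that by auto
  qed (use D0 in auto)
qed

text \<open>Existence of a limit without naming it: this is the form that oscillation estimates
  deliver and that can be tested for measurability.\<close>

lemma tendsto_ex_iff_cauchy:
  fixes f :: "'a \<Rightarrow> 'b::complete_space"
  assumes "F \<noteq> bot"
  shows "(\<exists>l. (f \<longlongrightarrow> l) F) \<longleftrightarrow> (\<forall>e>0. \<exists>P. eventually P F \<and> (\<forall>x y. P x \<and> P y \<longrightarrow> dist (f x) (f y) < e))"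
  unfolding cauchy_filter_metric_filtermap[symmetric] filterlim_def
proof
  show "\<exists>l. filtermap f F \<le> nhds l \<Longrightarrow> cauchy_filter (filtermap f F)"
    using nhds_imp_cauchy_filter by blast
  assume "cauchy_filter (filtermap f F)"
  moreover have "filtermap f F \<noteq> bot"
    using assms by (simp add: filtermap_bot_iff)
  ultimately show "\<exists>l. filtermap f F \<le> nhds l"
    using complete_UNIV[unfolded complete_uniform, rule_format, of "filtermap f F"] by auto
qed

section \<open>Koranyi regions and K-limits\<close>

lemma open_koranyi_region: "open (koranyi_region c \<zeta>)"
proof -
  have "open {z. norm (1 - cinner z \<zeta>) < c / 2 * (1 - (norm z)\<^sup>2)}"
    by (intro open_Collect_less continuous_intros)
  moreover have "koranyi_region c \<zeta> = ball 0 1 \<inter> {z. norm (1 - cinner z \<zeta>) < c / 2 * (1 - (norm z)\<^sup>2)}"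
    by (auto simp: koranyi_region_def)
  ultimately show ?thesis by (simp add: open_Int)
qed

lemma koranyi_region_mono: "c \<le> c' \<Longrightarrow> koranyi_region c \<zeta> \<subseteq> koranyi_region c' \<zeta>"
proof
  fix z assume "c \<le> c'" "z \<in> koranyi_region c \<zeta>"
  moreover from this have "c / 2 * (1 - (norm z)\<^sup>2) \<le> c' / 2 * (1 - (norm z)\<^sup>2)"
    by (intro mult_right_mono) (auto simp: koranyi_region_def power_le_one)
  ultimately show "z \<in> koranyi_region c' \<zeta>"
    by (auto simp: koranyi_region_def)
qed

lemma radial_koranyi:
  assumes \<zeta>: "norm \<zeta> = 1" and c: "c > 1"
  shows "filterlim (\<lambda>r. r *\<^sub>R \<zeta>) (at \<zeta> within koranyi_region c \<zeta>) (at_left 1)"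
  unfolding filterlim_at
proof
  show "((\<lambda>r. r *\<^sub>R \<zeta>) \<longlongrightarrow> \<zeta>) (at_left 1)"
    by (rule tendsto_eq_intros | simp)+
  have "\<forall>\<^sub>F r in at_left 1. r \<in> {max 0 (2 / c - 1)<..<(1::real)}"
    by (rule eventually_at_left_real) (use c in \<open>auto simp: field_simps\<close>)
  then show "\<forall>\<^sub>F r in at_left 1. r *\<^sub>R \<zeta> \<in> koranyi_region c \<zeta> \<and> r *\<^sub>R \<zeta> \<noteq> \<zeta>"
  proof eventually_elim
    case (elim r)
    \<comment> \<open>The threshold 2/c - 1 lies below 1 because c > 1. Exceeding it means 2 < c
      (1+r), which is the region condition 1 - r < (c/2)(1 - r^2) with the factor 1 - r
      cancelled.\<close>
    then have r: "0 < r" "r < 1" "2 < c * (1 + r)"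
      using c by (auto simp: field_simps)
    have "cinner (r *\<^sub>R \<zeta>) \<zeta> = of_real r"
      using \<zeta> by (simp add: scaleR_eq_smult cinner_scale_left cinner_self)
    then have n1: "norm (1 - cinner (r *\<^sub>R \<zeta>) \<zeta>) = 1 - r"
      using r by (metis (no_types, lifting) abs_of_pos diff_gt_0_iff_gt norm_of_real of_real_1 of_real_diff)
    define X where "X = c * (1 + r) * (1 - r)"
    have n2: "2 * (1 - r) < X"
      unfolding X_def using r by (intro mult_strict_right_mono) auto
    have n3: "c / 2 * (1 - (norm (r *\<^sub>R \<zeta>))\<^sup>2) = X / 2"
      using r \<zeta> by (simp add: X_def power2_eq_square algebra_simps)
    moreover have "r *\<^sub>R \<zeta> \<noteq> \<zeta>"
    proof
      assume "r *\<^sub>R \<zeta> = \<zeta>"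
      then have "norm (r *\<^sub>R \<zeta>) = norm \<zeta>" by simp
      then show False using r \<zeta> by simp
    qed
    moreover have "norm (1 - cinner (r *\<^sub>R \<zeta>) \<zeta>) < c / 2 * (1 - (norm (r *\<^sub>R \<zeta>))\<^sup>2)"
      unfolding n1 n3 using n2 by (simp add: field_simps)
    moreover have "r *\<^sub>R \<zeta> \<in> ball 0 1" using r \<zeta> by simp
    ultimately show ?case
      unfolding koranyi_region_def by blast
  qed
qed

lemma koranyi_nontrivial:
  assumes "norm \<zeta> = 1" "c > 1"
  shows "at \<zeta> within koranyi_region c \<zeta> \<noteq> bot"
proof
  assume "at \<zeta> within koranyi_region c \<zeta> = bot"
  then have "filterlim (\<lambda>r. r *\<^sub>R \<zeta>) bot (at_left (1::real))"
    using radial_koranyi[OF assms] by simp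
  then have "at_left (1::real) = bot"
    by (simp add: filterlim_def filtermap_bot_iff bot_unique)
  then show False by simp
qed

lemma has_K_limit_unique:
  assumes "norm \<zeta> = 1" "has_K_limit g \<zeta> l" "has_K_limit g \<zeta> l'"
  shows "l = l'"
  using tendsto_unique[OF koranyi_nontrivial[OF assms(1), of 2], of g l l'] assms(2,3)
  by (auto simp: has_K_limit_def)

lemma boundary_value_eq:
  assumes "norm \<zeta> = 1" "has_K_limit g \<zeta> l"
  shows "boundary_value g \<zeta> = l"
proof -
  have "(THE l. has_K_limit g \<zeta> l) = l"
    by (intro the_equality assms has_K_limit_unique[OF assms(1) _ assms(2)])
  then show ?thesis
    unfolding boundary_value_def using assms(2) by (simp only: if_P[OF exI[of _ l]])
qed

lemma has_K_limit_radial: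
  assumes "norm \<zeta> = 1" "has_K_limit g \<zeta> l"
  shows "((\<lambda>r. g (r *\<^sub>R \<zeta>)) \<longlongrightarrow> l) (at_left 1)"
proof -
  have "(g \<longlongrightarrow> l) (at \<zeta> within koranyi_region 2 \<zeta>)"
    using assms by (auto simp: has_K_limit_def)
  from filterlim_compose[OF this radial_koranyi[OF assms(1)]] show ?thesis by simp
qed

text \<open>Regions grow with the aperture, so countably many apertures suffice, and the limits
  along different apertures agree because all of them can be computed in the region of aperture
  2.\<close>

lemma has_K_limit_ex_iff:
  assumes \<zeta>: "norm \<zeta> = 1"
  shows "(\<exists>l. has_K_limit g \<zeta> l) \<longleftrightarrow> (\<forall>n::nat. \<exists>l. (g \<longlongrightarrow> l) (at \<zeta> within koranyi_region (real n + 2) \<zeta>))"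
proof
  assume L: "\<forall>n::nat. \<exists>l. (g \<longlongrightarrow> l) (at \<zeta> within koranyi_region (real n + 2) \<zeta>)"
  then obtain l where l: "\<And>n. (g \<longlongrightarrow> l n) (at \<zeta> within koranyi_region (real n + 2) \<zeta>)" by metis
  have "l n = l 0" for n
  proof (rule tendsto_unique[OF koranyi_nontrivial[OF \<zeta>, of 2]])
    show "(g \<longlongrightarrow> l n) (at \<zeta> within koranyi_region 2 \<zeta>)"
      by (rule tendsto_within_subset[OF l[of n]]) (rule koranyi_region_mono, simp)
    show "(g \<longlongrightarrow> l 0) (at \<zeta> within koranyi_region 2 \<zeta>)"
      using l[of 0] by simp
  qed simp
  have "(g \<longlongrightarrow> l 0) (at \<zeta> within koranyi_region c \<zeta>)" for c
  proof -
    obtain n :: nat where "c \<le> real n" using real_arch_simple by blast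
    then have "koranyi_region c \<zeta> \<subseteq> koranyi_region (real n + 2) \<zeta>"
      by (intro koranyi_region_mono) simp
    from tendsto_within_subset[OF l[of n] this] show ?thesis
      using \<open>l n = l 0\<close> by simp
  qed
  then show "\<exists>l. has_K_limit g \<zeta> l" by (auto simp: has_K_limit_def)
next
  assume "\<exists>l. has_K_limit g \<zeta> l"
  then obtain l where l: "has_K_limit g \<zeta> l" ..
  show "\<forall>n::nat. \<exists>l. (g \<longlongrightarrow> l) (at \<zeta> within koranyi_region (real n + 2) \<zeta>)"
  proof
    fix n :: nat
    have "(1::real) < real n + 2" by simp
    then have "(g \<longlongrightarrow> l) (at \<zeta> within koranyi_region (real n + 2) \<zeta>)"
      using l by (simp add: has_K_limit_def)
    then show "\<exists>l. (g \<longlongrightarrow> l) (at \<zeta> within koranyi_region (real n + 2) \<zeta>)" ..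
  qed
qed

text \<open>The Cauchy criterion with both scales running over countable sets. For fixed scales only
  the quantifiers over pairs of points remain, and these lead to unions of open sets.\<close>

lemma koranyi_limit_ex_iff:
  fixes g :: "complex ^ 'n::finite \<Rightarrow> complex"
  assumes \<zeta>: "norm \<zeta> = 1" and c: "c > 1"
  shows "(\<exists>l. (g \<longlongrightarrow> l) (at \<zeta> within koranyi_region c \<zeta>)) \<longleftrightarrow>
    (\<forall>n::nat. \<exists>m::nat. \<forall>z z'. z \<in> koranyi_region c \<zeta> \<longrightarrow> z' \<in> koranyi_region c \<zeta> \<longrightarrow>
       dist z \<zeta> < inverse (real (Suc m)) \<longrightarrow> dist z' \<zeta> < inverse (real (Suc m)) \<longrightarrow> dist (g z) (g z') \<le> inverse (real (Suc n)))"
  (is "?L \<longleftrightarrow> ?R")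
proof -
  have notin: "\<zeta> \<notin> koranyi_region c \<zeta>" using \<zeta> by (simp add: koranyi_region_def)
  have E: "?L \<longleftrightarrow> (\<forall>e>0. \<exists>P. eventually P (at \<zeta> within koranyi_region c \<zeta>) \<and> (\<forall>x y. P x \<and> P y \<longrightarrow> dist (g x) (g y) < e))"
    by (rule tendsto_ex_iff_cauchy[OF koranyi_nontrivial[OF \<zeta> c]])
  show ?thesis
  proof
    assume ?L
    show ?R
    proof
      fix n :: nat
      obtain P where P: "eventually P (at \<zeta> within koranyi_region c \<zeta>)" "\<And>x y. P x \<Longrightarrow> P y \<Longrightarrow> dist (g x) (g y) < inverse (real (Suc n))"
        using \<open>?L\<close> unfolding E by (metis inverse_positive_iff_positive of_nat_0_less_iff zero_less_Suc)
      then obtain d where d: "d > 0" "\<And>x. x \<in> koranyi_region c \<zeta> \<Longrightarrow> x \<noteq> \<zeta> \<Longrightarrow> dist x \<zeta> < d \<Longrightarrow> P x"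
        unfolding eventually_at by auto
      obtain m where m: "inverse (real (Suc m)) < d"
        using reals_Archimedean[OF d(1)] by auto
      show "\<exists>m::nat. \<forall>z z'. z \<in> koranyi_region c \<zeta> \<longrightarrow> z' \<in> koranyi_region c \<zeta> \<longrightarrow>
       dist z \<zeta> < inverse (real (Suc m)) \<longrightarrow> dist z' \<zeta> < inverse (real (Suc m)) \<longrightarrow> dist (g z) (g z') \<le> inverse (real (Suc n))"
        using d(2) m P(2) notin by (intro exI[of _ m]) (metis less_imp_le less_trans)
    qed
  next
    assume R: ?R
    show ?L unfolding E
    proof (intro allI impI)
      fix e :: real assume "e > 0"
      then obtain n where n: "inverse (real (Suc n)) < e"
        using reals_Archimedean by blast
      obtain m where m: "\<And>z z'. z \<in> koranyi_region c \<zeta> \<Longrightarrow> z' \<in> koranyi_region c \<zeta> \<Longrightarrow>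
       dist z \<zeta> < inverse (real (Suc m)) \<Longrightarrow> dist z' \<zeta> < inverse (real (Suc m)) \<Longrightarrow> dist (g z) (g z') \<le> inverse (real (Suc n))"
        using R by blast
      show "\<exists>P. eventually P (at \<zeta> within koranyi_region c \<zeta>) \<and> (\<forall>x y. P x \<and> P y \<longrightarrow> dist (g x) (g y) < e)"
      proof (intro exI conjI)
        show "eventually (\<lambda>z. z \<in> koranyi_region c \<zeta> \<and> dist z \<zeta> < inverse (real (Suc m))) (at \<zeta> within koranyi_region c \<zeta>)"
          unfolding eventually_at by (intro exI[of _ "inverse (real (Suc m))"]) auto
        show "\<forall>x y. (x \<in> koranyi_region c \<zeta> \<and> dist x \<zeta> < inverse (real (Suc m)))
           \<and> (y \<in> koranyi_region c \<zeta> \<and> dist y \<zeta> < inverse (real (Suc m))) \<longrightarrow> dist (g x) (g y) < e"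
          using m n by (meson le_less_trans)
      qed
    qed
  qed
qed

section \<open>Borel measurability of boundary values\<close>

definition K_limit_set :: "(complex ^ 'n::finite \<Rightarrow> complex) \<Rightarrow> (complex ^ 'n) set" where
  "K_limit_set g = {\<zeta> \<in> sphere 0 1. \<exists>l. has_K_limit g \<zeta> l}"

text \<open>Membership of \<open>z\<close> in the Koranyi region of \<open>\<zeta>\<close> is an open condition on \<open>\<zeta>\<close>, so failure of the
  Cauchy criterion at a given scale defines an open set.\<close>

lemma K_limit_set_borel: "K_limit_set g \<in> sets borel"
proof -
  define Bad where "Bad = (\<lambda>(k::nat) (n::nat) (m::nat). \<Union>z. \<Union>z'\<in>{z'. \<not> dist (g z) (g z') \<le> inverse (real (Suc n))}.
     {\<zeta>. z \<in> koranyi_region (real k + 2) \<zeta>} \<inter> {\<zeta>. z' \<in> koranyi_region (real k + 2) \<zeta>}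
     \<inter> {\<zeta>. dist z \<zeta> < inverse (real (Suc m))} \<inter> {\<zeta>. dist z' \<zeta> < inverse (real (Suc m))})"
  have op: "open (Bad k n m)" for k n m
    unfolding Bad_def
    by (intro open_UN ballI open_Int open_koranyi_trace open_Collect_less continuous_intros)
  have "K_limit_set g = sphere 0 1 \<inter> (\<Inter>k. \<Inter>n. \<Union>m. - Bad k n m)"
  proof (intro set_eqI)
    fix \<zeta>
    show "\<zeta> \<in> K_limit_set g \<longleftrightarrow> \<zeta> \<in> sphere 0 1 \<inter> (\<Inter>k. \<Inter>n. \<Union>m. - Bad k n m)"
    proof (cases "norm \<zeta> = 1")
      case True
      have "1 < real k + 2" for k by simp
      then have "\<zeta> \<in> K_limit_set g \<longleftrightarrow> (\<forall>k::nat. \<forall>n::nat. \<exists>m::nat. \<forall>z z'. z \<in> koranyi_region (real k + 2) \<zeta> \<longrightarrow> z' \<in> koranyi_region (real k + 2) \<zeta> \<longrightarrow>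
       dist z \<zeta> < inverse (real (Suc m)) \<longrightarrow> dist z' \<zeta> < inverse (real (Suc m)) \<longrightarrow> dist (g z) (g z') \<le> inverse (real (Suc n)))"
        using True by (simp only: K_limit_set_def mem_Collect_eq has_K_limit_ex_iff koranyi_limit_ex_iff) (simp add: dist_0_norm)
      also have "\<dots> \<longleftrightarrow> (\<forall>k n. \<exists>m. \<zeta> \<notin> Bad k n m)"
        unfolding Bad_def by blast
      finally show ?thesis using True by auto
    qed (simp add: K_limit_set_def)
  qed
  also have "\<dots> \<in> sets borel"
    using op by (intro sets.Int sets.countable_INT'' sets.countable_UN'' borel_closed) (auto intro: borel_comp borel_open)
  finally show ?thesis .
qed

lemma measurable_zero_outside_ball:
  assumes "continuous_on (ball 0 1) (g :: complex ^ 'n::finite \<Rightarrow> complex)"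
  shows "(\<lambda>z. if z \<in> ball 0 1 then g z else 0) \<in> borel_measurable borel"
  using assms by (intro borel_measurable_continuous_on_if) auto

text \<open>The definition assigns values off the sphere as well; they must be known because
  measurability is claimed on the whole space.\<close>

lemma boundary_value_inside:
  fixes g :: "complex ^ 'n::finite \<Rightarrow> complex"
  assumes g: "continuous_on (ball 0 1) g" and \<zeta>: "norm \<zeta> < 1"
  shows "boundary_value g \<zeta> = g \<zeta>"
proof -
  have cont: "(g \<longlongrightarrow> g \<zeta>) (at \<zeta>)"
    using g \<zeta> by (simp add: continuous_on_eq_continuous_at isCont_def)
  have L: "has_K_limit g \<zeta> (g \<zeta>)"
    unfolding has_K_limit_def using tendsto_within_subset[OF cont] by blast
  moreover have "l = g \<zeta>" if "has_K_limit g \<zeta> l" for l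
  proof -
    have "norm (1 - cinner \<zeta> \<zeta>) = 1 - (norm \<zeta>)\<^sup>2"
    proof -
      have "1 - cinner \<zeta> \<zeta> = of_real (1 - (norm \<zeta>)\<^sup>2)" by (simp add: cinner_self)
      then show ?thesis using \<zeta> by (simp only: norm_of_real) (simp add: power_le_one)
    qed
    moreover have "(norm \<zeta>)\<^sup>2 < 1" using \<zeta> by (simp add: power_less_one_iff)
    \<comment> \<open>An interior point belongs to its own region as soon as the aperture exceeds 2.
      The region is then a neighbourhood and the limit is an ordinary one.\<close>
    ultimately have "\<zeta> \<in> koranyi_region 4 \<zeta>"
      using \<zeta> by (simp add: koranyi_region_def)
    then have "at \<zeta> within koranyi_region 4 \<zeta> = at \<zeta>"
      by (rule at_within_open[OF _ open_koranyi_region])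
    then have "(g \<longlongrightarrow> l) (at \<zeta>)"
      using that by (metis has_K_limit_def one_less_numeral_iff semiring_norm(76))
    then show ?thesis
      using cont by (rule tendsto_unique[rotated]) simp
  qed
  ultimately have "(THE l. has_K_limit g \<zeta> l) = g \<zeta>"
    by (intro the_equality)
  then show ?thesis
    unfolding boundary_value_def using L by (simp only: if_P[OF exI[of _ "g \<zeta>"]])
qed

text \<open>Regions stay in the closed unit ball, so the filter is trivial and every
  \<open>l\<close> is a limit. The resulting value is unspecified but the same at all these
  points.\<close>

lemma boundary_value_outside:
  assumes "norm \<zeta> > 1" shows "boundary_value g \<zeta> = (THE l. True)"
proof -
  have "at \<zeta> within koranyi_region c \<zeta> = bot" for c
  proof -
    have "koranyi_region c \<zeta> \<subseteq> cball 0 1" by (auto simp: koranyi_region_def)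
    then have "closure (koranyi_region c \<zeta>) \<subseteq> cball 0 1"
      by (rule closure_minimal) simp
    then have "\<zeta> \<notin> closure (koranyi_region c \<zeta>)" using assms by auto
    then show ?thesis
      by (metis islimpt_in_closure trivial_limit_within Diff_subset closure_mono subsetD)
  qed
  then have "has_K_limit g \<zeta> = (\<lambda>l. True)" by (simp add: has_K_limit_def fun_eq_iff)
  then show ?thesis by (simp add: boundary_value_def)
qed

text \<open>Off a Borel set of convergence the function is explicit, and on that set it is the
  pointwise limit of Borel functions along a fixed sequence of radii.\<close>

lemma measurable_boundary_value:
  fixes g :: "complex ^ 'n::finite \<Rightarrow> complex"
  assumes g: "continuous_on (ball 0 1) g"
  shows "boundary_value g \<in> borel_measurable borel"
proof -
  define g0 where "g0 = (\<lambda>z. if z \<in> ball 0 1 then g z else 0)"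
  define r where "r = (\<lambda>n. 1 - 1 / (real n + 2))"
  have [measurable]: "g0 \<in> borel_measurable borel"
    unfolding g0_def by (rule measurable_zero_outside_ball[OF g])
  have [measurable]: "K_limit_set g \<in> sets borel" by (rule K_limit_set_borel)
  have r: "0 < r n" "r n < 1" for n by (auto simp: r_def field_simps)
  have "filterlim r (at_left 1) sequentially"
    unfolding filterlim_at
  proof
    have "(\<lambda>n. 1 - 1 / real (n + 2)) \<longlonglongrightarrow> 1 - 0"
      by (intro tendsto_diff tendsto_const LIMSEQ_ignore_initial_segment lim_1_over_n)
    then show "r \<longlonglongrightarrow> 1" by (simp add: r_def add.commute)
  qed (use r in \<open>auto simp: less_imp_neq\<close>)
  then have lim: "(\<lambda>n. g0 (r n *\<^sub>R \<zeta>)) \<longlonglongrightarrow> l" if "norm \<zeta> = 1" "has_K_limit g \<zeta> l" for \<zeta> l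
  proof -
    have "(\<lambda>n. g (r n *\<^sub>R \<zeta>)) \<longlonglongrightarrow> l"
      using filterlim_compose[OF has_K_limit_radial[OF that] \<open>filterlim r (at_left 1) sequentially\<close>] by simp
    then show ?thesis using r that by (simp add: g0_def abs_of_pos)
  qed
  have "boundary_value g \<zeta> = (if \<zeta> \<in> ball 0 1 then g0 \<zeta> else if \<zeta> \<in> K_limit_set g then lim (\<lambda>n. g0 (r n *\<^sub>R \<zeta>))
      else if \<zeta> \<in> sphere 0 1 then 0 else (THE l. True))" for \<zeta>
  proof -
    consider "norm \<zeta> < 1" | "norm \<zeta> = 1" "\<zeta> \<in> K_limit_set g" | "norm \<zeta> = 1" "\<zeta> \<notin> K_limit_set g" | "norm \<zeta> > 1"
      by linarith
    then show ?thesis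
    proof cases
      case 1 then show ?thesis by (simp add: boundary_value_inside[OF g] g0_def)
    next
      case 2
      then obtain l where "has_K_limit g \<zeta> l" by (auto simp: K_limit_set_def)
      then have "lim (\<lambda>n. g0 (r n *\<^sub>R \<zeta>)) = l" "boundary_value g \<zeta> = l"
        using lim[OF 2(1)] boundary_value_eq[OF 2(1)] limI by blast+
      then show ?thesis using 2 by simp
    next
      case 3 then show ?thesis by (auto simp: K_limit_set_def boundary_value_def)
    next
      case 4 then show ?thesis by (auto simp: K_limit_set_def boundary_value_outside)
    qed
  qed
  then have "boundary_value g = (\<lambda>\<zeta>. if \<zeta> \<in> ball 0 1 then g0 \<zeta> else if \<zeta> \<in> K_limit_set g then lim (\<lambda>n. g0 (r n *\<^sub>R \<zeta>))
      else if \<zeta> \<in> sphere 0 1 then 0 else (THE l. True))" by (rule ext)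
  also have "\<dots> \<in> borel_measurable borel"
  proof -
    have "(\<lambda>\<zeta>. g0 (r n *\<^sub>R \<zeta>)) \<in> borel_measurable borel" for n by measurable
    then have "(\<lambda>\<zeta>. lim (\<lambda>n. g0 (r n *\<^sub>R \<zeta>))) \<in> borel_measurable borel"
      by (rule borel_measurable_lim_metric)
    then show ?thesis
      by (intro measurable_If_set measurable_const) (simp_all add: K_limit_set_borel)
  qed
  finally show ?thesis .
qed

section \<open>Almost everywhere existence of K-limits for bounded functions\<close>

context
  fixes G :: "complex ^ 'n::finite \<Rightarrow> complex" and B :: real
  assumes G: "mv_holomorphic_on G (ball 0 1)" and B: "\<And>z. norm z < 1 \<Longrightarrow> norm (G z) \<le> B"
begin

definition partial where "partial m z = (\<Sum>k<m. homog_part G k z)"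

lemma summable_homog_sqnorm: "summable (homog_sqnorm G)"
  by (rule bounded_imp_summable[where B = "B\<^sup>2"])
    (use homog_sqnorm_bessel[OF G B, of "Suc _"] in \<open>simp_all add: homog_sqnorm_nonneg lessThan_Suc_atMost\<close>)

text \<open>Superlevel set of the Koranyi maximal function of the tail. The strict inequality makes
  the set of offending points open, hence testable on a countable dense subset.\<close>

definition exceptional where
  "exceptional c \<epsilon> m = {\<zeta> \<in> sphere 0 1. \<exists>z\<in>koranyi_region c \<zeta>. \<epsilon> < norm (G z - partial m z)}"

text \<open>Countably many offending points describe the whole set, and finitely many of them are
  handled by the weak-type inequality. That inequality is for polynomials, so the tail is first
  replaced by a difference of partial sums, whose square norm is at most the tail of a convergent
  series. Continuity from below passes to all points.\<close>

lemma exceptional_bound: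
  assumes c: "c > 1" and \<epsilon>: "\<epsilon> > 0"
  shows "exceptional c \<epsilon> m \<in> sets borel"
    and "\<epsilon>\<^sup>2 * measure sphere_measure (exceptional c \<epsilon> m)
       \<le> 16 * (koranyi_const c CARD('n))\<^sup>2 * (\<Sum>k. homog_sqnorm G (k + m))"
proof -
  define A where "A = (\<lambda>x :: complex ^ 'n. {\<zeta> \<in> sphere 0 1. x \<in> koranyi_region c \<zeta>})"
  define U where "U = {z \<in> ball 0 1. \<epsilon> < norm (G z - partial m z)}"
  have poly: "polyfun (\<lambda>z. partial M z)" for M
    unfolding partial_def by (intro polyfun_sum polyfun_homog_part G)
  have contG: "continuous_on (ball 0 1) G" by (rule mv_holomorphic_on_imp_continuous_on[OF G])
  have "open U"
  proof -
    have "continuous_on (ball 0 1) (\<lambda>z. norm (G z - partial m z))"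
      by (intro continuous_intros contG continuous_on_polyfun poly)
    from open_Collect_less_Int[OF continuous_on_const this, of \<epsilon>]
    obtain V where "open V" "V \<inter> ball 0 1 = {z \<in> ball 0 1. \<epsilon> < norm (G z - partial m z)}" by auto
    then show ?thesis unfolding U_def by (metis open_Int open_ball)
  qed
  obtain D where D: "countable D" "D \<subseteq> U" "\<And>V. open V \<Longrightarrow> open U \<Longrightarrow> U \<inter> V \<noteq> {} \<Longrightarrow> D \<inter> V \<noteq> {}"
    using separable_open_subset[of U] by blast
  have eq: "exceptional c \<epsilon> m = (\<Union>x\<in>D. A x)"
  proof
    show "(\<Union>x\<in>D. A x) \<subseteq> exceptional c \<epsilon> m"
      using D(2) by (auto simp: exceptional_def U_def A_def)
    show "exceptional c \<epsilon> m \<subseteq> (\<Union>x\<in>D. A x)"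
    proof
      fix \<zeta> assume "\<zeta> \<in> exceptional c \<epsilon> m"
      then obtain z where z: "\<zeta> \<in> sphere 0 1" "z \<in> koranyi_region c \<zeta>" "\<epsilon> < norm (G z - partial m z)"
        by (auto simp: exceptional_def)
      then have "z \<in> U" by (auto simp: U_def koranyi_region_def)
      then have "D \<inter> koranyi_region c \<zeta> \<noteq> {}"
        using z by (intro D(3) open_koranyi_region \<open>open U\<close>) auto
      then show "\<zeta> \<in> (\<Union>x\<in>D. A x)" using z by (auto simp: A_def)
    qed
  qed
  have A: "A x \<in> sets borel" for x
  proof -
    have "A x = sphere 0 1 \<inter> {\<zeta>. x \<in> koranyi_region c \<zeta>}" by (auto simp: A_def)
    then show ?thesis using open_koranyi_trace[of x c] by auto
  qed
  show "exceptional c \<epsilon> m \<in> sets borel"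
    unfolding eq using A by (intro sets.countable_UN' D(1)) auto
  define T where "T = (\<Sum>k. homog_sqnorm G (k + m))"
  have T0: "T \<ge> 0" unfolding T_def
    by (intro suminf_nonneg summable_ignore_initial_segment summable_homog_sqnorm homog_sqnorm_nonneg)
  show "\<epsilon>\<^sup>2 * measure sphere_measure (exceptional c \<epsilon> m) \<le> 16 * (koranyi_const c CARD('n))\<^sup>2 * (\<Sum>k. homog_sqnorm G (k + m))"
  proof (cases "D = {}")
    case True
    then show ?thesis using T0 by (simp add: eq T_def)
  next
    case False
    define x where "x = from_nat_into D"
    have x: "x j \<in> U" for j using D(2) from_nat_into[OF False] by (auto simp: x_def)
    have eq': "exceptional c \<epsilon> m = (\<Union>n. \<Union>j<n. A (x j))"
    proof -
      have "D = range x" using False D(1) by (simp add: x_def)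
      then show ?thesis unfolding eq by auto
    qed
    have le: "\<epsilon>\<^sup>2 * measure sphere_measure (\<Union>j<n. A (x j)) \<le> 16 * (koranyi_const c CARD('n))\<^sup>2 * T" for n
    proof -
      have nx: "norm (x j) < 1" "\<epsilon> < norm (G (x j) - partial m (x j))" for j
        using x[of j] by (auto simp: U_def)
      have "\<forall>\<^sub>F M in sequentially. \<epsilon> < norm (partial M (x j) - partial m (x j))" for j
      proof -
        have "(\<lambda>M. partial M (x j)) \<longlonglongrightarrow> G (x j)"
          using homog_part_sums[OF G nx(1)] by (simp add: partial_def sums_def)
        then have "(\<lambda>M. norm (partial M (x j) - partial m (x j))) \<longlonglongrightarrow> norm (G (x j) - partial m (x j))"
          by (intro tendsto_intros)
        then show ?thesis using nx(2) by (rule order_tendstoD)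
      qed
      then have "\<forall>\<^sub>F M in sequentially. \<forall>j\<in>{..<n}. \<epsilon> < norm (partial M (x j) - partial m (x j))"
        by (intro eventually_ball_finite) auto
      then have "\<forall>\<^sub>F M in sequentially. (\<forall>j\<in>{..<n}. \<epsilon> < norm (partial M (x j) - partial m (x j))) \<and> m \<le> M"
        using eventually_ge_at_top by (rule eventually_conj)
      \<comment> \<open>Only finitely many points are involved, so one \<open>M\<close> keeps the
        strict inequality at all of them.\<close>
      then obtain M where M: "\<And>j. j < n \<Longrightarrow> \<epsilon> < norm (partial M (x j) - partial m (x j))" "m \<le> M"
        by (auto simp: eventually_sequentially)
      define E where "E = (\<lambda>z. partial M z - partial m z)"
      have E_sum: "E z = (\<Sum>k\<in>{m..<M}. of_real 1 * homog_part G k z)" for z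
      proof -
        have "(\<Sum>k<M. homog_part G k z) = (\<Sum>k<m. homog_part G k z) + (\<Sum>k\<in>{m..<M}. homog_part G k z)"
          using M(2) by (subst sum.union_disjoint[symmetric]) (auto intro!: sum.cong)
        then show ?thesis by (simp add: E_def partial_def)
      qed
      have "(LINT \<eta>|sphere_measure. (norm (E \<eta>))\<^sup>2) = (\<Sum>k\<in>{m..<M}. 1\<^sup>2 * homog_sqnorm G k)"
        unfolding E_sum by (rule integral_homog_sum_sqnorm[OF G]) simp
      also have "\<dots> = (\<Sum>k<M - m. homog_sqnorm G (k + m))"
        by (simp add: sum.atLeastLessThan_shift_0[of _ m M] atLeast0LessThan add.commute o_def)
      also have "\<dots> \<le> T"
        unfolding T_def
        by (intro sum_le_suminf summable_ignore_initial_segment summable_homog_sqnorm) (auto simp: homog_sqnorm_nonneg)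
      finally have ET: "(LINT \<eta>|sphere_measure. (norm (E \<eta>))\<^sup>2) \<le> T" .
      have "polyfun E" unfolding E_def by (intro polyfun_diff poly)
      then have "\<epsilon>\<^sup>2 * measure sphere_measure (\<Union>j<n. {\<zeta> \<in> sphere 0 1. x j \<in> koranyi_region c \<zeta>})
        \<le> 16 * (koranyi_const c CARD('n))\<^sup>2 * (LINT \<eta>|sphere_measure. (norm (E \<eta>))\<^sup>2)"
        by (intro koranyi_weak_type_finite c \<epsilon> nx) (use M in \<open>auto simp: E_def less_imp_le\<close>)
      also have "\<dots> \<le> 16 * (koranyi_const c CARD('n))\<^sup>2 * T"
        by (intro mult_left_mono ET) auto
      finally show ?thesis unfolding A_def .
    qed
    have "(\<lambda>n. measure sphere_measure (\<Union>j<n. A (x j))) \<longlonglongrightarrow> measure sphere_measure (\<Union>n. \<Union>j<n. A (x j))"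
      by (rule sphere.finite_Lim_measure_incseq) (use A in \<open>auto simp: incseq_def intro: order_less_le_trans\<close>)
    then have "(\<lambda>n. \<epsilon>\<^sup>2 * measure sphere_measure (\<Union>j<n. A (x j))) \<longlonglongrightarrow> \<epsilon>\<^sup>2 * measure sphere_measure (exceptional c \<epsilon> m)"
      unfolding eq' by (intro tendsto_intros)
    then show ?thesis
      by (rule LIMSEQ_le_const2) (use le in \<open>auto simp: T_def\<close>)
  qed
qed

text \<open>A point without a suitable \<open>m\<close> lies in all exceptional sets, and the
  measures of these tend to 0 with the tails of the square norms.\<close>

lemma AE_koranyi_oscillation:
  assumes c: "c > 1" and \<epsilon>: "\<epsilon> > 0"
  shows "AE \<zeta> in sphere_measure. \<exists>m. \<forall>z\<in>koranyi_region c \<zeta>. norm (G z - partial m z) \<le> \<epsilon>"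
proof -
  define N where "N = (\<Inter>m. exceptional c \<epsilon> m)"
  have N: "N \<in> sets borel" unfolding N_def using exceptional_bound(1)[OF c \<epsilon>] by auto
  have "(\<lambda>m. 16 * (koranyi_const c CARD('n))\<^sup>2 * (\<Sum>k. homog_sqnorm G (k + m))) \<longlonglongrightarrow> 16 * (koranyi_const c CARD('n))\<^sup>2 * 0"
    by (intro tendsto_mult tendsto_const suminf_exist_split2 summable_homog_sqnorm)
  moreover have "\<epsilon>\<^sup>2 * measure sphere_measure N \<le> 16 * (koranyi_const c CARD('n))\<^sup>2 * (\<Sum>k. homog_sqnorm G (k + m))" for m
  proof -
    have "measure sphere_measure N \<le> measure sphere_measure (exceptional c \<epsilon> m)"
      by (rule sphere.finite_measure_mono) (use exceptional_bound(1)[OF c \<epsilon>] in \<open>auto simp: N_def\<close>)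
    then have "\<epsilon>\<^sup>2 * measure sphere_measure N \<le> \<epsilon>\<^sup>2 * measure sphere_measure (exceptional c \<epsilon> m)"
      by (intro mult_left_mono) auto
    then show ?thesis using exceptional_bound(2)[OF c \<epsilon>, of m] by linarith
  qed
  ultimately have "\<epsilon>\<^sup>2 * measure sphere_measure N \<le> 16 * (koranyi_const c CARD('n))\<^sup>2 * 0"
    by (intro LIMSEQ_le_const) auto
  then have "measure sphere_measure N \<le> 0"
    using \<epsilon> by (simp add: mult_le_0_iff)
  then have "measure sphere_measure N = 0"
    using measure_nonneg[of sphere_measure N] by linarith
  then have "N \<in> null_sets sphere_measure"
    using N by (intro null_setsI) (auto simp: sphere.emeasure_eq_measure)
  from AE_not_in[OF this] AE_sphere_measure show ?thesis
  proof eventually_elim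
    case (elim \<zeta>)
    then obtain m where "\<zeta> \<notin> exceptional c \<epsilon> m" by (auto simp: N_def)
    then have "\<forall>z\<in>koranyi_region c \<zeta>. \<not> \<epsilon> < norm (G z - partial m z)"
      using elim by (auto simp: exceptional_def)
    then show ?case by (intro exI[of _ m]) (auto simp: not_less)
  qed
qed

text \<open>Within a region \<open>G\<close> differs by arbitrarily little from a polynomial, which
  is continuous at the boundary point; this is the Cauchy criterion.\<close>

theorem AE_has_K_limit: "AE \<zeta> in sphere_measure. \<exists>l. has_K_limit G \<zeta> l"
proof -
  have "AE \<zeta> in sphere_measure. \<forall>c n. \<exists>m. \<forall>z\<in>koranyi_region (real c + 2) \<zeta>. norm (G z - partial m z) \<le> inverse (real (Suc n))"
    unfolding AE_all_countable by (intro allI AE_koranyi_oscillation) auto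
  with AE_sphere_measure show ?thesis
  proof eventually_elim
    fix \<zeta> :: "complex ^ 'n"
    assume "\<zeta> \<in> sphere 0 1"
      and osc: "\<forall>c n. \<exists>m. \<forall>z\<in>koranyi_region (real c + 2) \<zeta>. norm (G z - partial m z) \<le> inverse (real (Suc n))"
    then have \<zeta>: "norm \<zeta> = 1" by simp
    show "\<exists>l. has_K_limit G \<zeta> l"
      unfolding has_K_limit_ex_iff[OF \<zeta>]
    proof
      fix c :: nat
      have c1: "(1::real) < real c + 2" by simp
      show "\<exists>l. (G \<longlongrightarrow> l) (at \<zeta> within koranyi_region (real c + 2) \<zeta>)"
        unfolding tendsto_ex_iff_cauchy[OF koranyi_nontrivial[OF \<zeta> c1]]
      proof (intro allI impI)
        fix e :: real assume "e > 0"
        then obtain n where n: "inverse (real (Suc n)) < e / 4"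
          using reals_Archimedean[of "e / 4"] by auto
        obtain m where m: "\<forall>z\<in>koranyi_region (real c + 2) \<zeta>. norm (G z - partial m z) \<le> inverse (real (Suc n))"
          using osc by blast
        have "continuous_on UNIV (\<lambda>z. partial m z)"
          unfolding partial_def by (intro continuous_on_polyfun polyfun_sum polyfun_homog_part G)
        then have "((\<lambda>z. partial m z) \<longlongrightarrow> partial m \<zeta>) (at \<zeta> within koranyi_region (real c + 2) \<zeta>)"
          by (metis UNIV_I continuous_on_def subset_UNIV tendsto_within_subset)
        then have ev: "\<forall>\<^sub>F z in at \<zeta> within koranyi_region (real c + 2) \<zeta>. dist (partial m z) (partial m \<zeta>) < e / 4"
          using \<open>e > 0\<close> by (intro tendstoD) auto
        have ev2: "\<forall>\<^sub>F z in at \<zeta> within koranyi_region (real c + 2) \<zeta>. z \<in> koranyi_region (real c + 2) \<zeta>"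
          by (simp add: eventually_at_filter)
        show "\<exists>P. eventually P (at \<zeta> within koranyi_region (real c + 2) \<zeta>) \<and> (\<forall>x y. P x \<and> P y \<longrightarrow> dist (G x) (G y) < e)"
        proof (intro exI conjI allI impI)
          show "\<forall>\<^sub>F z in at \<zeta> within koranyi_region (real c + 2) \<zeta>. dist (partial m z) (partial m \<zeta>) < e / 4 \<and> dist (G z) (partial m z) < e / 4"
            using ev ev2
          proof eventually_elim
            case (elim z)
            then have "norm (G z - partial m z) \<le> inverse (real (Suc n))" using m by blast
            then show ?case using elim n by (simp add: dist_norm)
          qed
          fix x y
          assume "(dist (partial m x) (partial m \<zeta>) < e / 4 \<and> dist (G x) (partial m x) < e / 4) \<and>
            (dist (partial m y) (partial m \<zeta>) < e / 4 \<and> dist (G y) (partial m y) < e / 4)"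
          moreover have "dist (G x) (G y) \<le> dist (G x) (partial m x) + dist (partial m x) (partial m \<zeta>)
              + dist (partial m y) (partial m \<zeta>) + dist (G y) (partial m y)"
            using dist_triangle[of "G x" "G y" "partial m x"] dist_triangle[of "partial m x" "G y" "partial m \<zeta>"]
              dist_triangle2[of "partial m \<zeta>" "G y" "partial m y"] dist_commute[of "partial m \<zeta>" "partial m y"]
            by linarith
          ultimately show "dist (G x) (G y) < e" by linarith
        qed
      qed
    qed
  qed
qed

end

section \<open>Outer powers of zero-free functions\<close>

lemma mv_holomorphic_on_const: "mv_holomorphic_on (\<lambda>z. c) S"
  by (auto simp: mv_holomorphic_on_def intro!: exI[of _ "\<lambda>_. 0"])

lemma mv_holomorphic_on_mult:
  assumes "mv_holomorphic_on f S" "mv_holomorphic_on g S"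
  shows "mv_holomorphic_on (\<lambda>z. f z * g z) S"
  unfolding mv_holomorphic_on_def
proof
  fix z assume "z \<in> S"
  then obtain D E where D: "(f has_derivative D) (at z)" "\<forall>c v. D (c *s v) = c * D v"
    and E: "(g has_derivative E) (at z)" "\<forall>c v. E (c *s v) = c * E v"
    using assms unfolding mv_holomorphic_on_def by metis
  show "\<exists>D. ((\<lambda>z. f z * g z) has_derivative D) (at z) \<and> (\<forall>c v. D (c *s v) = c * D v)"
    using has_derivative_mult[OF D(1) E(1)] D(2) E(2)
    by (intro exI conjI) (assumption, simp add: algebra_simps)
qed

lemma mv_holomorphic_on_compose:
  assumes f: "mv_holomorphic_on f S" and h: "\<And>z. z \<in> S \<Longrightarrow> h field_differentiable at (f z)"
  shows "mv_holomorphic_on (\<lambda>z. h (f z)) S"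
  unfolding mv_holomorphic_on_def
proof
  fix z assume z: "z \<in> S"
  then obtain D where D: "(f has_derivative D) (at z)" "\<forall>c v. D (c *s v) = c * D v"
    using f unfolding mv_holomorphic_on_def by metis
  obtain h' where "(h has_field_derivative h') (at (f z))"
    using h[OF z] by (auto simp: field_differentiable_def)
  then have "(h has_derivative (*) h') (at (f z))" by (simp add: has_field_derivative_def)
  from has_derivative_compose[OF D(1) this]
  show "\<exists>D. ((\<lambda>z. h (f z)) has_derivative D) (at z) \<and> (\<forall>c v. D (c *s v) = c * D v)"
    using D(2) by (intro exI conjI) (assumption, simp)
qed

lemma mv_holomorphic_on_cong:
  assumes f: "mv_holomorphic_on f S" and S: "open S" and eq: "\<And>z. z \<in> S \<Longrightarrow> f z = g z"
  shows "mv_holomorphic_on g S"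
  unfolding mv_holomorphic_on_def
proof
  fix z assume z: "z \<in> S"
  then obtain D where D: "(f has_derivative D) (at z)" "\<forall>c v. D (c *s v) = c * D v"
    using f unfolding mv_holomorphic_on_def by metis
  have "(g has_derivative D) (at z)"
    by (rule has_derivative_transform_within_open[OF D(1) S z]) (use eq in auto)
  with D(2) show "\<exists>D. (g has_derivative D) (at z) \<and> (\<forall>c v. D (c *s v) = c * D v)" by blast
qed

lemma mv_holomorphic_on_coord: "mv_holomorphic_on (\<lambda>z. z $ i) S"
  unfolding mv_holomorphic_on_def
  by (intro ballI exI[of _ "\<lambda>z. z $ i"] conjI)
    (auto intro!: bounded_linear_imp_has_derivative bounded_linear_vec_nth)

lemma mv_holomorphic_on_add:
  assumes "mv_holomorphic_on f S" "mv_holomorphic_on g S"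
  shows "mv_holomorphic_on (\<lambda>z. f z + g z) S"
  unfolding mv_holomorphic_on_def
proof
  fix z assume "z \<in> S"
  then obtain D E where D: "(f has_derivative D) (at z)" "\<forall>c v. D (c *s v) = c * D v"
    and E: "(g has_derivative E) (at z)" "\<forall>c v. E (c *s v) = c * E v"
    using assms unfolding mv_holomorphic_on_def by metis
  show "\<exists>D. ((\<lambda>z. f z + g z) has_derivative D) (at z) \<and> (\<forall>c v. D (c *s v) = c * D v)"
    using has_derivative_add[OF D(1) E(1)] D(2) E(2)
    by (intro exI conjI) (assumption, simp add: algebra_simps)
qed

lemma mv_holomorphic_on_prod:
  "(\<And>i. i \<in> A \<Longrightarrow> mv_holomorphic_on (f i) S) \<Longrightarrow> mv_holomorphic_on (\<lambda>z. \<Prod>i\<in>A. f i z) S"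
  by (induction A rule: infinite_finite_induct)
    (auto intro: mv_holomorphic_on_const mv_holomorphic_on_mult)

lemma mv_holomorphic_on_polyfun:
  assumes "polyfun f" shows "mv_holomorphic_on f S"
  using assms
proof induction
  case (monom \<alpha>)
  have "mv_holomorphic_on (\<lambda>z. (\<Prod>j<\<alpha> $ i. z $ i)) S" for i
    by (intro mv_holomorphic_on_prod mv_holomorphic_on_coord)
  then show ?case
    unfolding mmonom_def by (intro mv_holomorphic_on_prod) simp
qed (auto intro: mv_holomorphic_on_add mv_holomorphic_on_mult mv_holomorphic_on_const)

text \<open>A continuous logarithm exists on the ball and is automatically holomorphic: near
  \<open>a\<close> it moves by less than pi, so it coincides with
  \<open>L a + Ln (f z / f a)\<close> for the principal branch.\<close>

lemma mv_holomorphic_logarithm: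
  fixes f :: "complex ^ 'n::finite \<Rightarrow> complex"
  assumes f: "mv_holomorphic_on f (ball 0 1)" and nz: "\<And>z. z \<in> ball 0 1 \<Longrightarrow> f z \<noteq> 0"
  obtains L where "mv_holomorphic_on L (ball 0 1)" "\<And>z. z \<in> ball 0 1 \<Longrightarrow> f z = exp (L z)"
proof -
  obtain L where L: "continuous_on (ball 0 1) L" "\<And>z. z \<in> ball 0 1 \<Longrightarrow> f z = exp (L z)"
    using continuous_logarithm_on_ball[OF mv_holomorphic_on_imp_continuous_on[OF f]] nz by metis
  have "mv_holomorphic_on L (ball 0 1)"
    unfolding mv_holomorphic_on_def
  proof
    fix a :: "complex ^ 'n" assume a: "a \<in> ball 0 1"
    obtain D where D: "(f has_derivative D) (at a)" "\<forall>c v. D (c *s v) = c * D v"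
      using f a unfolding mv_holomorphic_on_def by metis
    have Lnd: "(Ln has_derivative (*) (inverse 1)) (at (f a / f a))"
      using has_field_derivative_Ln[of 1] nz[OF a] by (simp add: has_field_derivative_def)
    have "((\<lambda>z. f z / f a) has_derivative (\<lambda>h. D h / f a)) (at a)"
      using has_derivative_mult_right[OF D(1), of "inverse (f a)"] by (simp add: divide_inverse mult.commute)
    from has_derivative_compose[OF this Lnd]
    have "((\<lambda>z. Ln (f z / f a)) has_derivative (\<lambda>h. D h / f a)) (at a)" by simp
    then have d: "((\<lambda>z. L a + Ln (f z / f a)) has_derivative (\<lambda>h. D h / f a)) (at a)"
      by (auto intro!: derivative_eq_intros)
    have "isCont L a" using L(1) a by (simp add: continuous_on_eq_continuous_at)
    then have "(L \<longlongrightarrow> L a) (at a)" by (simp add: isCont_def)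
    then have "\<forall>\<^sub>F z in at a. dist (L z) (L a) < pi" by (rule tendstoD) simp
    moreover have "\<forall>\<^sub>F z in at a. z \<in> ball 0 1"
      using a by (intro eventually_at_in_open') auto
    ultimately have ev: "\<forall>\<^sub>F z in at a. L a + Ln (f z / f a) = L z"
    proof eventually_elim
      case (elim z)
      have "\<bar>Im (L z - L a)\<bar> \<le> norm (L z - L a)" by (rule abs_Im_le_cmod)
      then have "-pi < Im (L z - L a)" "Im (L z - L a) \<le> pi"
        using elim(1) by (auto simp: dist_norm)
      then have "Ln (exp (L z - L a)) = L z - L a" by (rule Ln_exp)
      then show ?case using L(2)[OF elim(2)] L(2)[OF a] by (simp add: exp_diff)
    qed
    have "L a + Ln (f a / f a) = L a" using nz[OF a] by simp
    with ev have "(L has_derivative (\<lambda>h. D h / f a)) (at a)"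
      by (intro has_derivative_transform_eventually[OF d]) auto
    then show "\<exists>D. (L has_derivative D) (at a) \<and> (\<forall>c v. D (c *s v) = c * D v)"
      using D(2) by (intro exI[of _ "\<lambda>h. D h / f a"]) auto
  qed
  then show ?thesis by (rule that) (rule L(2))
qed

text \<open>A fixed sequence in (0,1) tending to 1, since Fatou's lemma and dominated convergence
  are about sequences. The shift by 2 excludes the radius 0.\<close>

definition radius :: "nat \<Rightarrow> real" where
  "radius n = 1 - 1 / (real n + 2)"

lemma radius: "0 < radius n" "radius n < 1"
  by (auto simp: radius_def field_simps)

lemma filterlim_radius: "filterlim radius (at_left 1) sequentially"
  unfolding filterlim_at
proof
  have "(\<lambda>n. 1 - 1 / real (n + 2)) \<longlonglongrightarrow> 1 - 0"
    by (intro tendsto_diff tendsto_const LIMSEQ_ignore_initial_segment lim_1_over_n)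
  then show "radius \<longlonglongrightarrow> 1" by (simp add: radius_def[abs_def] add.commute)
qed (use radius in \<open>auto simp: less_imp_neq\<close>)

lemma has_K_limit_radius:
  assumes "norm \<zeta> = 1" "has_K_limit g \<zeta> l"
  shows "(\<lambda>n. g (radius n *\<^sub>R \<zeta>)) \<longlonglongrightarrow> l"
  using filterlim_compose[OF has_K_limit_radial[OF assms] filterlim_radius] by simp

text \<open>A bound in L^2 gives uniform integrability, so almost everywhere convergence passes to
  the integrals. Fatou's lemma puts \<open>g\<close> in L^2; then y \<le> min y T + y^2/T for y = |f
  n - g| leaves a truncated part, treated by dominated convergence, and a remainder of size at most
  4 K / T.\<close>

lemma (in prob_space) L2_bounded_integral_limit:
  fixes f :: "nat \<Rightarrow> 'a \<Rightarrow> 'b::{banach, second_countable_topology}"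
  assumes [measurable]: "\<And>n. f n \<in> borel_measurable M" "g \<in> borel_measurable M"
    and lim: "AE x in M. (\<lambda>n. f n x) \<longlonglongrightarrow> g x"
    and int: "\<And>n. integrable M (\<lambda>x. (norm (f n x))\<^sup>2)"
    and K: "\<And>n. (LINT x|M. (norm (f n x))\<^sup>2) \<le> K"
  shows "integrable M (\<lambda>x. (norm (g x))\<^sup>2)" "integrable M g"
    "(\<lambda>n. LINT x|M. f n x) \<longlonglongrightarrow> (LINT x|M. g x)"
proof -
  have "0 \<le> (LINT x|M. (norm (f 0 x))\<^sup>2)"
    by (rule Bochner_Integration.integral_nonneg) simp
  then have K0: "K \<ge> 0" using K[of 0] by linarith
  have "(\<integral>\<^sup>+x. ennreal ((norm (g x))\<^sup>2) \<partial>M) = (\<integral>\<^sup>+x. liminf (\<lambda>n. ennreal ((norm (f n x))\<^sup>2)) \<partial>M)"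
  proof (rule nn_integral_cong_AE)
    show "AE x in M. ennreal ((norm (g x))\<^sup>2) = liminf (\<lambda>n. ennreal ((norm (f n x))\<^sup>2))"
      using lim
    proof eventually_elim
      case (elim x)
      then have "(\<lambda>n. ennreal ((norm (f n x))\<^sup>2)) \<longlonglongrightarrow> ennreal ((norm (g x))\<^sup>2)"
        by (intro tendsto_ennrealI tendsto_intros)
      then show ?case by (rule lim_imp_Liminf[OF sequentially_bot, symmetric])
    qed
  qed
  also have "\<dots> \<le> liminf (\<lambda>n. \<integral>\<^sup>+x. ennreal ((norm (f n x))\<^sup>2) \<partial>M)"
    by (rule nn_integral_liminf) measurable
  also have "\<dots> \<le> ennreal K"
  proof (rule Liminf_le)
    show "\<forall>\<^sub>F n in sequentially. (\<integral>\<^sup>+x. ennreal ((norm (f n x))\<^sup>2) \<partial>M) \<le> ennreal K"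
      using K int by (intro always_eventually allI) (simp add: nn_integral_eq_integral ennreal_leI)
  qed simp
  finally have gK: "(\<integral>\<^sup>+x. ennreal ((norm (g x))\<^sup>2) \<partial>M) \<le> ennreal K" .
  show g2: "integrable M (\<lambda>x. (norm (g x))\<^sup>2)"
    using gK by (intro integrableI_bounded) (auto simp: le_less_trans[OF _ ennreal_less_top])
  have "ennreal (LINT x|M. (norm (g x))\<^sup>2) \<le> ennreal K"
    using gK nn_integral_eq_integral[OF g2] by simp
  then have g2K: "(LINT x|M. (norm (g x))\<^sup>2) \<le> K"
    using K0 by simp
  have L1: "integrable M h" if [measurable]: "h \<in> borel_measurable M" and h: "integrable M (\<lambda>x. (norm (h x))\<^sup>2)" for h :: "'a \<Rightarrow> 'b"
  proof (rule Bochner_Integration.integrable_bound)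
    show "integrable M (\<lambda>x. 1 + (norm (h x))\<^sup>2)" using h by simp
    have "norm (h x) \<le> norm (1 + (norm (h x))\<^sup>2)" for x
    proof -
      have "0 \<le> (norm (h x) - 1)\<^sup>2" by simp
      then have "2 * norm (h x) \<le> 1 + (norm (h x))\<^sup>2" by (simp add: power2_eq_square algebra_simps)
      moreover have "0 \<le> (norm (h x))\<^sup>2" by simp
      ultimately show ?thesis using norm_ge_zero[of "h x"] unfolding real_norm_def by linarith
    qed
    then show "AE x in M. norm (h x) \<le> norm (1 + (norm (h x))\<^sup>2)" by blast
  qed simp
  show gi: "integrable M g" by (rule L1[OF _ g2]) simp
  have fi: "integrable M (f n)" for n by (rule L1[OF _ int]) simp
  have sq: "(norm (f n x - g x))\<^sup>2 \<le> 2 * (norm (f n x))\<^sup>2 + 2 * (norm (g x))\<^sup>2" for n x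
  proof -
    have "(norm (f n x - g x))\<^sup>2 \<le> (norm (f n x) + norm (g x))\<^sup>2"
      by (intro power_mono norm_triangle_ineq4) simp
    also have "\<dots> \<le> 2 * (norm (f n x))\<^sup>2 + 2 * (norm (g x))\<^sup>2"
      using sum_squares_bound[of "norm (f n x)" "norm (g x)"] by (simp add: power2_sum)
    finally show ?thesis .
  qed
  have di: "integrable M (\<lambda>x. (norm (f n x - g x))\<^sup>2)" for n
    by (rule Bochner_Integration.integrable_bound[of _ "\<lambda>x. 2 * (norm (f n x))\<^sup>2 + 2 * (norm (g x))\<^sup>2"])
      (use int g2 sq in auto)
  have dK: "(LINT x|M. (norm (f n x - g x))\<^sup>2) \<le> 4 * K" for n
  proof -
    have "(LINT x|M. (norm (f n x - g x))\<^sup>2) \<le> (LINT x|M. 2 * (norm (f n x))\<^sup>2 + 2 * (norm (g x))\<^sup>2)"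
      by (rule integral_mono[OF di]) (use int g2 sq in auto)
    also have "\<dots> = 2 * (LINT x|M. (norm (f n x))\<^sup>2) + 2 * (LINT x|M. (norm (g x))\<^sup>2)"
      using int g2 by simp
    finally show ?thesis using K[of n] g2K by linarith
  qed
  have mi: "integrable M (\<lambda>x. min (norm (f n x - g x)) T)" if "T > 0" for n T
    by (rule integrable_const_bound[where B = T]) (use that in auto)
  show "(\<lambda>n. LINT x|M. f n x) \<longlonglongrightarrow> (LINT x|M. g x)"
  proof (rule tendstoI)
    fix e :: real assume e: "e > 0"
    \<comment> \<open>Makes the remainder 4 K / T at most e/2; the summand 1 keeps \<open>T\<close>
      positive when \<open>K\<close> is 0.\<close>
    define T where "T = 8 * (K + 1) / e"
    have T: "T > 0" using K0 e by (simp add: T_def)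
    have "(\<lambda>n. LINT x|M. min (norm (f n x - g x)) T) \<longlonglongrightarrow> (LINT x|M. 0)"
    proof (rule integral_dominated_convergence[where w = "\<lambda>_. T"])
      show "AE x in M. (\<lambda>n. min (norm (f n x - g x)) T) \<longlonglongrightarrow> 0"
        using lim
      proof eventually_elim
        case (elim x)
        then have "(\<lambda>n. min (norm (f n x - g x)) T) \<longlonglongrightarrow> min (norm (g x - g x)) T"
          by (intro tendsto_intros)
        then show ?case using T by simp
      qed
      show "AE x in M. norm (min (norm (f n x - g x)) T) \<le> T" for n using T by auto
    qed simp_all
    then have "\<forall>\<^sub>F n in sequentially. (LINT x|M. min (norm (f n x - g x)) T) < e / 2"
      using e by (intro order_tendstoD(2)) auto
    then show "\<forall>\<^sub>F n in sequentially. dist (LINT x|M. f n x) (LINT x|M. g x) < e"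
    proof eventually_elim
      case (elim n)
      have "dist (LINT x|M. f n x) (LINT x|M. g x) = norm (LINT x|M. f n x - g x)"
        using fi gi by (simp add: dist_norm)
      also have "\<dots> \<le> (LINT x|M. norm (f n x - g x))"
        by (rule integral_norm_bound)
      also have "\<dots> \<le> (LINT x|M. min (norm (f n x - g x)) T + (norm (f n x - g x))\<^sup>2 / T)"
      proof (rule integral_mono)
        show "integrable M (\<lambda>x. min (norm (f n x - g x)) T + (norm (f n x - g x))\<^sup>2 / T)"
          using di mi[OF T] by (intro Bochner_Integration.integrable_add integrable_divide)
        fix x
        show "norm (f n x - g x) \<le> min (norm (f n x - g x)) T + (norm (f n x - g x))\<^sup>2 / T"
        proof (cases "norm (f n x - g x) \<le> T")
          case False
          then have "norm (f n x - g x) * T \<le> norm (f n x - g x) * norm (f n x - g x)"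
            by (intro mult_left_mono) auto
          then have "norm (f n x - g x) \<le> (norm (f n x - g x))\<^sup>2 / T"
            using T by (simp add: field_simps power2_eq_square)
          then show ?thesis using T False by simp
        qed (use T in simp)
      qed (use fi gi in auto)
      also have "\<dots> = (LINT x|M. min (norm (f n x - g x)) T) + (LINT x|M. (norm (f n x - g x))\<^sup>2) / T"
        using di mi[OF T] by (subst Bochner_Integration.integral_add) auto
      also have "(LINT x|M. (norm (f n x - g x))\<^sup>2) / T \<le> 4 * K / T"
        using dK T by (intro divide_right_mono) auto
      also have "4 * K / T \<le> e / 2"
        using K0 e by (simp add: T_def field_simps)
      finally show ?case using elim by linarith
    qed
  qed
qed

text \<open>\<open>F\<close> is exp((p/2) L) for a logarithm \<open>L\<close> of 1/g. The
  conclusions collect all that later arguments use: boundary values, their relation to the weight,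
  and the mean value property up to the boundary for q/F and ln |F|.\<close>

lemma outer_factor:
  fixes g :: "complex ^ 'n::finite \<Rightarrow> complex"
  assumes p: "0 < p" and g: "g \<in> hardy_space p"
    and nz: "\<forall>z\<in>ball 0 1. g z \<noteq> 0" and inv: "(\<lambda>z. 1 / g z) \<in> hardy_inf"
  obtains F Fs B where "mv_holomorphic_on F (ball 0 1)" "F \<in> borel_measurable borel" "\<And>z. norm z < 1 \<Longrightarrow> norm (F z) \<le> B"
    "\<And>z. norm z < 1 \<Longrightarrow> F z \<noteq> 0"
    "Fs \<in> borel_measurable borel"
    "AE \<zeta> in sphere_measure. (\<lambda>n. F (radius n *\<^sub>R \<zeta>)) \<longlonglongrightarrow> Fs \<zeta>"
    "AE \<zeta> in sphere_measure. Fs \<zeta> \<noteq> 0"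
    "AE \<zeta> in sphere_measure. norm (boundary_value g \<zeta>) powr p = 1 / (norm (Fs \<zeta>))\<^sup>2"
    "\<And>q. polyfun q \<Longrightarrow> integrable sphere_measure (\<lambda>\<zeta>. (norm (q \<zeta> / Fs \<zeta>))\<^sup>2)"
    "\<And>q. polyfun q \<Longrightarrow> integrable sphere_measure (\<lambda>\<zeta>. q \<zeta> / Fs \<zeta>)"
    "\<And>q. polyfun q \<Longrightarrow> (LINT \<zeta>|sphere_measure. q \<zeta> / Fs \<zeta>) = q 0 / F 0"
    "integrable sphere_measure (\<lambda>\<zeta>. ln (norm (Fs \<zeta>)))"
    "(LINT \<zeta>|sphere_measure. ln (norm (Fs \<zeta>))) = ln (norm (F 0))"
proof -
  have fin: "hardy_mean p g < \<infinity>"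
    using g by (simp add: hardy_space_def)
  \<comment> \<open>Cut off outside the ball, so that zero-freeness and bounds are stated inside
    while measurability can be had globally.\<close>
  define f where "f = (\<lambda>z. if z \<in> ball 0 1 then 1 / g z else 0)"
  have f: "mv_holomorphic_on f (ball 0 1)"
    by (rule mv_holomorphic_on_cong[of "\<lambda>z. 1 / g z"]) (use inv in \<open>auto simp: f_def hardy_inf_def\<close>)
  have fnz: "f z \<noteq> 0" if "z \<in> ball 0 1" for z using nz that by (simp add: f_def)
  obtain L where L: "mv_holomorphic_on L (ball 0 1)" "\<And>z. z \<in> ball 0 1 \<Longrightarrow> f z = exp (L z)"
    using mv_holomorphic_logarithm[OF f fnz] by metis
  obtain B0 where B0: "\<forall>x\<in>(\<lambda>z. 1 / g z) ` ball 0 1. norm x \<le> B0"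
    using inv unfolding hardy_inf_def bounded_iff by blast
  then have fB: "norm (f z) \<le> B0" if "norm z < 1" for z
    using that by (simp add: f_def)
  define F where "F = (\<lambda>z. if z \<in> ball 0 1 then exp (of_real (p / 2) * L z) else 0)"
  have F: "mv_holomorphic_on F (ball 0 1)"
  proof (rule mv_holomorphic_on_cong)
    show "mv_holomorphic_on (\<lambda>z. exp (of_real (p / 2) * L z)) (ball 0 1)"
      by (intro mv_holomorphic_on_compose[of _ _ exp] mv_holomorphic_on_mult mv_holomorphic_on_const L
          field_differentiable_within_exp)
  qed (auto simp: F_def)
  have nF: "norm (F z) = norm (f z) powr (p / 2)" if "norm z < 1" for z
    using that by (simp add: F_def L(2) powr_def)
  define B where "B = B0 powr (p / 2)"
  have FB: "norm (F z) \<le> B" if "norm z < 1" for z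
    unfolding nF[OF that] B_def using fB[OF that] p by (intro powr_mono2) auto
  have Fnz: "F z \<noteq> 0" if "norm z < 1" for z using that by (simp add: F_def)
  have meas0: "(\<lambda>z. if z \<in> ball 0 1 then h z else 0) \<in> borel_measurable borel"
    if "mv_holomorphic_on h (ball 0 1)" for h :: "complex ^ 'n \<Rightarrow> complex"
    by (intro measurable_zero_outside_ball mv_holomorphic_on_imp_continuous_on that)
  have Fm [measurable]: "F \<in> borel_measurable borel"
    using meas0[OF F] by (simp add: F_def cong: if_cong)
  define Fs where "Fs = boundary_value F"
  have Fsm [measurable]: "Fs \<in> borel_measurable borel"
    unfolding Fs_def by (intro measurable_boundary_value mv_holomorphic_on_imp_continuous_on F)
  have AEF: "AE \<zeta> in sphere_measure. has_K_limit F \<zeta> (Fs \<zeta>)"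
  proof -
    have "AE \<zeta> in sphere_measure. \<exists>l. has_K_limit F \<zeta> l"
      by (rule AE_has_K_limit[OF F]) (rule FB)
    then show ?thesis
      using AE_sphere_measure
    proof eventually_elim
      case (elim \<zeta>)
      then obtain l where "has_K_limit F \<zeta> l" by blast
      moreover from this have "Fs \<zeta> = l" unfolding Fs_def using elim by (intro boundary_value_eq) auto
      ultimately show ?case by simp
    qed
  qed
  have Flim: "AE \<zeta> in sphere_measure. (\<lambda>n. F (radius n *\<^sub>R \<zeta>)) \<longlonglongrightarrow> Fs \<zeta>"
    using AEF AE_sphere_measure by eventually_elim (simp add: has_K_limit_radius)
  have rb: "norm (radius n *\<^sub>R \<zeta>) < 1" if "norm \<zeta> = 1" for n and \<zeta> :: "complex ^ 'n"
    using that radius[of n] by simp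
  have key: "1 / (norm (F z))\<^sup>2 = norm (g z) powr p" if "norm z < 1" for z
  proof -
    have "(norm (F z))\<^sup>2 = norm (f z) powr p"
      unfolding nF[OF that] power2_eq_square powr_add[symmetric] by simp
    also have "\<dots> = inverse (norm (g z) powr p)"
      using that by (simp add: f_def norm_divide powr_divide inverse_eq_divide)
    finally show ?thesis by (simp add: divide_inverse)
  qed
  \<comment> \<open>Finite by the Hardy condition, so the conversion to a real loses nothing; it
    bounds the squares of all dilations of 1/F in the mean.\<close>
  define K where "K = enn2real (hardy_mean p g)"
  have nnK: "(\<integral>\<^sup>+\<zeta>. ennreal ((norm (1 / F (radius n *\<^sub>R \<zeta>)))\<^sup>2) \<partial>sphere_measure) \<le> ennreal K" for n
  proof -
    have "(\<integral>\<^sup>+\<zeta>. ennreal ((norm (1 / F (radius n *\<^sub>R \<zeta>)))\<^sup>2) \<partial>sphere_measure)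
      = (\<integral>\<^sup>+ \<zeta>\<in>sphere 0 1. ennreal (norm (g (radius n *\<^sub>R \<zeta>)) powr p) \<partial>sphere_measure)"
    proof (rule nn_integral_cong_AE)
      show "AE \<zeta> in sphere_measure. ennreal ((norm (1 / F (radius n *\<^sub>R \<zeta>)))\<^sup>2)
         = ennreal (norm (g (radius n *\<^sub>R \<zeta>)) powr p) * indicator (sphere 0 1) \<zeta>"
        using AE_sphere_measure
      proof eventually_elim
        fix \<zeta> :: "complex ^ 'n" assume \<zeta>: "\<zeta> \<in> sphere 0 1"
        have "norm (radius n *\<^sub>R \<zeta>) < 1" using \<zeta> by (intro rb) simp
        from key[OF this] \<zeta> show "ennreal ((norm (1 / F (radius n *\<^sub>R \<zeta>)))\<^sup>2)
         = ennreal (norm (g (radius n *\<^sub>R \<zeta>)) powr p) * indicator (sphere 0 1) \<zeta>"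
          by (simp add: norm_divide power_divide)
      qed
    qed
    also have "\<dots> \<le> hardy_mean p g"
      unfolding hardy_mean_def using radius[of n] by (intro SUP_upper) auto
    also have "\<dots> = ennreal K" using fin by (simp add: K_def)
    finally show ?thesis .
  qed
  have inv_int: "integrable sphere_measure (\<lambda>\<zeta>. (norm (1 / F (radius n *\<^sub>R \<zeta>)))\<^sup>2)" for n
    using nnK[of n] by (intro integrableI_bounded) (auto simp: le_less_trans[OF _ ennreal_less_top])
  have inv_K: "(LINT \<zeta>|sphere_measure. (norm (1 / F (radius n *\<^sub>R \<zeta>)))\<^sup>2) \<le> K" for n
    using nnK[of n] unfolding nn_integral_eq_integral[OF inv_int AE_I2, simplified]
    by (simp add: K_def)
  \<comment> \<open>Where the boundary value vanishes, the squares of 1/F blow up along the radii;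
    by Fatou's lemma and the bound \<open>K\<close> this happens only on a null set.\<close>
  have Fs0: "AE \<zeta> in sphere_measure. Fs \<zeta> \<noteq> 0"
  proof -
    have "(\<integral>\<^sup>+\<zeta>. liminf (\<lambda>n. ennreal ((norm (1 / F (radius n *\<^sub>R \<zeta>)))\<^sup>2)) \<partial>sphere_measure)
       \<le> liminf (\<lambda>n. \<integral>\<^sup>+\<zeta>. ennreal ((norm (1 / F (radius n *\<^sub>R \<zeta>)))\<^sup>2) \<partial>sphere_measure)"
      by (rule nn_integral_liminf) measurable
    also have "\<dots> \<le> ennreal K"
      by (rule Liminf_le) (auto intro!: always_eventually nnK)
    also have "\<dots> < \<infinity>" by simp
    finally have "AE \<zeta> in sphere_measure. liminf (\<lambda>n. ennreal ((norm (1 / F (radius n *\<^sub>R \<zeta>)))\<^sup>2)) \<noteq> \<infinity>"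
      by (intro nn_integral_PInf_AE) auto
    then show ?thesis using Flim AE_sphere_measure
    proof eventually_elim
      fix \<zeta> :: "complex ^ 'n"
      assume a: "liminf (\<lambda>n. ennreal ((norm (1 / F (radius n *\<^sub>R \<zeta>)))\<^sup>2)) \<noteq> \<infinity>"
        and b: "(\<lambda>n. F (radius n *\<^sub>R \<zeta>)) \<longlonglongrightarrow> Fs \<zeta>" and \<zeta>: "\<zeta> \<in> sphere 0 1"
      show "Fs \<zeta> \<noteq> 0"
      proof
        assume "Fs \<zeta> = 0"
        then have "(\<lambda>n. (norm (F (radius n *\<^sub>R \<zeta>)))\<^sup>2) \<longlonglongrightarrow> (norm (0::complex))\<^sup>2"
          using b by (intro tendsto_intros) simp
        moreover have "F (radius n *\<^sub>R \<zeta>) \<noteq> 0" for n using \<zeta> by (intro Fnz rb) simp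
        ultimately have "filterlim (\<lambda>n. inverse ((norm (F (radius n *\<^sub>R \<zeta>)))\<^sup>2)) at_top sequentially"
          by (intro filterlim_inverse_at_top) auto
        then have "(\<lambda>n. ennreal ((norm (1 / F (radius n *\<^sub>R \<zeta>)))\<^sup>2)) \<longlonglongrightarrow> top"
          by (subst ennreal_tendsto_top_eq_at_top) (simp add: norm_divide power_divide inverse_eq_divide)
        then have "liminf (\<lambda>n. ennreal ((norm (1 / F (radius n *\<^sub>R \<zeta>)))\<^sup>2)) = top"
          by (intro lim_imp_Liminf) auto
        then show False using a by simp
      qed
    qed
  qed
  have AEf: "AE \<zeta> in sphere_measure. \<exists>l. has_K_limit f \<zeta> l"
    by (rule AE_has_K_limit[OF f]) (rule fB)
  have w: "AE \<zeta> in sphere_measure. norm (boundary_value g \<zeta>) powr p = 1 / (norm (Fs \<zeta>))\<^sup>2"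
    using AEf Flim Fs0 AE_sphere_measure
  proof eventually_elim
    fix \<zeta> :: "complex ^ 'n"
    assume "\<exists>l. has_K_limit f \<zeta> l" and F: "(\<lambda>n. F (radius n *\<^sub>R \<zeta>)) \<longlonglongrightarrow> Fs \<zeta>" and "Fs \<zeta> \<noteq> 0" and "\<zeta> \<in> sphere 0 1"
    then obtain l where l: "has_K_limit f \<zeta> l" and \<zeta>: "norm \<zeta> = 1" by auto
    have "(\<lambda>n. norm (f (radius n *\<^sub>R \<zeta>)) powr (p / 2)) \<longlonglongrightarrow> norm l powr (p / 2)"
      using p by (intro tendsto_powr' tendsto_norm has_K_limit_radius[OF \<zeta> l] tendsto_const) auto
    then have "(\<lambda>n. norm (F (radius n *\<^sub>R \<zeta>))) \<longlonglongrightarrow> norm l powr (p / 2)"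
      using rb[OF \<zeta>] by (simp add: nF)
    then have nl: "norm (Fs \<zeta>) = norm l powr (p / 2)"
      by (intro LIMSEQ_unique[OF tendsto_norm[OF F]])
    then have l0: "l \<noteq> 0" using \<open>Fs \<zeta> \<noteq> 0\<close> p by auto
    \<comment> \<open>The limit of the bounded function 1/g is nonzero here because
      \<open>Fs \<zeta>\<close> is, so the limit of \<open>g\<close> is its reciprocal.\<close>
    have "has_K_limit g \<zeta> (1 / l)"
      unfolding has_K_limit_def
    proof (intro allI impI)
      fix c :: real assume "c > 1"
      then have "(f \<longlongrightarrow> l) (at \<zeta> within koranyi_region c \<zeta>)" using l by (simp add: has_K_limit_def)
      then have "((\<lambda>z. 1 / f z) \<longlongrightarrow> 1 / l) (at \<zeta> within koranyi_region c \<zeta>)"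
        using l0 by (intro tendsto_intros)
      then show "(g \<longlongrightarrow> 1 / l) (at \<zeta> within koranyi_region c \<zeta>)"
      proof (rule Lim_transform_eventually)
        have "1 / f z = g z" if "z \<in> koranyi_region c \<zeta>" for z
          using that by (auto simp: f_def koranyi_region_def)
        then show "\<forall>\<^sub>F z in at \<zeta> within koranyi_region c \<zeta>. 1 / f z = g z"
          by (simp add: eventually_at_filter)
      qed
    qed
    then have "boundary_value g \<zeta> = 1 / l" by (rule boundary_value_eq[OF \<zeta>])
    moreover have "(norm (Fs \<zeta>))\<^sup>2 = norm l powr p"
      unfolding nl power2_eq_square powr_add[symmetric] by simp
    ultimately show "norm (boundary_value g \<zeta>) powr p = 1 / (norm (Fs \<zeta>))\<^sup>2"
      by (simp add: norm_divide powr_divide)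
  qed
  have inv_lim: "AE \<zeta> in sphere_measure. (\<lambda>n. 1 / F (radius n *\<^sub>R \<zeta>)) \<longlonglongrightarrow> 1 / Fs \<zeta>"
    using Flim Fs0 by eventually_elim (auto intro!: tendsto_intros)
  have Q: "integrable sphere_measure (\<lambda>\<zeta>. (norm (q \<zeta> / Fs \<zeta>))\<^sup>2)
     \<and> integrable sphere_measure (\<lambda>\<zeta>. q \<zeta> / Fs \<zeta>)
     \<and> (LINT \<zeta>|sphere_measure. q \<zeta> / Fs \<zeta>) = q 0 / F 0" if q: "polyfun q" for q
  proof -
    have [measurable]: "q \<in> borel_measurable borel" by (rule borel_measurable_polyfun[OF q])
    obtain C where C: "\<And>x. norm x = 1 \<Longrightarrow> norm (q x) \<le> C"
      using continuous_bounded_on_sphere[OF continuous_on_polyfun[OF q]] by blast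
    have sq: "AE \<zeta> in sphere_measure. norm ((norm (q \<zeta> / F (radius n *\<^sub>R \<zeta>)))\<^sup>2) \<le> norm (C\<^sup>2 * (norm (1 / F (radius n *\<^sub>R \<zeta>)))\<^sup>2)" for n
      using AE_sphere_measure
    proof eventually_elim
      fix \<zeta> :: "complex ^ 'n" assume "\<zeta> \<in> sphere 0 1"
      then have "(norm (q \<zeta>))\<^sup>2 \<le> C\<^sup>2" by (intro power_mono C) auto
      then have "(norm (q \<zeta>))\<^sup>2 * (norm (1 / F (radius n *\<^sub>R \<zeta>)))\<^sup>2 \<le> C\<^sup>2 * (norm (1 / F (radius n *\<^sub>R \<zeta>)))\<^sup>2"
        by (rule mult_right_mono) simp
      moreover have "(norm (q \<zeta> / F (radius n *\<^sub>R \<zeta>)))\<^sup>2 = (norm (q \<zeta>))\<^sup>2 * (norm (1 / F (radius n *\<^sub>R \<zeta>)))\<^sup>2"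
        by (simp add: norm_divide power_divide)
      ultimately show "norm ((norm (q \<zeta> / F (radius n *\<^sub>R \<zeta>)))\<^sup>2) \<le> norm (C\<^sup>2 * (norm (1 / F (radius n *\<^sub>R \<zeta>)))\<^sup>2)"
        by simp
    qed
    have i1: "integrable sphere_measure (\<lambda>\<zeta>. (norm (q \<zeta> / F (radius n *\<^sub>R \<zeta>)))\<^sup>2)" for n
      by (rule Bochner_Integration.integrable_bound[OF integrable_mult_right[OF inv_int[of n], of "C\<^sup>2"] _ sq]) measurable
    have i2: "(LINT \<zeta>|sphere_measure. (norm (q \<zeta> / F (radius n *\<^sub>R \<zeta>)))\<^sup>2) \<le> C\<^sup>2 * K" for n
    proof -
      have "(LINT \<zeta>|sphere_measure. (norm (q \<zeta> / F (radius n *\<^sub>R \<zeta>)))\<^sup>2)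
         \<le> (LINT \<zeta>|sphere_measure. C\<^sup>2 * (norm (1 / F (radius n *\<^sub>R \<zeta>)))\<^sup>2)"
        by (rule integral_mono_AE[OF i1 integrable_mult_right[OF inv_int]]) (use sq[of n] in simp)
      also have "\<dots> = C\<^sup>2 * (LINT \<zeta>|sphere_measure. (norm (1 / F (radius n *\<^sub>R \<zeta>)))\<^sup>2)"
        by simp
      also have "\<dots> \<le> C\<^sup>2 * K" by (intro mult_left_mono inv_K) simp
      finally show ?thesis .
    qed
    have ql: "AE \<zeta> in sphere_measure. (\<lambda>n. q \<zeta> / F (radius n *\<^sub>R \<zeta>)) \<longlonglongrightarrow> q \<zeta> / Fs \<zeta>"
      using Flim Fs0 by eventually_elim (auto intro!: tendsto_intros)
    have qm: "(LINT \<zeta>|sphere_measure. q \<zeta> / F (radius n *\<^sub>R \<zeta>)) = q 0 / F 0" for n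
    proof -
      \<comment> \<open>The argument of \<open>q\<close> is rescaled by the inverse radius so that
        dilating \<open>G\<close> affects only \<open>F\<close>.\<close>
      define G where "G = (\<lambda>z. q (of_real (1 / radius n) *s z) * (1 / F z))"
      have "mv_holomorphic_on G (ball 0 1)"
        unfolding G_def
        by (intro mv_holomorphic_on_mult mv_holomorphic_on_polyfun polyfun_smult_arg q
            mv_holomorphic_on_compose[of _ _ "\<lambda>x. 1 / x"] F) (auto intro!: derivative_intros Fnz)
      moreover have "G \<in> borel_measurable borel"
        unfolding G_def using borel_measurable_polyfun[OF polyfun_smult_arg[OF q]] by measurable
      ultimately have "(LINT \<zeta>|sphere_measure. G (radius n *\<^sub>R \<zeta>)) = G 0"
        by (intro mean_value_sphere radius)
      moreover have "G (radius n *\<^sub>R \<zeta>) = q \<zeta> / F (radius n *\<^sub>R \<zeta>)" for \<zeta>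
        using radius[of n] by (simp add: G_def scaleR_eq_smult vector_smult_assoc flip: of_real_mult)
      moreover have "G 0 = q 0 / F 0" by (simp add: G_def)
      ultimately show ?thesis by simp
    qed
    note V = sphere.L2_bounded_integral_limit[of "\<lambda>n \<zeta>. q \<zeta> / F (radius n *\<^sub>R \<zeta>)" "\<lambda>\<zeta>. q \<zeta> / Fs \<zeta>" "C\<^sup>2 * K", OF _ _ ql i1 i2]
    have m1: "(\<lambda>\<zeta>. q \<zeta> / F (radius n *\<^sub>R \<zeta>)) \<in> borel_measurable sphere_measure" for n by simp
    have m2: "(\<lambda>\<zeta>. q \<zeta> / Fs \<zeta>) \<in> borel_measurable sphere_measure" by simp
    have "(\<lambda>n. q 0 / F 0) \<longlonglongrightarrow> (LINT \<zeta>|sphere_measure. q \<zeta> / Fs \<zeta>)"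
      using V(3)[OF m1 m2] unfolding qm .
    then have "(LINT \<zeta>|sphere_measure. q \<zeta> / Fs \<zeta>) = q 0 / F 0"
      by (simp add: LIMSEQ_const_iff)
    then show ?thesis using V(1,2)[OF m1 m2] by blast
  qed
  have lnF: "integrable sphere_measure (\<lambda>\<zeta>. ln (norm (Fs \<zeta>))) \<and> (LINT \<zeta>|sphere_measure. ln (norm (Fs \<zeta>))) = ln (norm (F 0))"
  proof -
    define C where "C = \<bar>ln (max B 1)\<bar>"
    \<comment> \<open>From above ln |F| is bounded because \<open>F\<close> is; from below it
      exceeds -|1/F|. Hence the square means of ln |F| inherit the bound for 1/F.\<close>
    have bd: "\<bar>ln (norm (F z))\<bar> \<le> C + norm (1 / F z)" if z: "norm z < 1" for z
    proof -
      have "ln (norm (F z)) \<le> ln (max B 1)"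
        using FB[OF z] Fnz[OF z] by (intro ln_mono) auto
      moreover have "- ln (norm (F z)) \<le> norm (1 / F z)"
        using ln_le_minus_one[of "norm (1 / F z)"] Fnz[OF z] by (simp add: norm_divide ln_div)
      moreover have "norm (1 / F z) \<ge> 0" by simp
      ultimately show ?thesis unfolding C_def by linarith
    qed
    have sq: "AE \<zeta> in sphere_measure. norm ((norm (ln (norm (F (radius n *\<^sub>R \<zeta>)))))\<^sup>2)
       \<le> norm (2 * C\<^sup>2 + 2 * (norm (1 / F (radius n *\<^sub>R \<zeta>)))\<^sup>2)" for n
      using AE_sphere_measure
    proof eventually_elim
      fix \<zeta> :: "complex ^ 'n" assume "\<zeta> \<in> sphere 0 1"
      then have "norm (radius n *\<^sub>R \<zeta>) < 1" by (intro rb) simp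
      from bd[OF this] have "(norm (ln (norm (F (radius n *\<^sub>R \<zeta>)))))\<^sup>2 \<le> (C + norm (1 / F (radius n *\<^sub>R \<zeta>)))\<^sup>2"
        by (intro power_mono) auto
      also have "\<dots> \<le> 2 * C\<^sup>2 + 2 * (norm (1 / F (radius n *\<^sub>R \<zeta>)))\<^sup>2"
        using sum_squares_bound[of C "norm (1 / F (radius n *\<^sub>R \<zeta>))"] by (simp add: power2_sum)
      finally show "norm ((norm (ln (norm (F (radius n *\<^sub>R \<zeta>)))))\<^sup>2)
       \<le> norm (2 * C\<^sup>2 + 2 * (norm (1 / F (radius n *\<^sub>R \<zeta>)))\<^sup>2)" by simp
    qed
    have ib: "integrable sphere_measure (\<lambda>\<zeta>. 2 * C\<^sup>2 + 2 * (norm (1 / F (radius n *\<^sub>R \<zeta>)))\<^sup>2)" for n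
      using inv_int[of n] by (intro Bochner_Integration.integrable_add integrable_mult_right) auto
    have i1: "integrable sphere_measure (\<lambda>\<zeta>. (norm (ln (norm (F (radius n *\<^sub>R \<zeta>)))))\<^sup>2)" for n
      by (rule Bochner_Integration.integrable_bound[OF ib[of n] _ sq]) measurable
    have i2: "(LINT \<zeta>|sphere_measure. (norm (ln (norm (F (radius n *\<^sub>R \<zeta>)))))\<^sup>2) \<le> 2 * C\<^sup>2 + 2 * K" for n
    proof -
      have "(LINT \<zeta>|sphere_measure. (norm (ln (norm (F (radius n *\<^sub>R \<zeta>)))))\<^sup>2)
         \<le> (LINT \<zeta>|sphere_measure. 2 * C\<^sup>2 + 2 * (norm (1 / F (radius n *\<^sub>R \<zeta>)))\<^sup>2)"
        by (rule integral_mono_AE[OF i1 ib]) (use sq[of n] in simp)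
      also have "\<dots> = 2 * C\<^sup>2 + 2 * (LINT \<zeta>|sphere_measure. (norm (1 / F (radius n *\<^sub>R \<zeta>)))\<^sup>2)"
        using inv_int[of n] by (subst Bochner_Integration.integral_add) (auto simp: sphere.prob_space[simplified])
      also have "\<dots> \<le> 2 * C\<^sup>2 + 2 * K" using inv_K[of n] by simp
      finally show ?thesis .
    qed
    have ll: "AE \<zeta> in sphere_measure. (\<lambda>n. ln (norm (F (radius n *\<^sub>R \<zeta>)))) \<longlonglongrightarrow> ln (norm (Fs \<zeta>))"
      using Flim Fs0 by eventually_elim (auto intro!: tendsto_intros)
    have qm: "(LINT \<zeta>|sphere_measure. ln (norm (F (radius n *\<^sub>R \<zeta>)))) = ln (norm (F 0))" for n
    proof -
      \<comment> \<open>ln |F| is the real part of this holomorphic function, to which the mean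
        value property applies.\<close>
      define G where "G = (\<lambda>z. if z \<in> ball 0 1 then of_real (p / 2) * L z else 0)"
      have aL: "mv_holomorphic_on (\<lambda>z. of_real (p / 2) * L z) (ball 0 1)"
        by (intro mv_holomorphic_on_mult mv_holomorphic_on_const L)
      have G: "mv_holomorphic_on G (ball 0 1)"
        by (rule mv_holomorphic_on_cong[OF aL]) (auto simp: G_def)
      have Gm: "G \<in> borel_measurable borel"
        unfolding G_def by (rule meas0[OF aL])
      have lnG: "ln (norm (F z)) = Re (G z)" if "norm z < 1" for z
        using that by (simp add: F_def G_def)
      note mv = mean_value_sphere[OF G radius Gm]
      have "(LINT \<zeta>|sphere_measure. ln (norm (F (radius n *\<^sub>R \<zeta>)))) = (LINT \<zeta>|sphere_measure. Re (G (radius n *\<^sub>R \<zeta>)))"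
      proof (rule integral_cong_AE)
        show "AE \<zeta> in sphere_measure. ln (norm (F (radius n *\<^sub>R \<zeta>))) = Re (G (radius n *\<^sub>R \<zeta>))"
          using AE_sphere_measure by eventually_elim (intro lnG rb, simp)
      qed (use Gm in auto)
      also have "\<dots> = Re (LINT \<zeta>|sphere_measure. G (radius n *\<^sub>R \<zeta>))"
        by (rule integral_Re[OF mv(1)])
      also have "\<dots> = ln (norm (F 0))"
        unfolding mv(2) by (rule lnG[symmetric]) simp
      finally show ?thesis .
    qed
    note V = sphere.L2_bounded_integral_limit[of "\<lambda>n \<zeta>. ln (norm (F (radius n *\<^sub>R \<zeta>)))" "\<lambda>\<zeta>. ln (norm (Fs \<zeta>))" "2 * C\<^sup>2 + 2 * K", OF _ _ ll i1 i2]
    have m1: "(\<lambda>\<zeta>. ln (norm (F (radius n *\<^sub>R \<zeta>)))) \<in> borel_measurable sphere_measure" for n by simp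
    have m2: "(\<lambda>\<zeta>. ln (norm (Fs \<zeta>))) \<in> borel_measurable sphere_measure" by simp
    have "(\<lambda>n. ln (norm (F 0))) \<longlonglongrightarrow> (LINT \<zeta>|sphere_measure. ln (norm (Fs \<zeta>)))"
      using V(3)[OF m1 m2] unfolding qm .
    then have "(LINT \<zeta>|sphere_measure. ln (norm (Fs \<zeta>))) = ln (norm (F 0))"
      by (simp add: LIMSEQ_const_iff)
    then show ?thesis using V(2)[OF m1 m2] by blast
  qed
  show ?thesis
    using that[OF F Fm FB Fnz Fsm Flim Fs0 w] Q lnF by blast
qed

section \<open>Verblunsky coefficients and distances in \<open>L\<^sup>2(\<mu>)\<close>\<close>

text \<open>Elimination of one index at a time. The pivot is a Schur complement and equals the
  quadratic form at a nonzero vector, hence does not vanish. The hypothesis speaks of all finite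
  subsets of \<open>S\<close>, so it passes to the smaller index set.\<close>

lemma positive_definite_solvable:
  fixes M :: "'i \<Rightarrow> 'i \<Rightarrow> complex"
  assumes pd: "\<And>T c. finite T \<Longrightarrow> T \<subseteq> S \<Longrightarrow> \<exists>i\<in>T. c i \<noteq> 0 \<Longrightarrow> (\<Sum>i\<in>T. \<Sum>j\<in>T. cnj (c i) * M i j * c j) \<noteq> 0"
    and "finite S"
  shows "\<exists>x. \<forall>i\<in>S. (\<Sum>j\<in>S. M i j * x j) = b i"
  using \<open>finite S\<close> pd
proof (induction S arbitrary: b rule: finite_induct)
  case (insert s S)
  have pdS: "(\<Sum>i\<in>T. \<Sum>j\<in>T. cnj (c i) * M i j * c j) \<noteq> 0" if "finite T" "T \<subseteq> S" "\<exists>i\<in>T. c i \<noteq> 0" for T c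
    using insert.prems[OF that(1) _ that(3)] that(2) by auto
  obtain y where y: "\<And>i. i \<in> S \<Longrightarrow> (\<Sum>j\<in>S. M i j * y j) = b i"
    using insert.IH[OF pdS] by metis
  obtain z where z: "\<And>i. i \<in> S \<Longrightarrow> (\<Sum>j\<in>S. M i j * z j) = M i s"
    using insert.IH[OF pdS, of "\<lambda>i. M i s"] by metis
  \<comment> \<open>The Schur complement of the entry at \<open>s\<close>; the vector
    \<open>c\<close> below is annihilated by all rows in \<open>S\<close>, so the quadratic form at
    \<open>c\<close> reduces to \<open>d\<close>.\<close>
  define d where "d = M s s - (\<Sum>j\<in>S. M s j * z j)"
  define c where "c = (\<lambda>i. if i = s then 1 else - z i)"
  have sumc: "(\<Sum>j\<in>insert s S. M i j * c j) = M i s - (\<Sum>j\<in>S. M i j * z j)" for i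
  proof -
    have "(\<Sum>j\<in>S. M i j * c j) = (\<Sum>j\<in>S. - (M i j * z j))"
      using insert.hyps by (intro sum.cong) (auto simp: c_def)
    then show ?thesis using insert.hyps by (simp add: c_def sum_negf)
  qed
  have "(\<Sum>i\<in>insert s S. \<Sum>j\<in>insert s S. cnj (c i) * M i j * c j)
      = (\<Sum>i\<in>insert s S. cnj (c i) * (\<Sum>j\<in>insert s S. M i j * c j))"
    by (simp add: sum_distrib_left mult.assoc)
  also have "\<dots> = cnj (c s) * (\<Sum>j\<in>insert s S. M s j * c j) + (\<Sum>i\<in>S. cnj (c i) * (\<Sum>j\<in>insert s S. M i j * c j))"
    using insert.hyps by simp
  also have "(\<Sum>i\<in>S. cnj (c i) * (\<Sum>j\<in>insert s S. M i j * c j)) = 0"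
    unfolding sumc using z by (intro sum.neutral) simp
  also have "cnj (c s) * (\<Sum>j\<in>insert s S. M s j * c j) + 0 = d"
    unfolding sumc by (simp add: c_def d_def)
  finally have "d \<noteq> 0"
    using insert.prems[of "insert s S" c] insert.hyps by (auto simp: c_def)
  define t where "t = (b s - (\<Sum>j\<in>S. M s j * y j)) / d"
  have td: "t * d = b s - (\<Sum>j\<in>S. M s j * y j)" using \<open>d \<noteq> 0\<close> by (simp add: t_def)
  define x where "x = (\<lambda>j. if j = s then t else y j - t * z j)"
  have sumx: "(\<Sum>j\<in>insert s S. M i j * x j) = t * M i s + (\<Sum>j\<in>S. M i j * y j) - t * (\<Sum>j\<in>S. M i j * z j)" for i
  proof -
    have "(\<Sum>j\<in>S. M i j * x j) = (\<Sum>j\<in>S. M i j * y j - t * (M i j * z j))"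
      using insert.hyps by (intro sum.cong) (auto simp: x_def algebra_simps)
    then show ?thesis using insert.hyps by (simp add: x_def sum_subtractf sum_distrib_left)
  qed
  have "(\<Sum>j\<in>insert s S. M i j * x j) = b i" if "i \<in> insert s S" for i
  proof (cases "i = s")
    case True
    have "t * M s s - t * (\<Sum>j\<in>S. M s j * z j) = t * d" by (simp add: d_def algebra_simps)
    then show ?thesis unfolding sumx True td by (simp add: algebra_simps)
  next
    case False
    then have "i \<in> S" using that by simp
    then show ?thesis unfolding sumx using y z by simp
  qed
  then show ?case by blast
qed simp

text \<open>Solvability column by column gives a right inverse. As \<open>M\<close> is Hermitian,
  the adjoint of a right inverse is a left inverse, and the two coincide; this gives both existence
  and uniqueness for the definite description.\<close>

lemma matrix_inverse_on:
  fixes M :: "'i \<Rightarrow> 'i \<Rightarrow> complex"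
  assumes pd: "\<And>T c. finite T \<Longrightarrow> T \<subseteq> S \<Longrightarrow> \<exists>i\<in>T. c i \<noteq> 0 \<Longrightarrow> (\<Sum>i\<in>T. \<Sum>j\<in>T. cnj (c i) * M i j * c j) \<noteq> 0"
    and S: "finite S" and herm: "\<And>i j. M j i = cnj (M i j)"
  shows "i \<in> S \<Longrightarrow> j \<in> S \<Longrightarrow> (\<Sum>k\<in>S. matrix_inverse_on S M i k * M k j) = (if i = j then 1 else 0)"
proof -
  define P where "P = (\<lambda>N. (\<forall>i j. i \<notin> S \<or> j \<notin> S \<longrightarrow> N i j = (0::complex)) \<and>
     (\<forall>i\<in>S. \<forall>j\<in>S. (\<Sum>k\<in>S. M i k * N k j) = (if i = j then 1 else 0)) \<and>
     (\<forall>i\<in>S. \<forall>j\<in>S. (\<Sum>k\<in>S. N i k * M k j) = (if i = j then 1 else 0)))"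
  have assoc: "(\<Sum>k\<in>S. A i k * (\<Sum>l\<in>S. B k l * C l j)) = (\<Sum>l\<in>S. (\<Sum>k\<in>S. A i k * B k l) * C l j)"
    for A B C :: "'i \<Rightarrow> 'i \<Rightarrow> complex" and i j
  proof -
    have "(\<Sum>k\<in>S. A i k * (\<Sum>l\<in>S. B k l * C l j)) = (\<Sum>k\<in>S. \<Sum>l\<in>S. A i k * B k l * C l j)"
      by (simp add: sum_distrib_left mult.assoc)
    also have "\<dots> = (\<Sum>l\<in>S. \<Sum>k\<in>S. A i k * B k l * C l j)" by (rule sum.swap)
    finally show ?thesis by (simp add: sum_distrib_right)
  qed
  have inv_eq: "A i j = B i j" if "i \<in> S" "j \<in> S"
    and l: "\<And>i j. i \<in> S \<Longrightarrow> j \<in> S \<Longrightarrow> (\<Sum>k\<in>S. A i k * M k j) = (if i = j then 1 else 0)"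
    and r: "\<And>i j. i \<in> S \<Longrightarrow> j \<in> S \<Longrightarrow> (\<Sum>k\<in>S. M i k * B k j) = (if i = j then 1 else 0)"
    for A B :: "'i \<Rightarrow> 'i \<Rightarrow> complex" and i j
  proof -
    have "A i j = (\<Sum>k\<in>S. A i k * (if k = j then 1 else 0))"
      using that(2) S by (simp add: if_distrib cong: if_cong)
    also have "\<dots> = (\<Sum>k\<in>S. A i k * (\<Sum>l\<in>S. M k l * B l j))"
      using r that by (intro sum.cong) auto
    also have "\<dots> = (\<Sum>l\<in>S. (\<Sum>k\<in>S. A i k * M k l) * B l j)" by (rule assoc)
    also have "\<dots> = (\<Sum>l\<in>S. (if i = l then 1 else 0) * B l j)"
      using l that by (intro sum.cong) auto
    also have "\<dots> = B i j"
      using that(1) S by (simp add: if_distrib[of "\<lambda>a. a * _"] cong: if_cong)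
    finally show ?thesis .
  qed
  have "\<exists>x. \<forall>i\<in>S. (\<Sum>k\<in>S. M i k * x k) = (if i = j then 1 else 0)" for j
    using positive_definite_solvable[OF pd S, of "\<lambda>i. if i = j then 1 else 0"] by blast
  then obtain X where X: "\<And>i j. i \<in> S \<Longrightarrow> (\<Sum>k\<in>S. M i k * X j k) = (if i = j then 1 else 0)" by metis
  define N where "N = (\<lambda>i j. if i \<in> S \<and> j \<in> S then X j i else 0)"
  have right: "(\<Sum>k\<in>S. M i k * N k j) = (if i = j then 1 else 0)" if "i \<in> S" "j \<in> S" for i j
  proof -
    have "(\<Sum>k\<in>S. M i k * N k j) = (\<Sum>k\<in>S. M i k * X j k)"
      using that by (intro sum.cong) (auto simp: N_def)
    then show ?thesis using X[OF that(1)] by simp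
  qed
  have left': "(\<Sum>k\<in>S. cnj (N k i) * M k j) = (if i = j then 1 else 0)" if "i \<in> S" "j \<in> S" for i j
  proof -
    have "(\<Sum>k\<in>S. cnj (N k i) * M k j) = cnj (\<Sum>k\<in>S. M j k * N k i)"
      unfolding cnj_sum by (intro sum.cong refl) (subst herm, simp)
    then show ?thesis using right[OF that(2,1)] by auto
  qed
  have NN: "cnj (N j i) = N i j" if "i \<in> S" "j \<in> S" for i j
    by (rule inv_eq[of i j "\<lambda>i j. cnj (N j i)" N, OF that left' right])
  have left: "(\<Sum>k\<in>S. N i k * M k j) = (if i = j then 1 else 0)" if "i \<in> S" "j \<in> S" for i j
  proof -
    have "(\<Sum>k\<in>S. N i k * M k j) = (\<Sum>k\<in>S. cnj (N k i) * M k j)"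
      using that NN by (intro sum.cong) auto
    then show ?thesis using left'[OF that] by simp
  qed
  have "P N" unfolding P_def using right left by (auto simp: N_def)
  moreover have "N' = N" if "P N'" for N'
  proof (intro ext)
    fix i j
    show "N' i j = N i j"
    proof (cases "i \<in> S \<and> j \<in> S")
      case True
      show ?thesis
        by (rule inv_eq) (use True that right in \<open>auto simp: P_def\<close>)
    next
      case False
      then show ?thesis using that by (auto simp: P_def N_def)
    qed
  qed
  ultimately have "P (THE N. P N)" by (rule theI)
  then have "P (matrix_inverse_on S M)"
    unfolding matrix_inverse_on_def P_def .
  then show "i \<in> S \<Longrightarrow> j \<in> S \<Longrightarrow> (\<Sum>k\<in>S. matrix_inverse_on S M i k * M k j) = (if i = j then 1 else 0)"
    by (simp add: P_def)
qed

section \<open>Orthogonal residuals of monomials\<close>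

definition ipm :: "(complex ^ 'n::finite) measure \<Rightarrow> (complex ^ 'n \<Rightarrow> complex) \<Rightarrow> (complex ^ 'n \<Rightarrow> complex) \<Rightarrow> complex" where
  "ipm \<mu> f g = (LINT \<zeta>|\<mu>. f \<zeta> * cnj (g \<zeta>))"

text \<open>The component of the monomial orthogonal to the monomials indexed by \<open>S\<close>.
  As a predicate it covers both the residual built from the inverse Gram matrix and the one built by
  a Gram--Schmidt step; \<open>residual_norm_unique\<close> makes them interchangeable.\<close>

definition is_residual ::
  "(complex ^ 'n::finite) measure \<Rightarrow> nat ^ 'n \<Rightarrow> (nat ^ 'n) set \<Rightarrow> (complex ^ 'n \<Rightarrow> complex) \<Rightarrow> bool" where
  "is_residual \<mu> \<alpha> S f \<longleftrightarrow> (\<exists>x. f = (\<lambda>\<zeta>. mmonom \<alpha> \<zeta> - (\<Sum>j\<in>S. x j * mmonom j \<zeta>))) \<and>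
     (\<forall>\<delta>\<in>S. ipm \<mu> f (mmonom \<delta>) = 0)"

locale finite_sphere_measure =
  fixes \<mu> :: "(complex ^ 'n::finite) measure"
  assumes sets_eq: "sets \<mu> = sets borel" and fin: "finite_measure \<mu>"
    and on_sphere: "AE \<zeta> in \<mu>. \<zeta> \<in> sphere 0 1"
begin

lemma integrable_continuous:
  fixes f :: "complex ^ 'n \<Rightarrow> 'b::{banach, second_countable_topology}"
  assumes f: "continuous_on UNIV f" shows "integrable \<mu> f"
proof -
  obtain B where B: "\<And>z. norm z = 1 \<Longrightarrow> norm (f z) \<le> B"
    using continuous_bounded_on_sphere[OF f] by blast
  show ?thesis
  proof (rule finite_measure.integrable_const_bound[OF fin, where B = B])
    show "AE x in \<mu>. norm (f x) \<le> B" using on_sphere by eventually_elim (simp add: B)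
    show "f \<in> borel_measurable \<mu>"
      using borel_measurable_continuous_onI[OF f] measurable_cong_sets[OF sets_eq refl] by auto
  qed
qed

end

locale nondegenerate_sphere_measure = finite_sphere_measure +
  assumes nondeg: "\<And>A c. finite A \<Longrightarrow> \<exists>\<alpha>\<in>A. c \<alpha> \<noteq> 0 \<Longrightarrow> (LINT \<zeta>|\<mu>. (norm (\<Sum>\<alpha>\<in>A. c \<alpha> * mmonom \<alpha> \<zeta>))\<^sup>2) > 0"
begin

lemma integrable_ipm: "polyfun f \<Longrightarrow> polyfun g \<Longrightarrow> integrable \<mu> (\<lambda>\<zeta>. f \<zeta> * cnj (g \<zeta>))"
  by (intro integrable_continuous continuous_on_mult continuous_on_cnj continuous_on_polyfun)

lemma ipm_monom: "ipm \<mu> (mmonom \<alpha>) (mmonom \<beta>) = moment \<mu> \<alpha> \<beta>"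
  by (simp add: ipm_def moment_def)

lemma ipm_cnj: "ipm \<mu> g f = cnj (ipm \<mu> f g)"
proof -
  have "ipm \<mu> g f = (LINT \<zeta>|\<mu>. cnj (f \<zeta> * cnj (g \<zeta>)))"
    unfolding ipm_def by (intro Bochner_Integration.integral_cong refl) (simp add: mult.commute)
  then show ?thesis
    unfolding ipm_def by (simp only: Bochner_Integration.integral_cnj)
qed

lemma ipm_diff_left:
  assumes "polyfun f" "polyfun g" "polyfun h"
  shows "ipm \<mu> (\<lambda>\<zeta>. f \<zeta> - g \<zeta>) h = ipm \<mu> f h - ipm \<mu> g h"
  using integrable_ipm[OF assms(1,3)] integrable_ipm[OF assms(2,3)]
  by (simp add: ipm_def left_diff_distrib)

lemma ipm_cmult_left: "ipm \<mu> (\<lambda>\<zeta>. c * f \<zeta>) h = c * ipm \<mu> f h"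
  by (simp add: ipm_def mult.assoc)

lemma ipm_sum_left:
  assumes "\<And>j. j \<in> S \<Longrightarrow> polyfun (f j)" "polyfun h"
  shows "ipm \<mu> (\<lambda>\<zeta>. \<Sum>j\<in>S. f j \<zeta>) h = (\<Sum>j\<in>S. ipm \<mu> (f j) h)"
  unfolding ipm_def sum_distrib_right
  by (intro Bochner_Integration.integral_sum integrable_ipm assms)

lemma ipm_diff_right:
  assumes "polyfun f" "polyfun g" "polyfun h"
  shows "ipm \<mu> h (\<lambda>\<zeta>. f \<zeta> - g \<zeta>) = ipm \<mu> h f - ipm \<mu> h g"
  unfolding ipm_cnj[of h] ipm_diff_left[OF assms] by simp

lemma ipm_cmult_right: "ipm \<mu> h (\<lambda>\<zeta>. c * f \<zeta>) = cnj c * ipm \<mu> h f"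
  unfolding ipm_cnj[of h] ipm_cmult_left by simp

lemma ipm_sum_right:
  assumes "\<And>j. j \<in> S \<Longrightarrow> polyfun (f j)" "polyfun h"
  shows "ipm \<mu> h (\<lambda>\<zeta>. \<Sum>j\<in>S. f j \<zeta>) = (\<Sum>j\<in>S. ipm \<mu> h (f j))"
proof -
  have "cnj (ipm \<mu> (\<lambda>\<zeta>. \<Sum>j\<in>S. f j \<zeta>) h) = cnj (\<Sum>j\<in>S. ipm \<mu> (f j) h)"
    using ipm_sum_left[of S f h] assms by simp
  then show ?thesis
    unfolding cnj_sum ipm_cnj[of h] .
qed

lemma ipm_self: "ipm \<mu> f f = of_real (LINT \<zeta>|\<mu>. (norm (f \<zeta>))\<^sup>2)"
  unfolding ipm_def complex_norm_square[symmetric] by (rule integral_complex_of_real)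

lemma polyfun_residual: "polyfun (\<lambda>\<zeta>. mmonom \<alpha> \<zeta> - (\<Sum>j\<in>S. x j * mmonom j \<zeta>))"
  by (intro polyfun_diff polyfun.monom polyfun_sum polyfun.cmult)

lemma is_residual_polyfun: "is_residual \<mu> \<alpha> S f \<Longrightarrow> polyfun f"
  using polyfun_residual by (auto simp: is_residual_def)

text \<open>A function orthogonal to the monomials in \<open>S\<close> does not see the correction
  terms of a residual.\<close>

lemma ipm_residual_right:
  assumes h: "polyfun h" "\<And>\<delta>. \<delta> \<in> S \<Longrightarrow> ipm \<mu> h (mmonom \<delta>) = 0"
  shows "ipm \<mu> h (\<lambda>\<zeta>. mmonom \<alpha> \<zeta> - (\<Sum>j\<in>S. x j * mmonom j \<zeta>)) = ipm \<mu> h (mmonom \<alpha>)"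
proof -
  have "ipm \<mu> h (\<lambda>\<zeta>. \<Sum>j\<in>S. x j * mmonom j \<zeta>) = (\<Sum>j\<in>S. cnj (x j) * ipm \<mu> h (mmonom j))"
    by (subst ipm_sum_right) (auto intro: polyfun.intros h simp: ipm_cmult_right)
  also have "\<dots> = 0" using h by (intro sum.neutral) auto
  finally show ?thesis
    by (subst ipm_diff_right) (auto intro!: polyfun.intros polyfun_sum h)
qed

lemma residual_norm_unique:
  assumes f: "is_residual \<mu> \<alpha> S f" and f': "is_residual \<mu> \<alpha> S f'"
  shows "ipm \<mu> f f = ipm \<mu> f' f'"
proof -
  have r: "ipm \<mu> h k = ipm \<mu> h (mmonom \<alpha>)" if "is_residual \<mu> \<alpha> S h" "is_residual \<mu> \<alpha> S k" for h k
    using that ipm_residual_right[OF is_residual_polyfun[OF that(1)]] unfolding is_residual_def by auto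
  have "ipm \<mu> f f = ipm \<mu> f f'" using r[OF f f] r[OF f f'] by simp
  also have "\<dots> = cnj (ipm \<mu> f' f)" by (rule ipm_cnj)
  also have "ipm \<mu> f' f = ipm \<mu> f' f'" using r[OF f' f] r[OF f' f'] by simp
  also have "cnj (ipm \<mu> f' f') = ipm \<mu> f' f'" by (rule ipm_cnj[symmetric])
  finally show ?thesis .
qed

text \<open>Pythagoras: the difference of the competitor and the residual lies in the span of the
  monomials in \<open>S\<close>, to which the residual is orthogonal.\<close>

lemma residual_minimal:
  assumes f: "is_residual \<mu> \<alpha> S f"
  shows "(LINT \<zeta>|\<mu>. (norm (f \<zeta>))\<^sup>2) \<le> (LINT \<zeta>|\<mu>. (norm (mmonom \<alpha> \<zeta> - (\<Sum>j\<in>S. c j * mmonom j \<zeta>)))\<^sup>2)"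
proof -
  define q where "q = (\<lambda>\<zeta>. mmonom \<alpha> \<zeta> - (\<Sum>j\<in>S. c j * mmonom j \<zeta>))"
  have pq: "polyfun q" unfolding q_def by (rule polyfun_residual)
  have pf: "polyfun f" by (rule is_residual_polyfun[OF f])
  have fq: "ipm \<mu> f q = ipm \<mu> f f"
    using f ipm_residual_right[OF pf] unfolding is_residual_def q_def by auto
  then have qf: "ipm \<mu> q f = ipm \<mu> f f"
    by (subst ipm_cnj) (simp add: ipm_self)
  have "ipm \<mu> (\<lambda>\<zeta>. q \<zeta> - f \<zeta>) (\<lambda>\<zeta>. q \<zeta> - f \<zeta>) = ipm \<mu> q q - ipm \<mu> f f"
    by (simp add: ipm_diff_left ipm_diff_right pq pf polyfun_diff fq qf)
  then have "complex_of_real (LINT \<zeta>|\<mu>. (norm (q \<zeta> - f \<zeta>))\<^sup>2) = of_real ((LINT \<zeta>|\<mu>. (norm (q \<zeta>))\<^sup>2) - (LINT \<zeta>|\<mu>. (norm (f \<zeta>))\<^sup>2))"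
    by (simp add: ipm_self)
  then have "(LINT \<zeta>|\<mu>. (norm (q \<zeta> - f \<zeta>))\<^sup>2) = (LINT \<zeta>|\<mu>. (norm (q \<zeta>))\<^sup>2) - (LINT \<zeta>|\<mu>. (norm (f \<zeta>))\<^sup>2)"
    unfolding of_real_eq_iff .
  moreover have "(LINT \<zeta>|\<mu>. (norm (q \<zeta> - f \<zeta>))\<^sup>2) \<ge> 0" by simp
  ultimately show ?thesis unfolding q_def by linarith
qed

lemma residual_pos:
  assumes f: "is_residual \<mu> \<alpha> S f" and "finite S" "\<alpha> \<notin> S"
  shows "(LINT \<zeta>|\<mu>. (norm (f \<zeta>))\<^sup>2) > 0"
proof -
  obtain x where x: "f = (\<lambda>\<zeta>. mmonom \<alpha> \<zeta> - (\<Sum>j\<in>S. x j * mmonom j \<zeta>))"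
    using f by (auto simp: is_residual_def)
  define c where "c = (\<lambda>j. if j = \<alpha> then 1 else - x j)"
  have "f \<zeta> = (\<Sum>j\<in>insert \<alpha> S. c j * mmonom j \<zeta>)" for \<zeta>
  proof -
    have "(\<Sum>j\<in>S. c j * mmonom j \<zeta>) = (\<Sum>j\<in>S. - (x j * mmonom j \<zeta>))"
      using assms(3) by (intro sum.cong) (auto simp: c_def)
    then show ?thesis using assms(2,3) by (simp add: x c_def sum_negf)
  qed
  then show ?thesis
    using nondeg[of "insert \<alpha> S" c] assms(2) by (auto simp: c_def)
qed

lemma moment_hermitian: "moment \<mu> \<beta> \<alpha> = cnj (moment \<mu> \<alpha> \<beta>)"
  unfolding ipm_monom[symmetric] by (rule ipm_cnj)

lemma moment_positive_definite:
  assumes "finite T" "\<exists>i\<in>T. c i \<noteq> 0"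
  shows "(\<Sum>i\<in>T. \<Sum>j\<in>T. cnj (c i) * moment \<mu> i j * c j) \<noteq> 0"
proof -
  \<comment> \<open>The coefficients are conjugated because the moment matrix is conjugate linear in
    its second index.\<close>
  define f where "f = (\<lambda>\<zeta>. \<Sum>i\<in>T. cnj (c i) * mmonom i \<zeta>)"
  have pf: "polyfun f" unfolding f_def by (intro polyfun_sum polyfun.intros)
  have "ipm \<mu> f f = (\<Sum>i\<in>T. cnj (c i) * ipm \<mu> (mmonom i) f)"
    by (subst (1) f_def, subst ipm_sum_left) (auto intro: polyfun.intros pf simp: ipm_cmult_left)
  also have "\<dots> = (\<Sum>i\<in>T. \<Sum>j\<in>T. cnj (c i) * moment \<mu> i j * c j)"
  proof (rule sum.cong[OF refl])
    fix i
    have "ipm \<mu> (mmonom i) f = (\<Sum>j\<in>T. c j * moment \<mu> i j)"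
      unfolding f_def by (subst ipm_sum_right) (auto intro: polyfun.intros simp: ipm_cmult_right ipm_monom)
    then show "cnj (c i) * ipm \<mu> (mmonom i) f = (\<Sum>j\<in>T. cnj (c i) * moment \<mu> i j * c j)"
      by (simp add: sum_distrib_left mult_ac)
  qed
  finally have "(\<Sum>i\<in>T. \<Sum>j\<in>T. cnj (c i) * moment \<mu> i j * c j) = of_real (LINT \<zeta>|\<mu>. (norm (f \<zeta>))\<^sup>2)"
    by (simp add: ipm_self)
  moreover have "(LINT \<zeta>|\<mu>. (norm (f \<zeta>))\<^sup>2) > 0"
    unfolding f_def using assms by (intro nondeg) auto
  ultimately show ?thesis by simp
qed

text \<open>The coefficients are the row of moments times the inverse matrix, that is, the solution
  of the normal equations. Pairing this residual with an arbitrary monomial reproduces the Schur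
  complement expressions in the definition of the Verblunsky coefficients.\<close>

lemma residual_exists:
  assumes S: "finite S"
  obtains f where "is_residual \<mu> \<alpha> S f"
    "\<And>\<beta>. ipm \<mu> f (mmonom \<beta>) = moment \<mu> \<alpha> \<beta> - inv_form S (moment \<mu>) (moment \<mu> \<alpha>) (\<lambda>\<delta>. moment \<mu> \<delta> \<beta>)"
proof -
  define N where "N = matrix_inverse_on S (moment \<mu>)"
  define x where "x = (\<lambda>j. \<Sum>i\<in>S. moment \<mu> \<alpha> i * N i j)"
  define f where "f = (\<lambda>\<zeta>. mmonom \<alpha> \<zeta> - (\<Sum>j\<in>S. x j * mmonom j \<zeta>))"
  have N: "(\<Sum>k\<in>S. N i k * moment \<mu> k j) = (if i = j then 1 else 0)" if "i \<in> S" "j \<in> S" for i j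
    unfolding N_def by (rule matrix_inverse_on[OF _ S moment_hermitian that]) (rule moment_positive_definite)
  have ip: "ipm \<mu> f (mmonom \<beta>) = moment \<mu> \<alpha> \<beta> - (\<Sum>j\<in>S. x j * moment \<mu> j \<beta>)" for \<beta>
  proof -
    have "ipm \<mu> (\<lambda>\<zeta>. \<Sum>j\<in>S. x j * mmonom j \<zeta>) (mmonom \<beta>) = (\<Sum>j\<in>S. x j * moment \<mu> j \<beta>)"
      by (subst ipm_sum_left) (auto intro: polyfun.intros simp: ipm_cmult_left ipm_monom)
    then show ?thesis
      unfolding f_def by (subst ipm_diff_left) (auto intro!: polyfun.intros polyfun_sum simp: ipm_monom)
  qed
  have sw: "(\<Sum>j\<in>S. x j * h j) = (\<Sum>i\<in>S. moment \<mu> \<alpha> i * (\<Sum>j\<in>S. N i j * h j))" for h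
  proof -
    have "(\<Sum>j\<in>S. x j * h j) = (\<Sum>j\<in>S. \<Sum>i\<in>S. moment \<mu> \<alpha> i * N i j * h j)"
      by (simp add: x_def sum_distrib_right)
    also have "\<dots> = (\<Sum>i\<in>S. \<Sum>j\<in>S. moment \<mu> \<alpha> i * N i j * h j)" by (rule sum.swap)
    finally show ?thesis by (simp add: sum_distrib_left mult.assoc)
  qed
  show ?thesis
  proof (rule that)
    have "ipm \<mu> f (mmonom \<delta>) = 0" if "\<delta> \<in> S" for \<delta>
    proof -
      have "(\<Sum>j\<in>S. x j * moment \<mu> j \<delta>) = (\<Sum>i\<in>S. moment \<mu> \<alpha> i * (if i = \<delta> then 1 else 0))"
        unfolding sw using N that by (intro sum.cong) auto
      also have "\<dots> = moment \<mu> \<alpha> \<delta>" using that S by (simp add: if_distrib cong: if_cong)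
      finally show ?thesis by (simp add: ip)
    qed
    then show "is_residual \<mu> \<alpha> S f" unfolding is_residual_def by (auto simp: f_def)
    show "ipm \<mu> f (mmonom \<beta>) = moment \<mu> \<alpha> \<beta> - inv_form S (moment \<mu>) (moment \<mu> \<alpha>) (\<lambda>\<delta>. moment \<mu> \<delta> \<beta>)" for \<beta>
      unfolding ip sw by (simp add: inv_form_def N_def sum_distrib_left mult.assoc)
  qed
qed

lemma residual_self:
  assumes "is_residual \<mu> \<alpha> S f" shows "ipm \<mu> f f = ipm \<mu> f (mmonom \<alpha>)"
  using assms ipm_residual_right[OF is_residual_polyfun[OF assms]] unfolding is_residual_def by auto

text \<open>One Gram--Schmidt step: \<open>f\<close> is corrected by its projection onto the
  residual \<open>h\<close> of the new monomial, and the squared norm drops by that of the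
  projection.\<close>

lemma residual_insert:
  assumes f: "is_residual \<mu> \<alpha> S f" and h: "is_residual \<mu> \<beta> S h" and S: "finite S" "\<beta> \<notin> S" and "\<alpha> \<notin> S"
  obtains f' where "is_residual \<mu> \<alpha> (insert \<beta> S) f'"
    "(LINT \<zeta>|\<mu>. (norm (f' \<zeta>))\<^sup>2) = (LINT \<zeta>|\<mu>. (norm (f \<zeta>))\<^sup>2) - (norm (ipm \<mu> f (mmonom \<beta>)))\<^sup>2 / (LINT \<zeta>|\<mu>. (norm (h \<zeta>))\<^sup>2)"
proof -
  define E where "E = (LINT \<zeta>|\<mu>. (norm (h \<zeta>))\<^sup>2)"
  define G where "G = ipm \<mu> f (mmonom \<beta>)"
  define t where "t = G / of_real E"
  have E: "E > 0" unfolding E_def by (rule residual_pos[OF h S])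
  have pf: "polyfun f" and ph: "polyfun h" using f h is_residual_polyfun by auto
  obtain x where x: "f = (\<lambda>\<zeta>. mmonom \<alpha> \<zeta> - (\<Sum>j\<in>S. x j * mmonom j \<zeta>))" and fo: "\<And>\<delta>. \<delta> \<in> S \<Longrightarrow> ipm \<mu> f (mmonom \<delta>) = 0"
    using f by (auto simp: is_residual_def)
  obtain y where y: "h = (\<lambda>\<zeta>. mmonom \<beta> \<zeta> - (\<Sum>j\<in>S. y j * mmonom j \<zeta>))" and ho: "\<And>\<delta>. \<delta> \<in> S \<Longrightarrow> ipm \<mu> h (mmonom \<delta>) = 0"
    using h by (auto simp: is_residual_def)
  define f' where "f' = (\<lambda>\<zeta>. f \<zeta> - t * h \<zeta>)"
  have ip': "ipm \<mu> f' k = ipm \<mu> f k - t * ipm \<mu> h k" if "polyfun k" for k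
    unfolding f'_def by (simp add: ipm_diff_left ipm_cmult_left pf ph polyfun.cmult that)
  have hh: "ipm \<mu> h (mmonom \<beta>) = of_real E"
    using residual_self[OF h] by (simp add: ipm_self E_def)
  have fh: "ipm \<mu> f h = G"
    unfolding G_def y by (rule ipm_residual_right[OF pf fo])
  have hf: "ipm \<mu> h f = ipm \<mu> h (mmonom \<alpha>)"
    unfolding x by (rule ipm_residual_right[OF ph ho])
  have res: "is_residual \<mu> \<alpha> (insert \<beta> S) f'"
    unfolding is_residual_def
  proof
    define z where "z = (\<lambda>j. if j = \<beta> then t else x j - t * y j)"
    have "f' \<zeta> = mmonom \<alpha> \<zeta> - (\<Sum>j\<in>insert \<beta> S. z j * mmonom j \<zeta>)" for \<zeta>
    proof -
      have "(\<Sum>j\<in>S. z j * mmonom j \<zeta>) = (\<Sum>j\<in>S. x j * mmonom j \<zeta> - t * (y j * mmonom j \<zeta>))"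
        using S(2) by (intro sum.cong) (auto simp: z_def algebra_simps)
      then show ?thesis
        using S by (simp add: f'_def x y z_def sum_subtractf sum_distrib_left algebra_simps)
    qed
    then show "\<exists>x. f' = (\<lambda>\<zeta>. mmonom \<alpha> \<zeta> - (\<Sum>j\<in>insert \<beta> S. x j * mmonom j \<zeta>))" by blast
    show "\<forall>\<delta>\<in>insert \<beta> S. ipm \<mu> f' (mmonom \<delta>) = 0"
      using fo ho E by (auto simp: ip' polyfun.monom hh G_def[symmetric] t_def)
  qed
  have "ipm \<mu> f' f' = ipm \<mu> f' (mmonom \<alpha>)" by (rule residual_self[OF res])
  also have "\<dots> = ipm \<mu> f f - t * ipm \<mu> h f"
    by (simp add: ip' polyfun.monom hf residual_self[OF f])
  also have "ipm \<mu> h f = cnj G" by (subst ipm_cnj) (simp add: fh)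
  also have "t * cnj G = of_real ((norm G)\<^sup>2 / E)"
    by (simp add: t_def complex_norm_square mult.commute del: of_real_power)
  finally have "complex_of_real (LINT \<zeta>|\<mu>. (norm (f' \<zeta>))\<^sup>2) = of_real ((LINT \<zeta>|\<mu>. (norm (f \<zeta>))\<^sup>2) - (norm G)\<^sup>2 / E)"
    by (simp add: ipm_self)
  then have "(LINT \<zeta>|\<mu>. (norm (f' \<zeta>))\<^sup>2) = (LINT \<zeta>|\<mu>. (norm (f \<zeta>))\<^sup>2) - (norm G)\<^sup>2 / E"
    unfolding of_real_eq_iff .
  then show ?thesis using that[OF res] by (simp add: G_def E_def)
qed

end

section \<open>Verblunsky coefficients along the shortlex enumeration\<close>

lemma shortlex_zero_least: "\<not> \<alpha> \<prec>\<^sub>s 0"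
proof
  assume a: "\<alpha> \<prec>\<^sub>s 0"
  then have "mdeg \<alpha> = 0" by (auto simp: shortlex_def)
  then have "\<alpha> = 0" by (simp add: mdeg_eq_0_iff)
  then show False using a shortlex_irrefl by blast
qed

lemma shortlex_enum_0: "shortlex_enum 0 = (0 :: ('n::{finite,linorder}) mindex)"
proof (rule injD[OF inj_card_shortlex_below])
  show "card {\<delta>. \<delta> \<prec>\<^sub>s (shortlex_enum 0 :: 'n mindex)} = card {\<delta>. \<delta> \<prec>\<^sub>s (0 :: 'n mindex)}"
    by (simp add: card_below_shortlex_enum shortlex_zero_least)
qed

definition shortlex_between :: "nat \<Rightarrow> ('n::{finite,linorder}) mindex set" where
  "shortlex_between n = {\<delta>. 0 \<prec>\<^sub>s \<delta> \<and> \<delta> \<prec>\<^sub>s shortlex_enum n}"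

lemma shortlex_enum_less_iff: "(shortlex_enum i :: ('n::{finite,linorder}) mindex) \<prec>\<^sub>s shortlex_enum j \<longleftrightarrow> i < j"
  by (metis shortlex_enum_mono shortlex_irrefl shortlex_trans linorder_neqE_nat)

lemma shortlex_between_eq: "shortlex_between n = (shortlex_enum ` {1..<n} :: ('n::{finite,linorder}) mindex set)"
proof -
  have "\<delta> \<in> shortlex_between n \<longleftrightarrow> \<delta> \<in> shortlex_enum ` {1..<n}" for \<delta> :: "'n mindex"
  proof -
    obtain k where k: "\<delta> = shortlex_enum k"
      using bij_shortlex_enum[where 'n = 'n] by (metis bij_pointE)
    have "\<delta> \<in> shortlex_between n \<longleftrightarrow> 0 < k \<and> k < n"
      unfolding shortlex_between_def k shortlex_enum_0[symmetric] by (simp add: shortlex_enum_less_iff)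
    also have "\<dots> \<longleftrightarrow> \<delta> \<in> shortlex_enum ` {1..<n}"
      using bij_is_inj[OF bij_shortlex_enum[where 'n = 'n]] by (auto simp: k dest: injD)
    finally show ?thesis .
  qed
  then show ?thesis by blast
qed

lemma finite_shortlex_between: "finite (shortlex_between n)"
  by (simp add: shortlex_between_eq)

lemma zero_notin_shortlex_between: "0 \<notin> shortlex_between n"
  by (simp add: shortlex_between_def shortlex_irrefl)

text \<open>The Verblunsky coefficient is the correlation of the residuals of 1 and of the new monomial.\<close>

lemma verblunsky_product:
  fixes \<mu> :: "(('n::{finite,linorder}) cspace) measure"
  assumes nd: "nondegenerate_sphere_measure \<mu>" and prob: "prob_space \<mu>" and n: "n > 0"
  shows "\<exists>f. is_residual \<mu> 0 (shortlex_between n) f \<and>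
    (\<Prod>k<n. 1 - (norm (verblunsky \<mu> 0 (shortlex_enum k)))\<^sup>2) = (LINT \<zeta>|\<mu>. (norm (f \<zeta>))\<^sup>2)"
  using n
proof (induction n rule: nat_induct_non_zero)
  \<comment> \<open>The factor of index 0 is 1 because the diagonal coefficient is 0, so both sides
    are the total mass.\<close>
  case 1
  have "shortlex_between 1 = ({} :: 'n mindex set)" by (simp add: shortlex_between_eq)
  moreover have "verblunsky \<mu> 0 (shortlex_enum 0) = 0"
    by (simp add: shortlex_enum_0 verblunsky_def shortlex_irrefl)
  ultimately show ?case
    using prob_space.prob_space[OF prob] by (intro exI[of _ "mmonom 0"]) (auto simp: is_residual_def)
next
  case (Suc n)
  interpret nondegenerate_sphere_measure \<mu> by (rule nd)
  let ?S = "shortlex_between n :: 'n mindex set"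
  define \<beta> :: "'n mindex" where "\<beta> = shortlex_enum n"
  have S: "finite ?S" by (rule finite_shortlex_between)
  have \<beta>0: "0 \<prec>\<^sub>s \<beta>" unfolding \<beta>_def using Suc(1) shortlex_enum_0[where 'n = 'n] by (metis shortlex_enum_less_iff)
  have \<beta>S: "\<beta> \<notin> ?S" by (simp add: \<beta>_def shortlex_between_def shortlex_irrefl)
  have ins: "shortlex_between (Suc n) = insert \<beta> ?S"
    using Suc(1) by (auto simp: shortlex_between_eq \<beta>_def atLeastLessThanSuc)
  obtain f0 where f0: "is_residual \<mu> 0 ?S f0"
    and prod: "(\<Prod>k<n. 1 - (norm (verblunsky \<mu> 0 (shortlex_enum k)))\<^sup>2) = (LINT \<zeta>|\<mu>. (norm (f0 \<zeta>))\<^sup>2)"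
    using Suc.IH by blast
  obtain f where f: "is_residual \<mu> 0 ?S f"
    and fip: "\<And>\<beta>. ipm \<mu> f (mmonom \<beta>) = moment \<mu> 0 \<beta> - inv_form ?S (moment \<mu>) (moment \<mu> 0) (\<lambda>\<delta>. moment \<mu> \<delta> \<beta>)"
    using residual_exists[OF S] by blast
  obtain h where h: "is_residual \<mu> \<beta> ?S h"
    and hip: "\<And>\<beta>'. ipm \<mu> h (mmonom \<beta>') = moment \<mu> \<beta> \<beta>' - inv_form ?S (moment \<mu>) (moment \<mu> \<beta>) (\<lambda>\<delta>. moment \<mu> \<delta> \<beta>')"
    using residual_exists[OF S] by blast
  define D where "D = (LINT \<zeta>|\<mu>. (norm (f \<zeta>))\<^sup>2)"
  define E where "E = (LINT \<zeta>|\<mu>. (norm (h \<zeta>))\<^sup>2)"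
  define G where "G = ipm \<mu> f (mmonom \<beta>)"
  have D: "D > 0" unfolding D_def by (rule residual_pos[OF f S zero_notin_shortlex_between])
  have E: "E > 0" unfolding E_def by (rule residual_pos[OF h S \<beta>S])
  \<comment> \<open>The residual from the induction hypothesis need not be the one given by the
    inverse matrix, but their norms agree.\<close>
  have Df0: "D = (LINT \<zeta>|\<mu>. (norm (f0 \<zeta>))\<^sup>2)"
    using residual_norm_unique[OF f f0] unfolding ipm_self of_real_eq_iff D_def .
  have cn: "(\<lambda>\<delta>. cnj (moment \<mu> 0 \<delta>)) = (\<lambda>\<delta>. moment \<mu> \<delta> 0)" "(\<lambda>\<delta>. cnj (moment \<mu> \<delta> \<beta>)) = moment \<mu> \<beta>"
    by (auto simp: fun_eq_iff moment_hermitian[symmetric])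
  have ipD: "ipm \<mu> f (mmonom 0) = of_real D" using residual_self[OF f] by (simp add: ipm_self D_def)
  have ipE: "ipm \<mu> h (mmonom \<beta>) = of_real E" using residual_self[OF h] by (simp add: ipm_self E_def)
  have "verblunsky \<mu> 0 \<beta> = verblunsky_pre (moment \<mu>) 0 \<beta>"
    using \<beta>0 by (simp add: verblunsky_def)
  \<comment> \<open>Hermitian symmetry turns the conjugated row and column into columns and rows of
    moments, so both expressions under the square roots are squared norms of residuals.\<close>
  also have "\<dots> = G / complex_of_real (sqrt (Re (ipm \<mu> f (mmonom 0))) * sqrt (Re (ipm \<mu> h (mmonom \<beta>))))"
    unfolding verblunsky_pre_def Let_def G_def fip hip cn shortlex_between_def by (simp only: \<beta>_def)
  also have "\<dots> = G / complex_of_real (sqrt D * sqrt E)" by (simp add: ipD ipE)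
  finally have "norm (verblunsky \<mu> 0 \<beta>) = norm G / (sqrt D * sqrt E)"
    using D E by (simp add: norm_divide norm_mult abs_of_pos)
  then have \<gamma>: "(norm (verblunsky \<mu> 0 \<beta>))\<^sup>2 = (norm G)\<^sup>2 / (D * E)"
    using D E by (simp add: power_divide power_mult_distrib)
  obtain f' where f': "is_residual \<mu> 0 (insert \<beta> ?S) f'" "(LINT \<zeta>|\<mu>. (norm (f' \<zeta>))\<^sup>2) = D - (norm G)\<^sup>2 / E"
    using residual_insert[OF f h S \<beta>S zero_notin_shortlex_between] unfolding D_def E_def G_def by blast
  have "(\<Prod>k<Suc n. 1 - (norm (verblunsky \<mu> 0 (shortlex_enum k)))\<^sup>2) = D * (1 - (norm (verblunsky \<mu> 0 \<beta>))\<^sup>2)"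
    using prod Df0 by (simp add: \<beta>_def)
  also have "\<dots> = D - (norm G)\<^sup>2 / E"
    unfolding \<gamma> using D E by (simp add: field_simps)
  finally show ?case using f' unfolding ins by auto
qed

section \<open>The limit of the partial products\<close>

lemma nn_integral_add_measures:
  assumes M: "sets M1 = sets M" "sets M2 = sets M"
    and em: "\<And>A. A \<in> sets M \<Longrightarrow> emeasure M A = emeasure M1 A + emeasure M2 A"
    and f: "f \<in> borel_measurable M"
  shows "(\<integral>\<^sup>+x. f x \<partial>M) = (\<integral>\<^sup>+x. f x \<partial>M1) + (\<integral>\<^sup>+x. f x \<partial>M2)"
proof -
  have mM: "h \<in> borel_measurable M1" "h \<in> borel_measurable M2" if "h \<in> borel_measurable M" for h :: "'a \<Rightarrow> ennreal"
    using that by (simp_all only: measurable_cong_sets[OF M(1) refl] measurable_cong_sets[OF M(2) refl])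
  show ?thesis
    using f
  proof (induction rule: borel_measurable_induct)
    case (cong f g)
    have sp: "space M1 = space M" "space M2 = space M" using M sets_eq_imp_space_eq by blast+
    have "(\<integral>\<^sup>+x. f x \<partial>N) = (\<integral>\<^sup>+x. g x \<partial>N)" if "space N = space M" for N
      by (rule nn_integral_cong) (simp add: cong(3) that)
    then show ?case using cong(4) sp by metis
  next
    case (set A)
    then show ?case using em[of A] M by (simp only: nn_integral_indicator)
  next
    case (mult u c)
    have "u \<in> borel_measurable M1" "u \<in> borel_measurable M2"
      by (rule mM[OF \<open>u \<in> borel_measurable M\<close>])+
    then show ?case using \<open>u \<in> borel_measurable M\<close> mult.IH by (simp only: nn_integral_cmult distrib_left)
  next
    case (add u v)
    have "u \<in> borel_measurable M1" "u \<in> borel_measurable M2" "v \<in> borel_measurable M1" "v \<in> borel_measurable M2"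
      by (rule mM[OF \<open>u \<in> borel_measurable M\<close>] mM[OF \<open>v \<in> borel_measurable M\<close>])+
    then show ?case using \<open>u \<in> borel_measurable M\<close> \<open>v \<in> borel_measurable M\<close> add.IH by (simp only: nn_integral_add ac_simps)
  next
    case (seq U)
    have U: "U i \<in> borel_measurable M1" "U i \<in> borel_measurable M2" for i
      by (rule mM[OF \<open>U i \<in> borel_measurable M\<close>])+
    have inc: "incseq (\<lambda>i. \<integral>\<^sup>+x. U i x \<partial>N)" for N
      using \<open>incseq U\<close> by (auto simp: incseq_def le_fun_def intro!: nn_integral_mono)
    have "(\<integral>\<^sup>+x. (SUP i. U i) x \<partial>M) = (SUP i. \<integral>\<^sup>+x. U i x \<partial>M)"
      using nn_integral_monotone_convergence_SUP[OF \<open>incseq U\<close>, of M] seq by (simp add: image_comp)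
    also have "\<dots> = (SUP i. (\<integral>\<^sup>+x. U i x \<partial>M1) + (\<integral>\<^sup>+x. U i x \<partial>M2))"
      by (simp only: seq.IH)
    also have "\<dots> = (SUP i. \<integral>\<^sup>+x. U i x \<partial>M1) + (SUP i. \<integral>\<^sup>+x. U i x \<partial>M2)"
      by (rule ennreal_SUP_add[OF inc inc])
    also have "\<dots> = (\<integral>\<^sup>+x. (SUP i. U i) x \<partial>M1) + (\<integral>\<^sup>+x. (SUP i. U i) x \<partial>M2)"
      using nn_integral_monotone_convergence_SUP[OF \<open>incseq U\<close>, of M1] nn_integral_monotone_convergence_SUP[OF \<open>incseq U\<close>, of M2] U
      by (simp add: image_comp)
    finally show ?case .
  qed
qed

text \<open>The measure is the image under \<open>x\<close> of a weighted counting measure, for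
  which the integral is a series by definition.\<close>

lemma nn_integral_atoms:
  assumes sets: "sets \<nu> = sets borel"
    and em: "\<And>A. A \<in> sets borel \<Longrightarrow> emeasure \<nu> A = (\<Sum>k. ennreal (a k) * indicator A (x k))"
    and f: "f \<in> borel_measurable borel"
  shows "(\<integral>\<^sup>+z. f z \<partial>\<nu>) = (\<Sum>k::nat. ennreal (a k) * f (x k))"
proof -
  define N where "N = distr (density (count_space UNIV) (\<lambda>k. ennreal (a k))) borel x"
  have "(\<integral>\<^sup>+z. h z \<partial>N) = (\<Sum>k. ennreal (a k) * h (x k))" if "h \<in> borel_measurable borel" for h
    unfolding N_def using that by (simp add: nn_integral_distr nn_integral_density nn_integral_count_space_nat)
  note N = this
  have "\<nu> = N"
  proof (rule measure_eqI)
    show "sets \<nu> = sets N" by (simp add: sets N_def)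
    fix A assume "A \<in> sets \<nu>"
    then have A: "A \<in> sets borel" using sets by simp
    then have "emeasure N A = (\<integral>\<^sup>+z. indicator A z \<partial>N)" by (simp add: N_def)
    also have "\<dots> = (\<Sum>k. ennreal (a k) * indicator A (x k))" using A by (intro N) simp
    finally show "emeasure \<nu> A = emeasure N A" using em[OF A] by simp
  qed
  then show ?thesis using N[OF f] by simp
qed

text \<open>The variance is nonnegative.\<close>

lemma (in prob_space) norm_integral_squared_le:
  fixes h :: "'a \<Rightarrow> complex"
  assumes h: "integrable M h" and h2: "integrable M (\<lambda>x. (norm (h x))\<^sup>2)"
  shows "(norm (LINT x|M. h x))\<^sup>2 \<le> (LINT x|M. (norm (h x))\<^sup>2)"
proof -
  define a where "a = (LINT x|M. h x)"
  have e: "(norm (h x - a))\<^sup>2 = (norm (h x))\<^sup>2 - 2 * Re (cnj a * h x) + (norm a)\<^sup>2" for x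
    unfolding cmod_power2 by (simp add: power2_eq_square algebra_simps)
  have i: "integrable M (\<lambda>x. 2 * Re (cnj a * h x))"
    using h by (intro integrable_mult_right integrable_Re) auto
  have "0 \<le> (LINT x|M. (norm (h x - a))\<^sup>2)"
    by (rule Bochner_Integration.integral_nonneg) simp
  also have "\<dots> = (LINT x|M. (norm (h x))\<^sup>2) - (LINT x|M. 2 * Re (cnj a * h x)) + (norm a)\<^sup>2"
    unfolding e using h2 i by (simp add: prob_space)
  also have "(LINT x|M. 2 * Re (cnj a * h x)) = 2 * Re (LINT x|M. cnj a * h x)"
    using h by (simp only: integral_mult_right_zero) (simp add: integral_Re)
  also have "(LINT x|M. cnj a * h x) = cnj a * a" by (simp add: a_def)
  also have "Re (cnj a * a) = (norm a)\<^sup>2" unfolding cmod_power2 by (simp add: power2_eq_square)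
  finally show ?thesis by (simp add: a_def)
qed

lemma sphere_sqnorm_monomial_sum:
  assumes "finite A"
  shows "(LINT \<zeta>|sphere_measure. (norm (\<Sum>\<alpha>\<in>A. c \<alpha> * mmonom \<alpha> \<zeta>))\<^sup>2) = (\<Sum>\<alpha>\<in>A. (norm (c \<alpha>))\<^sup>2 * monom_sqnorm \<alpha>)"
proof -
  have "complex_of_real (LINT \<zeta>|sphere_measure. (norm (\<Sum>\<alpha>\<in>A. c \<alpha> * mmonom \<alpha> \<zeta>))\<^sup>2)
     = (LINT \<zeta>|sphere_measure. complex_of_real ((norm (\<Sum>\<alpha>\<in>A. c \<alpha> * mmonom \<alpha> \<zeta>))\<^sup>2))"
    by (rule integral_complex_of_real[symmetric])
  also have "\<dots> = (LINT \<zeta>|sphere_measure. (\<Sum>\<alpha>\<in>A. \<Sum>\<beta>\<in>A. c \<alpha> * cnj (c \<beta>) * (mmonom \<alpha> \<zeta> * cnj (mmonom \<beta> \<zeta>))))"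
    unfolding complex_norm_square cnj_sum sum_product
    by (intro Bochner_Integration.integral_cong sum.cong refl) simp
  also have "\<dots> = (\<Sum>\<alpha>\<in>A. \<Sum>\<beta>\<in>A. c \<alpha> * cnj (c \<beta>) * moment sphere_measure \<alpha> \<beta>)"
    unfolding moment_def by (subst Bochner_Integration.integral_sum) (auto simp: Bochner_Integration.integral_sum)
  also have "\<dots> = (\<Sum>\<alpha>\<in>A. c \<alpha> * cnj (c \<alpha>) * of_real (monom_sqnorm \<alpha>))"
    using assms by (intro sum.cong refl) (simp add: moment_sphere if_distrib cong: if_cong)
  also have "\<dots> = complex_of_real (\<Sum>\<alpha>\<in>A. (norm (c \<alpha>))\<^sup>2 * monom_sqnorm \<alpha>)"
    unfolding of_real_sum of_real_mult complex_norm_square ..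
  finally show ?thesis unfolding of_real_eq_iff .
qed

text \<open>The atoms come as a sequence padded with zero masses, so the points are constrained only
  where the mass is positive. The measure enters through the integral formula \<open>nn_mu\<close>,
  which hides the density and the series of atoms.\<close>

locale outer_weight_measure =
  fixes F Fs :: "complex ^ 'n::finite \<Rightarrow> complex" and B :: real and w :: "complex ^ 'n \<Rightarrow> real"
    and \<mu> :: "(complex ^ 'n) measure" and a :: "nat \<Rightarrow> real" and x :: "nat \<Rightarrow> complex ^ 'n"
  assumes F: "mv_holomorphic_on F (ball 0 1)" and F_meas: "F \<in> borel_measurable borel"
    and FB: "\<And>z. norm z < 1 \<Longrightarrow> norm (F z) \<le> B" and F_nz: "\<And>z. norm z < 1 \<Longrightarrow> F z \<noteq> 0"
    and Fs_meas: "Fs \<in> borel_measurable borel"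
    and F_lim: "AE \<zeta> in sphere_measure. (\<lambda>n. F (radius n *\<^sub>R \<zeta>)) \<longlonglongrightarrow> Fs \<zeta>"
    and Fs_nz: "AE \<zeta> in sphere_measure. Fs \<zeta> \<noteq> 0"
    and w_meas: "w \<in> borel_measurable borel" and w_nonneg: "\<And>\<zeta>. 0 \<le> w \<zeta>"
    and w: "AE \<zeta> in sphere_measure. w \<zeta> = 1 / (norm (Fs \<zeta>))\<^sup>2"
    and Q2: "\<And>q. polyfun q \<Longrightarrow> integrable sphere_measure (\<lambda>\<zeta>. (norm (q \<zeta> / Fs \<zeta>))\<^sup>2)"
    and Q1: "\<And>q. polyfun q \<Longrightarrow> integrable sphere_measure (\<lambda>\<zeta>. q \<zeta> / Fs \<zeta>)"
    and Q: "\<And>q. polyfun q \<Longrightarrow> (LINT \<zeta>|sphere_measure. q \<zeta> / Fs \<zeta>) = q 0 / F 0"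
    and sets_mu: "sets \<mu> = sets borel" and prob_mu: "prob_space \<mu>"
    and a_nonneg: "\<And>k. 0 \<le> a k" and x_sphere: "\<And>k. a k > 0 \<Longrightarrow> norm (x k) = 1"
    and nn_mu: "\<And>f. f \<in> borel_measurable borel \<Longrightarrow>
      (\<integral>\<^sup>+z. f z \<partial>\<mu>) = (\<integral>\<^sup>+z. ennreal (w z) * f z \<partial>sphere_measure) + (\<Sum>k. ennreal (a k) * f (x k))"
begin

sublocale mu: finite_sphere_measure \<mu>
proof (rule finite_sphere_measure.intro)
  show "sets \<mu> = sets borel" by (rule sets_mu)
  show "finite_measure \<mu>" using prob_mu by (rule prob_space.finite_measure)
  have "(\<integral>\<^sup>+z. indicator (- sphere 0 1) z \<partial>\<mu>) = (\<integral>\<^sup>+z. ennreal (w z) * indicator (- sphere 0 1) z \<partial>sphere_measure)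
     + (\<Sum>k. ennreal (a k) * indicator (- sphere 0 1) (x k))"
    by (intro nn_mu) simp
  also have "(\<integral>\<^sup>+z. ennreal (w z) * indicator (- sphere 0 1) z \<partial>sphere_measure) = (\<integral>\<^sup>+(z :: complex ^ 'n). 0 \<partial>sphere_measure)"
    by (rule nn_integral_cong_AE) (use AE_sphere_measure in eventually_elim, simp)
  also have "(\<lambda>k. ennreal (a k) * indicator (- sphere 0 1) (x k)) = (\<lambda>k. 0)"
    using a_nonneg x_sphere by (force simp: indicator_def less_le)
  finally have "emeasure \<mu> (- sphere 0 1) = 0"
    using sets_mu by (simp add: nn_integral_indicator)
  then have "- sphere 0 1 \<in> null_sets \<mu>"
    using sets_mu by (intro null_setsI) auto
  from AE_not_in[OF this] show "AE \<zeta> in \<mu>. \<zeta> \<in> sphere 0 1" by simp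
qed

lemma mu_integral_ge:
  assumes "polyfun q"
  shows "(LINT \<zeta>|sphere_measure. (norm (q \<zeta> / Fs \<zeta>))\<^sup>2) \<le> (LINT \<zeta>|\<mu>. (norm (q \<zeta>))\<^sup>2)"
proof -
  have c: "continuous_on UNIV (\<lambda>\<zeta>. (norm (q \<zeta>))\<^sup>2)"
    by (intro continuous_intros continuous_on_polyfun assms)
  have i: "integrable \<mu> (\<lambda>\<zeta>. (norm (q \<zeta>))\<^sup>2)" by (rule mu.integrable_continuous[OF c])
  have m: "(\<lambda>\<zeta>. (norm (q \<zeta>))\<^sup>2) \<in> borel_measurable borel" by (rule borel_measurable_continuous_onI[OF c])
  have "ennreal (LINT \<zeta>|sphere_measure. (norm (q \<zeta> / Fs \<zeta>))\<^sup>2) = (\<integral>\<^sup>+\<zeta>. ennreal ((norm (q \<zeta> / Fs \<zeta>))\<^sup>2) \<partial>sphere_measure)"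
    by (rule nn_integral_eq_integral[symmetric, OF Q2[OF assms]]) simp
  also have "\<dots> = (\<integral>\<^sup>+\<zeta>. ennreal (w \<zeta>) * ennreal ((norm (q \<zeta>))\<^sup>2) \<partial>sphere_measure)"
    by (rule nn_integral_cong_AE)
      (use w in eventually_elim, simp add: norm_divide power_divide flip: ennreal_mult)
  also have "\<dots> \<le> (\<integral>\<^sup>+\<zeta>. ennreal ((norm (q \<zeta>))\<^sup>2) \<partial>\<mu>)"
    using m by (subst nn_mu) auto
  also have "\<dots> = ennreal (LINT \<zeta>|\<mu>. (norm (q \<zeta>))\<^sup>2)"
    by (rule nn_integral_eq_integral[OF i]) simp
  finally show ?thesis by simp
qed

lemma lower_bound:
  assumes "polyfun q" "q 0 = 1"
  shows "1 / (norm (F 0))\<^sup>2 \<le> (LINT \<zeta>|\<mu>. (norm (q \<zeta>))\<^sup>2)"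
proof -
  have "1 / (norm (F 0))\<^sup>2 = (norm (LINT \<zeta>|sphere_measure. q \<zeta> / Fs \<zeta>))\<^sup>2"
    by (simp add: Q assms norm_divide power_divide)
  also have "\<dots> \<le> (LINT \<zeta>|sphere_measure. (norm (q \<zeta> / Fs \<zeta>))\<^sup>2)"
    by (rule sphere.norm_integral_squared_le[OF Q1 Q2]) (rule assms)+
  also have "\<dots> \<le> (LINT \<zeta>|\<mu>. (norm (q \<zeta>))\<^sup>2)" by (rule mu_integral_ge[OF assms(1)])
  finally show ?thesis .
qed

text \<open>The absolutely continuous part already suffices: the weight is positive almost
  everywhere, so a polynomial of norm 0 would vanish almost everywhere on the sphere, against the
  orthogonality of monomials with positive norms.\<close>

sublocale nondegenerate_sphere_measure \<mu>
proof
  fix A :: "(nat ^ 'n) set" and c :: "nat ^ 'n \<Rightarrow> complex"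
  assume A: "finite A" "\<exists>\<alpha>\<in>A. c \<alpha> \<noteq> 0"
  define q where "q = (\<lambda>\<zeta>. \<Sum>\<alpha>\<in>A. c \<alpha> * mmonom \<alpha> \<zeta>)"
  have q: "polyfun q" unfolding q_def by (intro polyfun_sum polyfun.intros)
  obtain \<alpha> where \<alpha>: "\<alpha> \<in> A" "c \<alpha> \<noteq> 0" using A by blast
  have "0 < (norm (c \<alpha>))\<^sup>2 * monom_sqnorm \<alpha>" using \<alpha> monom_sqnorm_pos[of \<alpha>] by simp
  also have "\<dots> \<le> (\<Sum>\<alpha>\<in>A. (norm (c \<alpha>))\<^sup>2 * monom_sqnorm \<alpha>)"
    using A \<alpha> by (intro member_le_sum) (auto intro!: mult_nonneg_nonneg less_imp_le[OF monom_sqnorm_pos])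
  also have "\<dots> = (LINT \<zeta>|sphere_measure. (norm (q \<zeta>))\<^sup>2)"
    unfolding q_def by (rule sphere_sqnorm_monomial_sum[symmetric, OF A(1)])
  finally have pos: "0 < (LINT \<zeta>|sphere_measure. (norm (q \<zeta>))\<^sup>2)" .
  have i: "integrable sphere_measure (\<lambda>\<zeta>. (norm (q \<zeta>))\<^sup>2)"
    by (intro integrable_sphere_continuous continuous_intros continuous_on_polyfun q)
  have "0 < (LINT \<zeta>|sphere_measure. (norm (q \<zeta> / Fs \<zeta>))\<^sup>2)"
  proof (rule ccontr)
    assume "\<not> ?thesis"
    moreover have "0 \<le> (LINT \<zeta>|sphere_measure. (norm (q \<zeta> / Fs \<zeta>))\<^sup>2)"
      by (rule Bochner_Integration.integral_nonneg) simp
    ultimately have "(LINT \<zeta>|sphere_measure. (norm (q \<zeta> / Fs \<zeta>))\<^sup>2) = 0" by linarith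
    then have "AE \<zeta> in sphere_measure. (norm (q \<zeta> / Fs \<zeta>))\<^sup>2 = 0"
      using integral_nonneg_eq_0_iff_AE[OF Q2[OF q]] by simp
    then have "AE \<zeta> in sphere_measure. (norm (q \<zeta>))\<^sup>2 = 0"
      using Fs_nz by eventually_elim auto
    then have "(LINT \<zeta>|sphere_measure. (norm (q \<zeta>))\<^sup>2) = 0"
      using integral_nonneg_eq_0_iff_AE[OF i] by simp
    then show False using pos by simp
  qed
  then show "(LINT \<zeta>|\<mu>. (norm (\<Sum>\<alpha>\<in>A. c \<alpha> * mmonom \<alpha> \<zeta>))\<^sup>2) > 0"
    using mu_integral_ge[OF q] unfolding q_def by linarith
qed

lemma atoms_sum: "summable a" "(\<Sum>k. a k) \<le> 1" and w_int: "integrable sphere_measure w"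
proof -
  have "(\<integral>\<^sup>+z. 1 \<partial>\<mu>) = 1"
    using prob_space.emeasure_space_1[OF prob_mu] by simp
  then have e: "(\<integral>\<^sup>+z. ennreal (w z) \<partial>sphere_measure) + (\<Sum>k. ennreal (a k)) = 1"
    using nn_mu[of "\<lambda>_. 1"] by simp
  then have s: "(\<Sum>k. ennreal (a k)) \<le> 1" and wi: "(\<integral>\<^sup>+z. ennreal (w z) \<partial>sphere_measure) \<le> 1"
    by (metis add.commute le_iff_add)+
  show sa: "summable a"
    by (rule summable_suminf_not_top[OF a_nonneg]) (use s in \<open>auto simp: top_unique\<close>)
  then show "(\<Sum>k. a k) \<le> 1"
    using s a_nonneg by (simp add: suminf_ennreal2)
  show "integrable sphere_measure w"
  proof (rule integrableI_bounded)
    show "w \<in> borel_measurable sphere_measure" using w_meas by simp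
    show "(\<integral>\<^sup>+z. ennreal (norm (w z)) \<partial>sphere_measure) < \<infinity>"
      using wi w_nonneg by (auto simp: le_less_trans[OF _ ennreal_one_less_top])
  qed
qed

lemma mu_integral_eq:
  assumes q: "polyfun q" and C: "\<And>\<zeta>. norm \<zeta> = 1 \<Longrightarrow> norm (q \<zeta>) \<le> C"
  shows "(LINT \<zeta>|\<mu>. (norm (q \<zeta>))\<^sup>2) = (LINT \<zeta>|sphere_measure. w \<zeta> * (norm (q \<zeta>))\<^sup>2) + (\<Sum>k. a k * (norm (q (x k)))\<^sup>2)"
    and "summable (\<lambda>k. a k * (norm (q (x k)))\<^sup>2)"
    and "integrable sphere_measure (\<lambda>\<zeta>. w \<zeta> * (norm (q \<zeta>))\<^sup>2)"
proof -
  have [measurable]: "q \<in> borel_measurable borel" by (rule borel_measurable_polyfun[OF q])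
  note w_meas[measurable]
  have i: "integrable \<mu> (\<lambda>\<zeta>. (norm (q \<zeta>))\<^sup>2)"
    by (intro mu.integrable_continuous continuous_intros continuous_on_polyfun q)
  have le: "a k * (norm (q (x k)))\<^sup>2 \<le> C\<^sup>2 * a k" for k
  proof (cases "a k = 0")
    case False
    then have "(norm (q (x k)))\<^sup>2 \<le> C\<^sup>2"
      using a_nonneg[of k] by (intro power_mono C x_sphere) auto
    then have "a k * (norm (q (x k)))\<^sup>2 \<le> a k * C\<^sup>2" by (rule mult_left_mono[OF _ a_nonneg])
    then show ?thesis by (simp add: mult.commute)
  qed simp
  show s: "summable (\<lambda>k. a k * (norm (q (x k)))\<^sup>2)"
    by (rule summable_comparison_test'[OF summable_mult[OF atoms_sum(1)], of 0 _ "C\<^sup>2"]) (use le a_nonneg in simp)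
  show wi: "integrable sphere_measure (\<lambda>\<zeta>. w \<zeta> * (norm (q \<zeta>))\<^sup>2)"
  proof (rule Bochner_Integration.integrable_bound[OF integrable_mult_right[OF w_int, of "C\<^sup>2"]])
    show "AE \<zeta> in sphere_measure. norm (w \<zeta> * (norm (q \<zeta>))\<^sup>2) \<le> norm (C\<^sup>2 * w \<zeta>)"
      using AE_sphere_measure
    proof eventually_elim
      fix \<zeta> :: "complex ^ 'n" assume "\<zeta> \<in> sphere 0 1"
      then have "(norm (q \<zeta>))\<^sup>2 \<le> C\<^sup>2" by (intro power_mono C) auto
      then have "w \<zeta> * (norm (q \<zeta>))\<^sup>2 \<le> w \<zeta> * C\<^sup>2" by (rule mult_left_mono[OF _ w_nonneg])
      then show "norm (w \<zeta> * (norm (q \<zeta>))\<^sup>2) \<le> norm (C\<^sup>2 * w \<zeta>)"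
        using w_nonneg[of \<zeta>] by (simp add: abs_mult mult.commute)
    qed
  qed simp
  have "ennreal (LINT \<zeta>|\<mu>. (norm (q \<zeta>))\<^sup>2) = (\<integral>\<^sup>+\<zeta>. ennreal ((norm (q \<zeta>))\<^sup>2) \<partial>\<mu>)"
    by (rule nn_integral_eq_integral[symmetric, OF i]) simp
  also have "\<dots> = (\<integral>\<^sup>+\<zeta>. ennreal (w \<zeta>) * ennreal ((norm (q \<zeta>))\<^sup>2) \<partial>sphere_measure) + (\<Sum>k. ennreal (a k) * ennreal ((norm (q (x k)))\<^sup>2))"
    by (rule nn_mu) measurable
  also have "\<dots> = (\<integral>\<^sup>+\<zeta>. ennreal (w \<zeta> * (norm (q \<zeta>))\<^sup>2) \<partial>sphere_measure) + (\<Sum>k. ennreal (a k * (norm (q (x k)))\<^sup>2))"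
    using w_nonneg a_nonneg by (simp add: ennreal_mult)
  also have "(\<integral>\<^sup>+\<zeta>. ennreal (w \<zeta> * (norm (q \<zeta>))\<^sup>2) \<partial>sphere_measure) = ennreal (LINT \<zeta>|sphere_measure. w \<zeta> * (norm (q \<zeta>))\<^sup>2)"
    by (rule nn_integral_eq_integral[OF wi]) (simp add: w_nonneg)
  also have "(\<Sum>k. ennreal (a k * (norm (q (x k)))\<^sup>2)) = ennreal (\<Sum>k. a k * (norm (q (x k)))\<^sup>2)"
    using a_nonneg by (intro suminf_ennreal2 s) simp
  also have "ennreal (LINT \<zeta>|sphere_measure. w \<zeta> * (norm (q \<zeta>))\<^sup>2) + ennreal (\<Sum>k. a k * (norm (q (x k)))\<^sup>2)
      = ennreal ((LINT \<zeta>|sphere_measure. w \<zeta> * (norm (q \<zeta>))\<^sup>2) + (\<Sum>k. a k * (norm (q (x k)))\<^sup>2))"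
    using a_nonneg w_nonneg by (intro ennreal_plus[symmetric] suminf_nonneg s Bochner_Integration.integral_nonneg) auto
  finally show "(LINT \<zeta>|\<mu>. (norm (q \<zeta>))\<^sup>2) = (LINT \<zeta>|sphere_measure. w \<zeta> * (norm (q \<zeta>))\<^sup>2) + (\<Sum>k. a k * (norm (q (x k)))\<^sup>2)"
    using a_nonneg w_nonneg
    by (subst (asm) ennreal_inj) (auto intro!: Bochner_Integration.integral_nonneg suminf_nonneg s add_nonneg_nonneg)
qed

text \<open>Each factor vanishes at its atom, is bounded by 1 on the closed ball and takes the value
  1/(1+d) at the origin, close to 1 for small \<open>d\<close>.\<close>

definition atom_killer :: "real \<Rightarrow> nat set \<Rightarrow> complex ^ 'n \<Rightarrow> complex" where
  "atom_killer d J z = (\<Prod>k\<in>J. (1 - cinner z (x k)) * inverse (of_real (1 + d) - cinner z (x k)))"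

context
  fixes d :: real and J :: "nat set"
  assumes d: "d > 0" and J: "finite J" "\<And>k. k \<in> J \<Longrightarrow> norm (x k) = 1"
begin

text \<open>1 - <z, x k> has nonnegative real part, so adding d > 0 increases the modulus and keeps
  it at least \<open>d\<close>.\<close>

lemma atom_denominator:
  assumes "k \<in> J" "norm z \<le> 1"
  shows "of_real (1 + d) - cinner z (x k) \<noteq> 0"
    "norm ((1 - cinner z (x k)) * inverse (of_real (1 + d) - cinner z (x k))) \<le> 1"
    "norm (of_real (1 + d) - cinner z (x k)) \<ge> d"
proof -
  have "norm (cinner z (x k)) \<le> 1"
    using norm_cinner_le[of z "x k"] assms J by simp
  then have re: "Re (cinner z (x k)) \<le> 1"
    using complex_Re_le_cmod[of "cinner z (x k)"] by linarith
  have "d \<le> Re (of_real (1 + d) - cinner z (x k))" using re by simp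
  also have "\<dots> \<le> norm (of_real (1 + d) - cinner z (x k))" by (rule complex_Re_le_cmod)
  finally show n: "norm (of_real (1 + d) - cinner z (x k)) \<ge> d" .
  then show nz: "of_real (1 + d) - cinner z (x k) \<noteq> 0" using d by auto
  have "(norm (1 - cinner z (x k)))\<^sup>2 \<le> (norm (of_real (1 + d) - cinner z (x k)))\<^sup>2"
  proof -
    have "(1 - Re (cinner z (x k)))\<^sup>2 \<le> (1 + d - Re (cinner z (x k)))\<^sup>2"
      using re d by (intro power_mono) auto
    then show ?thesis by (simp add: cmod_power2)
  qed
  then have "norm (1 - cinner z (x k)) \<le> norm (of_real (1 + d) - cinner z (x k))"
    by (rule power2_le_imp_le) simp
  then show "norm ((1 - cinner z (x k)) * inverse (of_real (1 + d) - cinner z (x k))) \<le> 1"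
  proof -
    have "norm (1 - cinner z (x k)) * inverse (norm (of_real (1 + d) - cinner z (x k)))
       \<le> norm (of_real (1 + d) - cinner z (x k)) * inverse (norm (of_real (1 + d) - cinner z (x k)))"
      using \<open>norm (1 - cinner z (x k)) \<le> _\<close> by (rule mult_right_mono) simp
    also have "\<dots> = 1" using nz by (intro right_inverse) simp
    finally show ?thesis unfolding norm_mult norm_inverse .
  qed
qed

lemma norm_atom_killer_le: "norm z \<le> 1 \<Longrightarrow> norm (atom_killer d J z) \<le> 1"
  unfolding atom_killer_def prod_norm[symmetric] by (intro prod_le_1 conjI norm_ge_zero atom_denominator)

lemma atom_killer_0: "atom_killer d J 0 = of_real ((1 / (1 + d)) ^ card J)"
  by (simp add: atom_killer_def cinner_def divide_inverse)

lemma continuous_on_atom_killer: "continuous_on (cball 0 1) (atom_killer d J)"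
  unfolding atom_killer_def
  by (intro continuous_intros) (use atom_denominator(1) in auto)

lemma atom_killer_holomorphic: "mv_holomorphic_on (atom_killer d J) (ball 0 1)"
proof -
  have c: "mv_holomorphic_on (\<lambda>z. b - cinner z (x k)) (ball 0 1)" for b k
    by (intro mv_holomorphic_on_polyfun polyfun_diff polyfun_const polyfun_cinner_left)
  have "mv_holomorphic_on (\<lambda>z. inverse (of_real (1 + d) - cinner z (x k))) (ball 0 1)" if "k \<in> J" for k
  proof (rule mv_holomorphic_on_compose[OF c])
    fix z :: "complex ^ 'n" assume "z \<in> ball 0 1"
    then have "of_real (1 + d) - cinner z (x k) \<noteq> 0" using that by (intro atom_denominator) auto
    then show "inverse field_differentiable at (of_real (1 + d) - cinner z (x k))"
      by (intro field_differentiable_inverse) auto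
  qed
  then show ?thesis
    unfolding atom_killer_def by (intro mv_holomorphic_on_prod mv_holomorphic_on_mult c)
qed

text \<open>The factor of this atom is at most (1-r)/d and the others at most 1. The rate is
  explicit so that multiplication by the bounded \<open>F\<close> still gives 0 in the limit,
  whatever \<open>F\<close> does near the atom.\<close>

lemma norm_atom_killer_radial_le:
  assumes k: "k \<in> J" and r: "0 < r" "r < 1"
  shows "norm (atom_killer d J (r *\<^sub>R x k)) \<le> (1 - r) / d"
proof -
  have nz: "norm (r *\<^sub>R x k) \<le> 1" using r J(2)[OF k] by simp
  define h where "h = (\<lambda>j. norm ((1 - cinner (r *\<^sub>R x k) (x j)) * inverse (of_real (1 + d) - cinner (r *\<^sub>R x k) (x j))))"
  have c: "cinner (r *\<^sub>R x k) (x k) = of_real r"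
    using J(2)[OF k] by (simp add: scaleR_eq_smult cinner_scale_left cinner_self)
  have "norm (atom_killer d J (r *\<^sub>R x k)) = h k * (\<Prod>j\<in>J - {k}. h j)"
    unfolding atom_killer_def prod_norm[symmetric] h_def by (rule prod.remove[OF J(1) k])
  also have "\<dots> \<le> h k * 1"
    unfolding h_def by (intro mult_left_mono prod_le_1 conjI norm_ge_zero atom_denominator nz) auto
  also have "h k * 1 = norm (of_real (1 - r) :: complex) * inverse (norm (of_real (1 + d) - cinner (r *\<^sub>R x k) (x k)))"
    unfolding h_def norm_mult norm_inverse c by simp
  also have "\<dots> \<le> (1 - r) * inverse d"
    using atom_denominator(3)[OF k nz] d r by (intro mult_mono le_imp_inverse_le) (auto simp del: of_real_diff)
  finally show ?thesis by (simp add: divide_inverse)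
qed

text \<open>The n-th polynomial is within 1/(n+1) on the sphere of the dilation by
  \<open>radius n\<close> of F/F(0) times the killing factors. Uniform boundedness allows dominated
  convergence, and the limit is known both almost everywhere and at the killed atoms.\<close>

lemma approximants:
  defines "B' \<equiv> B / norm (F 0)"
  obtains q where "\<And>n. polyfun (q n)" "\<And>n. q n 0 = of_real ((1 / (1 + d)) ^ card J)"
    "\<And>n \<zeta>. norm \<zeta> = 1 \<Longrightarrow> norm (q n \<zeta>) \<le> B' + 1"
    "\<And>k. k \<in> J \<Longrightarrow> (\<lambda>n. q n (x k)) \<longlonglongrightarrow> 0"
    "AE \<zeta> in sphere_measure. (\<lambda>n. q n \<zeta>) \<longlonglongrightarrow> Fs \<zeta> / F 0 * atom_killer d J \<zeta>"
proof -
  define H where "H = (\<lambda>z. (1 / F 0) * F z * atom_killer d J z)"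
  have F0: "F 0 \<noteq> 0" by (rule F_nz) simp
  have H: "mv_holomorphic_on H (ball 0 1)"
    unfolding H_def by (intro mv_holomorphic_on_mult mv_holomorphic_on_const F atom_killer_holomorphic)
  have B0: "B \<ge> 0" using FB[of 0] norm_ge_zero[of "F 0"] by (simp del: norm_ge_zero)
  have B': "B' \<ge> 0" using B0 by (simp add: B'_def)
  have HB: "norm (H z) \<le> B' * norm (atom_killer d J z)" if "norm z < 1" for z
    unfolding H_def norm_mult B'_def
    using FB[OF that] by (intro mult_right_mono) (auto simp: norm_divide divide_right_mono)
  have "\<exists>q. polyfun q \<and> q 0 = H 0 \<and> (\<forall>z. norm z \<le> 1 \<longrightarrow> norm (H (radius n *\<^sub>R z) - q z) < 1 / (real n + 1))" for n
  proof -
    have "1 / (real n + 1) > 0" by simp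
    from homog_part_approx[OF H radius this] show ?thesis by metis
  qed
  then obtain q where q: "\<And>n. polyfun (q n)" "\<And>n. q n 0 = H 0"
    "\<And>n z. norm z \<le> 1 \<Longrightarrow> norm (H (radius n *\<^sub>R z) - q n z) < 1 / (real n + 1)" by metis
  have H0: "H 0 = of_real ((1 / (1 + d)) ^ card J)"
    using F0 by (simp only: H_def atom_killer_0) simp
  have rn: "norm (radius n *\<^sub>R z) < 1" if "norm z = 1" for n and z :: "complex ^ 'n"
    using radius[of n] that by simp
  have e0: "(\<lambda>n. 1 / (real n + 1)) \<longlonglongrightarrow> 0"
    using LIMSEQ_inverse_real_of_nat by (simp add: inverse_eq_divide add.commute)
  have r1: "radius \<longlonglongrightarrow> 1"
    using filterlim_radius by (simp add: filterlim_at)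
  have qlim: "(\<lambda>n. q n \<zeta>) \<longlonglongrightarrow> l" if "norm \<zeta> = 1" "(\<lambda>n. H (radius n *\<^sub>R \<zeta>)) \<longlonglongrightarrow> l" for \<zeta> l
  proof -
    have "(\<lambda>n. H (radius n *\<^sub>R \<zeta>) - q n \<zeta>) \<longlonglongrightarrow> 0"
      by (rule Lim_null_comparison[OF _ e0]) (use q(3)[of \<zeta>] that less_imp_le in \<open>auto intro!: always_eventually\<close>)
    from tendsto_diff[OF that(2) this] show ?thesis by simp
  qed
  show ?thesis
  proof (rule that)
    show "polyfun (q n)" for n by (rule q(1))
    show "q n 0 = of_real ((1 / (1 + d)) ^ card J)" for n by (simp only: q(2) H0)
    show "norm (q n \<zeta>) \<le> B' + 1" if "norm \<zeta> = 1" for n \<zeta>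
    proof -
      have "norm (H (radius n *\<^sub>R \<zeta>)) \<le> B' * 1"
      proof -
        have "norm (atom_killer d J (radius n *\<^sub>R \<zeta>)) \<le> 1"
          by (rule norm_atom_killer_le) (use rn[OF that, of n] in simp)
        from order_trans[OF HB[OF rn[OF that]] mult_left_mono[OF this B']] show ?thesis .
      qed
      moreover have "norm (q n \<zeta>) \<le> norm (H (radius n *\<^sub>R \<zeta>)) + norm (H (radius n *\<^sub>R \<zeta>) - q n \<zeta>)"
        using norm_triangle_ineq4[of "H (radius n *\<^sub>R \<zeta>)" "H (radius n *\<^sub>R \<zeta>) - q n \<zeta>"] by simp
      moreover have "1 / (real n + 1) \<le> 1" by simp
      ultimately show ?thesis using q(3)[of \<zeta> n] that by linarith
    qed
    show "(\<lambda>n. q n (x k)) \<longlonglongrightarrow> 0" if "k \<in> J" for k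
    proof (rule qlim[OF J(2)[OF that]])
      have "(\<lambda>n. B' * ((1 - radius n) / d)) \<longlonglongrightarrow> B' * ((1 - 1) / d)"
        using d by (intro tendsto_intros r1) auto
      then have t0: "(\<lambda>n. B' * ((1 - radius n) / d)) \<longlonglongrightarrow> 0" by simp
      show "(\<lambda>n. H (radius n *\<^sub>R x k)) \<longlonglongrightarrow> 0"
      proof (rule Lim_null_comparison[OF always_eventually[OF allI] t0])
        fix n
        show "norm (H (radius n *\<^sub>R x k)) \<le> B' * ((1 - radius n) / d)"
          using HB[OF rn[OF J(2)[OF that]], of n] mult_left_mono[OF norm_atom_killer_radial_le[OF that radius] B'] by (rule order_trans)
      qed
    qed
    show "AE \<zeta> in sphere_measure. (\<lambda>n. q n \<zeta>) \<longlonglongrightarrow> Fs \<zeta> / F 0 * atom_killer d J \<zeta>"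
      using F_lim AE_sphere_measure
    proof eventually_elim
      fix \<zeta> :: "complex ^ 'n"
      assume l: "(\<lambda>n. F (radius n *\<^sub>R \<zeta>)) \<longlonglongrightarrow> Fs \<zeta>" and "\<zeta> \<in> sphere 0 1"
      then have \<zeta>: "norm \<zeta> = 1" by simp
      have "(\<lambda>n. radius n *\<^sub>R \<zeta>) \<longlonglongrightarrow> 1 *\<^sub>R \<zeta>" by (intro tendsto_intros r1)
      then have "(\<lambda>n. atom_killer d J (radius n *\<^sub>R \<zeta>)) \<longlonglongrightarrow> atom_killer d J \<zeta>"
        by (intro continuous_on_tendsto_compose[OF continuous_on_atom_killer])
          (use \<zeta> rn[OF \<zeta>] less_imp_le in \<open>auto intro!: always_eventually\<close>)
      then have "(\<lambda>n. H (radius n *\<^sub>R \<zeta>)) \<longlonglongrightarrow> 1 / F 0 * Fs \<zeta> * atom_killer d J \<zeta>"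
        unfolding H_def by (intro tendsto_intros l)
      from qlim[OF \<zeta> this] show "(\<lambda>n. q n \<zeta>) \<longlonglongrightarrow> Fs \<zeta> / F 0 * atom_killer d J \<zeta>" by simp
    qed
  qed
qed

end

text \<open>The order of quantifiers matters: the number \<open>m\<close> of killed atoms depends on
  \<open>e\<close> alone, and \<open>d\<close> is free afterwards. The integral splits into the
  weight part, where the limit has modulus at most 1/|F(0)| against |F|, the killed atoms, which
  vanish in the limit, and the small tail of atoms.\<close>

lemma upper_bound_unnormalized:
  assumes e: "e > 0"
  obtains m :: nat where "\<And>d. d > 0 \<Longrightarrow> \<exists>q. polyfun q \<and> q 0 = of_real ((1 / (1 + d)) ^ m) \<and>
    (LINT \<zeta>|\<mu>. (norm (q \<zeta>))\<^sup>2) \<le> 1 / (norm (F 0))\<^sup>2 + e"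
proof -
  define B' where "B' = B / norm (F 0)"
  define C where "C = B' + 1"
  have F0: "F 0 \<noteq> 0" by (rule F_nz) simp
  have "B \<ge> 0" using FB[of 0] norm_ge_zero[of "F 0"] by (simp del: norm_ge_zero)
  then have C: "C \<ge> 1" by (simp add: C_def B'_def)
  have "(\<lambda>N. C\<^sup>2 * (\<Sum>k. a (k + N))) \<longlonglongrightarrow> C\<^sup>2 * 0"
    by (intro tendsto_mult tendsto_const suminf_exist_split2 atoms_sum)
  then have "\<forall>\<^sub>F N in sequentially. C\<^sup>2 * (\<Sum>k. a (k + N)) < e / 3"
    using e by (intro order_tendstoD(2)) auto
  \<comment> \<open>The polynomials are bounded by \<open>C\<close> on the sphere for every
    \<open>d\<close>, so the atoms beyond \<open>N\<close> contribute less than e/3 independently of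
    \<open>d\<close>.\<close>
  then obtain N where N: "C\<^sup>2 * (\<Sum>k. a (k + N)) < e / 3"
    by (auto simp: eventually_sequentially)
  define J where "J = {k. k < N \<and> a k > 0}"
  have J: "finite J" "\<And>k. k \<in> J \<Longrightarrow> norm (x k) = 1" using x_sphere by (auto simp: J_def)
  show ?thesis
  proof (rule that[of "card J"])
    fix d :: real assume d: "d > 0"
    obtain q where q: "\<And>n. polyfun (q n)" "\<And>n. q n 0 = of_real ((1 / (1 + d)) ^ card J)"
      "\<And>n \<zeta>. norm \<zeta> = 1 \<Longrightarrow> norm (q n \<zeta>) \<le> B / norm (F 0) + 1"
      "\<And>k. k \<in> J \<Longrightarrow> (\<lambda>n. q n (x k)) \<longlonglongrightarrow> 0"
      "AE \<zeta> in sphere_measure. (\<lambda>n. q n \<zeta>) \<longlonglongrightarrow> Fs \<zeta> / F 0 * atom_killer d J \<zeta>"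
      by (rule approximants[OF d J]) (assumption | blast)+
    have qC: "norm (q n \<zeta>) \<le> C" if "norm \<zeta> = 1" for n \<zeta>
      using q(3)[OF that] by (simp add: C_def B'_def)
    have eq1: "(LINT \<zeta>|\<mu>. (norm (q n \<zeta>))\<^sup>2) = (LINT \<zeta>|sphere_measure. w \<zeta> * (norm (q n \<zeta>))\<^sup>2) + (\<Sum>k. a k * (norm (q n (x k)))\<^sup>2)" for n
      by (rule mu_integral_eq[OF q(1)]) (rule qC)
    have eq2: "summable (\<lambda>k. a k * (norm (q n (x k)))\<^sup>2)" for n
      by (rule mu_integral_eq[OF q(1)]) (rule qC)
    have [measurable]: "q n \<in> borel_measurable borel" for n by (rule borel_measurable_polyfun[OF q(1)])
    note w_meas[measurable] Fs_meas[measurable]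
    \<comment> \<open>The killing factor is controlled only on the closed ball; the cut-off makes it
      Borel on the whole space.\<close>
    define k where "k = (\<lambda>\<zeta>. if \<zeta> \<in> cball 0 1 then atom_killer d J \<zeta> else 0)"
    have [measurable]: "k \<in> borel_measurable borel"
      unfolding k_def by (intro borel_measurable_continuous_on_if continuous_on_atom_killer d J) auto
    have lim1: "(\<lambda>n. LINT \<zeta>|sphere_measure. w \<zeta> * (norm (q n \<zeta>))\<^sup>2)
        \<longlonglongrightarrow> (LINT \<zeta>|sphere_measure. w \<zeta> * (norm (Fs \<zeta> / F 0 * k \<zeta>))\<^sup>2)"
    proof (rule integral_dominated_convergence[where w = "\<lambda>\<zeta>. C\<^sup>2 * w \<zeta>"])
      show "integrable sphere_measure (\<lambda>\<zeta>. C\<^sup>2 * w \<zeta>)" using w_int by simp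
      show "AE \<zeta> in sphere_measure. (\<lambda>n. w \<zeta> * (norm (q n \<zeta>))\<^sup>2) \<longlonglongrightarrow> w \<zeta> * (norm (Fs \<zeta> / F 0 * k \<zeta>))\<^sup>2"
        using q(5) AE_sphere_measure
      proof eventually_elim
        fix \<zeta> :: "complex ^ 'n"
        assume l: "(\<lambda>n. q n \<zeta>) \<longlonglongrightarrow> Fs \<zeta> / F 0 * atom_killer d J \<zeta>" and "\<zeta> \<in> sphere 0 1"
        then have "k \<zeta> = atom_killer d J \<zeta>" by (simp add: k_def)
        then show "(\<lambda>n. w \<zeta> * (norm (q n \<zeta>))\<^sup>2) \<longlonglongrightarrow> w \<zeta> * (norm (Fs \<zeta> / F 0 * k \<zeta>))\<^sup>2"
          using l by (simp only:) (intro tendsto_intros)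
      qed
      show "AE \<zeta> in sphere_measure. norm (w \<zeta> * (norm (q n \<zeta>))\<^sup>2) \<le> C\<^sup>2 * w \<zeta>" for n
        using AE_sphere_measure
      proof eventually_elim
        fix \<zeta> :: "complex ^ 'n" assume "\<zeta> \<in> sphere 0 1"
        then have "(norm (q n \<zeta>))\<^sup>2 \<le> C\<^sup>2" by (intro power_mono qC) auto
        then have "w \<zeta> * (norm (q n \<zeta>))\<^sup>2 \<le> w \<zeta> * C\<^sup>2" by (rule mult_left_mono[OF _ w_nonneg])
        then show "norm (w \<zeta> * (norm (q n \<zeta>))\<^sup>2) \<le> C\<^sup>2 * w \<zeta>"
          using w_nonneg[of \<zeta>] by (simp add: abs_mult mult.commute)
      qed
    qed simp_all
    \<comment> \<open>The weight cancels the squared modulus of \<open>Fs\<close>, leaving the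
      squared killing factor over |F(0)|^2.\<close>
    have le1: "(LINT \<zeta>|sphere_measure. w \<zeta> * (norm (Fs \<zeta> / F 0 * k \<zeta>))\<^sup>2) \<le> 1 / (norm (F 0))\<^sup>2"
    proof -
      have bd: "AE \<zeta> in sphere_measure. w \<zeta> * (norm (Fs \<zeta> / F 0 * k \<zeta>))\<^sup>2 \<le> 1 / (norm (F 0))\<^sup>2"
        using w Fs_nz AE_sphere_measure
      proof eventually_elim
        fix \<zeta> :: "complex ^ 'n"
        assume w: "w \<zeta> = 1 / (norm (Fs \<zeta>))\<^sup>2" and nz: "Fs \<zeta> \<noteq> 0" and "\<zeta> \<in> sphere 0 1"
        then have "norm (k \<zeta>) \<le> 1" using norm_atom_killer_le[OF d J] by (simp add: k_def)
        then have "(norm (k \<zeta>))\<^sup>2 \<le> 1" by (simp add: power_le_one)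
        then have "(norm (k \<zeta>))\<^sup>2 / (norm (F 0))\<^sup>2 \<le> 1 / (norm (F 0))\<^sup>2" by (intro divide_right_mono) auto
        then show "w \<zeta> * (norm (Fs \<zeta> / F 0 * k \<zeta>))\<^sup>2 \<le> 1 / (norm (F 0))\<^sup>2"
          using nz by (simp add: w norm_mult norm_divide power_mult_distrib power_divide)
      qed
      have "(LINT \<zeta>|sphere_measure. w \<zeta> * (norm (Fs \<zeta> / F 0 * k \<zeta>))\<^sup>2) \<le> (LINT (\<zeta> :: complex ^ 'n)|sphere_measure. 1 / (norm (F 0))\<^sup>2)"
      proof (rule integral_mono_AE)
        show "integrable sphere_measure (\<lambda>\<zeta>. w \<zeta> * (norm (Fs \<zeta> / F 0 * k \<zeta>))\<^sup>2)"
          by (rule sphere.integrable_const_bound[where B = "1 / (norm (F 0))\<^sup>2"]) (use bd w_nonneg in \<open>auto simp: abs_mult\<close>)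
      qed (use bd in auto)
      then show ?thesis by (simp add: sphere.prob_space[simplified])
    qed
    have "\<forall>\<^sub>F n in sequentially. (LINT \<zeta>|sphere_measure. w \<zeta> * (norm (q n \<zeta>))\<^sup>2) < 1 / (norm (F 0))\<^sup>2 + e / 3"
      using le1 e by (intro order_tendstoD(2)[OF lim1]) linarith
    moreover have "(\<lambda>n. \<Sum>k<N. a k * (norm (q n (x k)))\<^sup>2) \<longlonglongrightarrow> (\<Sum>k<N. 0)"
    proof (rule tendsto_sum)
      fix j assume "j \<in> {..<N}"
      show "(\<lambda>n. a j * (norm (q n (x j)))\<^sup>2) \<longlonglongrightarrow> 0"
      proof (cases "a j = 0")
        case False
        then have "j \<in> J" using \<open>j \<in> {..<N}\<close> a_nonneg[of j] by (simp add: J_def)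
        then have "(\<lambda>n. a j * (norm (q n (x j)))\<^sup>2) \<longlonglongrightarrow> a j * (norm (0 :: complex))\<^sup>2"
          by (intro tendsto_intros q(4))
        then show ?thesis by simp
      qed simp
    qed
    then have "\<forall>\<^sub>F n in sequentially. (\<Sum>k<N. a k * (norm (q n (x k)))\<^sup>2) < e / 3"
      using e by (intro order_tendstoD(2)) auto
    ultimately have "\<forall>\<^sub>F n in sequentially. (LINT \<zeta>|\<mu>. (norm (q n \<zeta>))\<^sup>2) \<le> 1 / (norm (F 0))\<^sup>2 + e"
    proof eventually_elim
      case (elim n)
      have tail: "(\<Sum>k. a (k + N) * (norm (q n (x (k + N))))\<^sup>2) \<le> (\<Sum>k. C\<^sup>2 * a (k + N))"
      proof (rule suminf_le)
        show "summable (\<lambda>k. C\<^sup>2 * a (k + N))"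
          by (intro summable_mult summable_ignore_initial_segment atoms_sum)
        show "summable (\<lambda>k. a (k + N) * (norm (q n (x (k + N))))\<^sup>2)"
          by (rule summable_ignore_initial_segment[OF eq2])
        fix k
        show "a (k + N) * (norm (q n (x (k + N))))\<^sup>2 \<le> C\<^sup>2 * a (k + N)"
        proof (cases "a (k + N) = 0")
          case False
          then have "(norm (q n (x (k + N))))\<^sup>2 \<le> C\<^sup>2"
            using a_nonneg[of "k + N"] by (intro power_mono qC x_sphere) auto
          then have "a (k + N) * (norm (q n (x (k + N))))\<^sup>2 \<le> a (k + N) * C\<^sup>2"
            by (rule mult_left_mono[OF _ a_nonneg])
          then show ?thesis by (simp add: mult.commute)
        qed simp
      qed
      have "(\<Sum>k. C\<^sup>2 * a (k + N)) = C\<^sup>2 * (\<Sum>k. a (k + N))"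
        by (intro suminf_mult summable_ignore_initial_segment atoms_sum)
      moreover have "(\<Sum>k. a k * (norm (q n (x k)))\<^sup>2)
         = (\<Sum>k. a (k + N) * (norm (q n (x (k + N))))\<^sup>2) + (\<Sum>k<N. a k * (norm (q n (x k)))\<^sup>2)"
        by (rule suminf_split_initial_segment[OF eq2])
      ultimately show ?case
        using elim tail N unfolding eq1 by linarith
    qed
    then obtain n where "(LINT \<zeta>|\<mu>. (norm (q n \<zeta>))\<^sup>2) \<le> 1 / (norm (F 0))\<^sup>2 + e"
      by (auto simp: eventually_sequentially)
    then show "\<exists>q. polyfun q \<and> q 0 = of_real ((1 / (1 + d)) ^ card J) \<and>
      (LINT \<zeta>|\<mu>. (norm (q \<zeta>))\<^sup>2) \<le> 1 / (norm (F 0))\<^sup>2 + e"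
      using q(1,2) by blast
  qed
qed

text \<open>Multiplication by (1+d)^m restores the value 1 at the origin. It costs (1+d)^(2m), which
  tends to 1 as d does to 0 because \<open>m\<close> is fixed.\<close>

lemma upper_bound:
  assumes e: "e > 0"
  obtains q where "polyfun q" "q 0 = 1" "(LINT \<zeta>|\<mu>. (norm (q \<zeta>))\<^sup>2) < 1 / (norm (F 0))\<^sup>2 + e"
proof -
  define L where "L = 1 / (norm (F 0))\<^sup>2"
  obtain m where m: "\<And>d. d > 0 \<Longrightarrow> \<exists>q. polyfun q \<and> q 0 = of_real ((1 / (1 + d)) ^ m) \<and> (LINT \<zeta>|\<mu>. (norm (q \<zeta>))\<^sup>2) \<le> L + e / 2"
    using upper_bound_unnormalized[of "e / 2"] e unfolding L_def by auto
  have "((\<lambda>d. ((1 + d) ^ m)\<^sup>2 * (L + e / 2)) \<longlongrightarrow> ((1 + 0) ^ m)\<^sup>2 * (L + e / 2)) (at_right (0::real))"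
    by (intro tendsto_intros)
  then have "\<forall>\<^sub>F d in at_right (0::real). ((1 + d) ^ m)\<^sup>2 * (L + e / 2) < L + e"
    using e by (intro order_tendstoD(2)) auto
  moreover have "\<forall>\<^sub>F d in at_right (0::real). d > 0" by (rule eventually_at_right_less)
  ultimately have "\<forall>\<^sub>F d in at_right (0::real). ((1 + d) ^ m)\<^sup>2 * (L + e / 2) < L + e \<and> d > 0"
    by (rule eventually_conj)
  then obtain d :: real where d: "((1 + d) ^ m)\<^sup>2 * (L + e / 2) < L + e" "d > 0"
    using eventually_happens' trivial_limit_at_right_real by blast
  obtain q where q: "polyfun q" "q 0 = of_real ((1 / (1 + d)) ^ m)" "(LINT \<zeta>|\<mu>. (norm (q \<zeta>))\<^sup>2) \<le> L + e / 2"
    using m[OF d(2)] by blast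
  define q' where "q' = (\<lambda>z. of_real ((1 + d) ^ m) * q z)"
  show ?thesis
  proof (rule that)
    show "polyfun q'" unfolding q'_def by (rule polyfun.cmult[OF q(1)])
    have "(1 + d) ^ m * (1 / (1 + d)) ^ m = 1"
      using d(2) by (simp flip: power_mult_distrib)
    then show "q' 0 = 1"
      unfolding q'_def q(2) of_real_mult[symmetric] by simp
    have "(LINT \<zeta>|\<mu>. (norm (q' \<zeta>))\<^sup>2) = ((1 + d) ^ m)\<^sup>2 * (LINT \<zeta>|\<mu>. (norm (q \<zeta>))\<^sup>2)"
      by (simp only: q'_def norm_mult norm_of_real power_mult_distrib power2_abs integral_mult_right_zero)
    also have "\<dots> \<le> ((1 + d) ^ m)\<^sup>2 * (L + e / 2)"
      by (intro mult_left_mono q(3)) simp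
    finally show "(LINT \<zeta>|\<mu>. (norm (q' \<zeta>))\<^sup>2) < 1 / (norm (F 0))\<^sup>2 + e"
      using d(1) unfolding L_def by linarith
  qed
qed

end

section \<open>Convergence of the partial products and conclusion\<close>

lemma mmonom_at_0: "mmonom \<alpha> 0 = (if \<alpha> = 0 then 1 else 0)"
  by (auto simp: mmonom_def vec_eq_iff)

text \<open>Every residual takes the value 1 at the origin, which gives the lower bound. A nearly
  optimal polynomial involves finitely many monomials, so from some index on it competes with the
  residual and gives the upper bound.\<close>

lemma verblunsky_product_limit:
  fixes \<mu> :: "(('n::{finite,linorder}) cspace) measure"
  assumes "outer_weight_measure F Fs B w \<mu> a x"
  shows "(\<lambda>n. \<Prod>k<n. 1 - (norm (verblunsky \<mu> 0 (shortlex_enum k)))\<^sup>2) \<longlonglongrightarrow> 1 / (norm (F 0))\<^sup>2"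
proof -
  interpret outer_weight_measure F Fs B w \<mu> a x by (rule assms)
  let ?P = "\<lambda>n. \<Prod>k<n. 1 - (norm (verblunsky \<mu> 0 (shortlex_enum k)))\<^sup>2"
  note vp = verblunsky_product[OF nondegenerate_sphere_measure_axioms prob_mu]
  have lower: "1 / (norm (F 0))\<^sup>2 \<le> ?P n" if n: "n > 0" for n
  proof -
    obtain f where f: "is_residual \<mu> 0 (shortlex_between n) f" "?P n = (LINT \<zeta>|\<mu>. (norm (f \<zeta>))\<^sup>2)"
      using vp[OF n] by blast
    have "f 0 = 1"
    proof -
      obtain y where "f = (\<lambda>\<zeta>. mmonom 0 \<zeta> - (\<Sum>j\<in>shortlex_between n. y j * mmonom j \<zeta>))"
        using f(1) by (auto simp: is_residual_def)
      moreover have "(\<Sum>j\<in>shortlex_between n. y j * mmonom j 0) = 0"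
        using zero_notin_shortlex_between[of n] by (intro sum.neutral) (auto simp: mmonom_at_0)
      ultimately show ?thesis by simp
    qed
    then show ?thesis
      unfolding f(2) by (intro lower_bound is_residual_polyfun[OF f(1)])
  qed
  have upper: "\<forall>\<^sub>F n in sequentially. ?P n < 1 / (norm (F 0))\<^sup>2 + e" if e: "e > 0" for e
  proof -
    obtain q where q: "polyfun q" "q 0 = 1" "(LINT \<zeta>|\<mu>. (norm (q \<zeta>))\<^sup>2) < 1 / (norm (F 0))\<^sup>2 + e"
      using upper_bound[OF e] by blast
    obtain A c where A: "finite A" and qA: "q = (\<lambda>z. \<Sum>\<alpha>\<in>A. c \<alpha> * mmonom \<alpha> z)"
      using polyfun_representation[OF q(1)] by blast
    have "finite (inv shortlex_enum ` A)" using A by simp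
    then obtain n0 where n0: "\<And>i. i \<in> inv shortlex_enum ` A \<Longrightarrow> i < n0"
      by (meson finite_nat_set_iff_bounded)
    have "?P n < 1 / (norm (F 0))\<^sup>2 + e" if n: "n \<ge> max n0 1" for n
    proof -
      let ?S = "shortlex_between n :: 'n mindex set"
      have AS: "A \<subseteq> insert 0 ?S"
      proof
        fix \<alpha> assume "\<alpha> \<in> A"
        define i where "i = inv shortlex_enum \<alpha>"
        have \<alpha>: "\<alpha> = shortlex_enum i"
          unfolding i_def using bij_is_surj[OF bij_shortlex_enum[where 'n = 'n]] by (simp add: surj_f_inv_f)
        have "i < n" using n0[of i] n \<open>\<alpha> \<in> A\<close> by (auto simp: i_def)
        then show "\<alpha> \<in> insert 0 ?S"
          unfolding \<alpha> shortlex_between_eq using shortlex_enum_0[where 'n = 'n] by (cases "i = 0") auto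
      qed
      define b where "b = (\<lambda>j. if j \<in> A then c j else 0)"
      have S: "finite ?S" "0 \<notin> ?S" by (rule finite_shortlex_between zero_notin_shortlex_between)+
      have qb: "q z = b 0 + (\<Sum>j\<in>?S. b j * mmonom j z)" for z
      proof -
        have "q z = (\<Sum>j\<in>insert 0 ?S. b j * mmonom j z)"
          unfolding qA using AS S by (intro sum.mono_neutral_cong_left) (auto simp: b_def)
        then show ?thesis using S by simp
      qed
      have "(\<Sum>j\<in>?S. b j * mmonom j 0) = 0"
        using S by (intro sum.neutral) (auto simp: mmonom_at_0)
      then have "b 0 = 1" using q(2) qb[of 0] by simp
      then have qr: "q = (\<lambda>\<zeta>. mmonom 0 \<zeta> - (\<Sum>j\<in>?S. (- b j) * mmonom j \<zeta>))"
        by (simp add: fun_eq_iff qb sum_negf)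
      obtain f where f: "is_residual \<mu> 0 ?S f" "?P n = (LINT \<zeta>|\<mu>. (norm (f \<zeta>))\<^sup>2)"
        using vp[of n] n by auto
      have "?P n \<le> (LINT \<zeta>|\<mu>. (norm (q \<zeta>))\<^sup>2)"
        unfolding f(2) qr by (rule residual_minimal[OF f(1)])
      then show ?thesis using q(3) by linarith
    qed
    then show ?thesis unfolding eventually_sequentially by blast
  qed
  show ?thesis
  proof (rule order_tendstoI)
    show "\<forall>\<^sub>F n in sequentially. y < ?P n" if "y < 1 / (norm (F 0))\<^sup>2" for y
      using eventually_gt_at_top[of 0] by eventually_elim (use lower that in \<open>blast intro: less_le_trans\<close>)
    show "\<forall>\<^sub>F n in sequentially. ?P n < y" if "1 / (norm (F 0))\<^sup>2 < y" for y
      using upper[of "y - 1 / (norm (F 0))\<^sup>2"] that by simp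
  qed
qed

text \<open>Integrability of the logarithm is part of the conclusion because the Bochner integral of
  a non-integrable function is 0 by convention, which would give the right-hand side a spurious
  value.\<close>

theorem theorem7p2:
  fixes p :: real
    and g :: "('n::{finite,linorder}) cspace \<Rightarrow> complex"
    and w :: "'n cspace \<Rightarrow> real"
    and \<mu> \<mu>s :: "('n cspace) measure"
  assumes p: "1 \<le> p"
    and g: "g \<in> hardy_space p" "hardy_norm p g \<le> 1"
    and inv_g: "\<forall>z\<in>ball 0 1. g z \<noteq> 0" "(\<lambda>z. 1 / g z) \<in> hardy_inf"
    and w: "w = (\<lambda>\<zeta>. norm (boundary_value g \<zeta>) powr p)"
    and \<mu>s: "discrete_on_sphere \<mu>s"
    and \<mu>: "sets \<mu> = sets borel"
      "\<forall>A\<in>sets borel. emeasure \<mu> A = emeasure (density sphere_measure (\<lambda>\<zeta>. ennreal (w \<zeta>))) A + emeasure \<mu>s A"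
      "prob_space \<mu>"
  shows "integrable sphere_measure (\<lambda>\<zeta>. ln (w \<zeta>)) \<and>
    (\<lambda>n. \<Prod>k<n. 1 - (norm (verblunsky \<mu> 0 (shortlex_enum k)))\<^sup>2)
      \<longlonglongrightarrow> exp (LINT \<zeta>|sphere_measure. ln (w \<zeta>))"
proof -
  have "0 < p" using p by simp
  obtain F Fs B where
    F: "mv_holomorphic_on F (ball 0 1)" "F \<in> borel_measurable borel" "\<And>z. norm z < 1 \<Longrightarrow> norm (F z) \<le> B"
    "\<And>z. norm z < 1 \<Longrightarrow> F z \<noteq> 0"
    "Fs \<in> borel_measurable borel"
    "AE \<zeta> in sphere_measure. (\<lambda>n. F (radius n *\<^sub>R \<zeta>)) \<longlonglongrightarrow> Fs \<zeta>"
    "AE \<zeta> in sphere_measure. Fs \<zeta> \<noteq> 0"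
    "AE \<zeta> in sphere_measure. norm (boundary_value g \<zeta>) powr p = 1 / (norm (Fs \<zeta>))\<^sup>2"
    "\<And>q. polyfun q \<Longrightarrow> integrable sphere_measure (\<lambda>\<zeta>. (norm (q \<zeta> / Fs \<zeta>))\<^sup>2)"
    "\<And>q. polyfun q \<Longrightarrow> integrable sphere_measure (\<lambda>\<zeta>. q \<zeta> / Fs \<zeta>)"
    "\<And>q. polyfun q \<Longrightarrow> (LINT \<zeta>|sphere_measure. q \<zeta> / Fs \<zeta>) = q 0 / F 0"
    and lnFs: "integrable sphere_measure (\<lambda>\<zeta>. ln (norm (Fs \<zeta>)))"
    "(LINT \<zeta>|sphere_measure. ln (norm (Fs \<zeta>))) = ln (norm (F 0))"
    by (rule outer_factor[OF \<open>0 < p\<close> g(1) inv_g]) blast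
  have F0: "F 0 \<noteq> 0" by (rule F(4)) simp
  have w_eq: "AE \<zeta> in sphere_measure. w \<zeta> = 1 / (norm (Fs \<zeta>))\<^sup>2"
    using F(8) by (simp add: w)
  have "continuous_on (ball 0 1) g"
    using g(1) by (auto simp: hardy_space_def intro: mv_holomorphic_on_imp_continuous_on)
  then have w_meas [measurable]: "w \<in> borel_measurable borel"
    unfolding w using measurable_boundary_value by measurable
  obtain I \<rho> x where I: "\<And>k. k \<in> I \<Longrightarrow> \<rho> k > 0 \<and> x k \<in> sphere 0 1" and sets_s: "sets \<mu>s = sets borel"
    and em: "\<And>A. A \<in> sets borel \<Longrightarrow> emeasure \<mu>s A = (\<Sum>k. if k \<in> I then ennreal (\<rho> k) * indicator A (x k) else 0)"
    using \<mu>s unfolding discrete_on_sphere_def by blast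
  \<comment> \<open>Zero masses outside \<open>I\<close> turn the possibly finite or empty family of
    atoms into a sequence.\<close>
  define a where "a = (\<lambda>k::nat. if k \<in> I then \<rho> k else 0)"
  have nn: "(\<integral>\<^sup>+z. f z \<partial>\<mu>) = (\<integral>\<^sup>+z. ennreal (w z) * f z \<partial>sphere_measure) + (\<Sum>k. ennreal (a k) * f (x k))"
    if f: "f \<in> borel_measurable borel" for f
  proof -
    have "(\<integral>\<^sup>+z. f z \<partial>\<mu>) = (\<integral>\<^sup>+z. f z \<partial>density sphere_measure (\<lambda>\<zeta>. ennreal (w \<zeta>))) + (\<integral>\<^sup>+z. f z \<partial>\<mu>s)"
      by (rule nn_integral_add_measures)
        (use \<mu> sets_s f measurable_cong_sets[OF \<mu>(1) refl] in auto)
    also have "(\<integral>\<^sup>+z. f z \<partial>\<mu>s) = (\<Sum>k. ennreal (a k) * f (x k))"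
      by (rule nn_integral_atoms[OF sets_s _ f])
        (simp add: em a_def if_distrib[of ennreal] if_distrib[of "\<lambda>c. c * _"] cong: if_cong)
    also have "(\<integral>\<^sup>+z. f z \<partial>density sphere_measure (\<lambda>\<zeta>. ennreal (w \<zeta>))) = (\<integral>\<^sup>+z. ennreal (w z) * f z \<partial>sphere_measure)"
      using f by (simp add: nn_integral_density)
    finally show ?thesis .
  qed
  have "outer_weight_measure F Fs B w \<mu> a x"
  proof (rule outer_weight_measure.intro)
    show "0 \<le> w \<zeta>" for \<zeta> by (simp add: w)
    show "0 \<le> a k" for k using I by (auto simp: a_def less_imp_le)
    show "norm (x k) = 1" if "a k > 0" for k
      using I that by (auto simp: a_def split: if_splits)
  qed (rule F(1,2,3,4,5,6,7,9,10,11) w_meas w_eq \<mu>(1,3) nn | assumption)+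
  then have lim: "(\<lambda>n. \<Prod>k<n. 1 - (norm (verblunsky \<mu> 0 (shortlex_enum k)))\<^sup>2) \<longlonglongrightarrow> 1 / (norm (F 0))\<^sup>2"
    by (rule verblunsky_product_limit)
  have ln_w: "AE \<zeta> in sphere_measure. - 2 * ln (norm (Fs \<zeta>)) = ln (w \<zeta>)"
    using w_eq F(7) by eventually_elim (simp add: ln_div ln_realpow)
  have i2: "integrable sphere_measure (\<lambda>\<zeta>. - 2 * ln (norm (Fs \<zeta>)))"
    by (rule integrable_mult_right[OF lnFs(1)])
  have int: "integrable sphere_measure (\<lambda>\<zeta>. ln (w \<zeta>))"
    by (rule Bochner_Integration.integrable_cong_AE_imp[OF i2]) (use ln_w in auto)
  have "(LINT \<zeta>|sphere_measure. ln (w \<zeta>)) = (LINT \<zeta>|sphere_measure. - 2 * ln (norm (Fs \<zeta>)))"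
    by (rule integral_cong_AE) (use ln_w F(5) in auto)
  also have "\<dots> = - 2 * ln (norm (F 0))"
    by (simp only: integral_mult_right_zero lnFs(2))
  finally have "exp (LINT \<zeta>|sphere_measure. ln (w \<zeta>)) = 1 / (norm (F 0))\<^sup>2"
    using F0 by (simp add: exp_minus exp_double inverse_eq_divide)
  then show ?thesis using int lim by simp
qed

end
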